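(* Let $H>0$, $l>1$, and let $\{X(t), t\in\mathbb{R}^+\}$ be a (wide sense) discrete scale invariant (DSI) process with index $H$ and scale $l$. Let $q\in\mathbb{N}$ and $1\le s_0<s_1<\cdots<s_{q-1}<l$. For $n\in\mathbb{Z}$ and $u=0,\ldots,q-1$ put $V^u(n)=X(l^n s_u)$ and $V(n)=\big(V^0(n),\ldots,V^{q-1}(n)\big)$. Then $V$ is a multi-dimensional embedded self-similar process, and the following hold. (i) For each fixed $u\in\{0,\ldots,q-1\}$ and all $n\in\mathbb{Z}$, $V^u(n)$ has the harmonic like representation $$V^u(n)=(l^n s_u)^H\int_0^{2\pi}e^{i\omega n}\,d\phi_u(\omega),$$ where $\phi_0,\ldots,\phi_{q-1}$ are orthogonal spectral measures, with $E[d\phi_u(\omega)\overline{d\phi_\nu(\omega')}]=dG^H_{u,\nu}(\omega)$ when $\omega=\omega'$ and $=0$ when $\omega\ne\omega'$, for $u,\nu=0,\ldots,q-1$. (ii) The spectral density matrix of $\{V(n)\equiv U(l^n)\}$, where $U(l^n)=\big(X(l^ns_0),\ldots,X(l^ns_{q-1})\big)$, is $g^H(\omega)=[g^H_{u,\nu}(\omega)]_{u,\nu=0,\ldots,q-1}$, where the elements $g^H_{u,\nu}(\omega)=dG^H_{u,\nu}(\omega)/d\omega$ are $$g^H_{u,\nu}(\omega)=\frac{(s_us_\nu)^{-H}}{2\pi}\sum_{\tau=-\infty}^{\infty}l^{-H\tau}e^{-i\omega\tau}Q^H_{u,\nu}(\tau),$$ and $Q^H_{u,\nu}(\tau)=E[V^u(\tau)V^\nu(0)]$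 is the covariance function of $V^u(\tau)$ and $V^\nu(0)$.
   Context: All processes are real-valued, and scale invariance and self-similarity are understood in the wide sense. A process $\{X(t),t\in\mathbb{R}^+\}$ is (wide sense) DSI with index $H$ and scale $l$ if for all $t,s>0$: $E[X^2(t)]<\infty$, $E[X(lt)]=l^HE[X(t)]$, and $E[X(lt)X(ls)]=l^{2H}E[X(t)X(s)]$. A process $\{Z(k),k\in\hat T\}$, $\hat T$ a countable subset of $(0,\infty)$, is (wide sense) self-similar with index $H$ and parameter space $\hat T$ if for all $k,k_1\in\hat T$ and all $c>0$ with $ck,ck_1\in\hat T$: $E[Z^2(k)]<\infty$, $E[Z(ck)]=c^HE[Z(k)]$, $E[Z(ck)Z(ck_1)]=c^{2H}E[Z(k)Z(k_1)]$. A process $U(t)=(U^0(t),\ldots,U^{q-1}(t))$ with parameter space $\{l^n:n\in\mathbb{Z}\}$ is a multi-dimensional self-similar process if (a) each $U^j$ is self-similar (index $H$) with parameter space $\{l^n:n\in\mathbb{Z}\}$, and (b) $\mathrm{Cov}\big(U^j(l^{n+\tau}),U^k(l^n)\big)=l^{2nH}\mathrm{Cov}\big(U^j(l^\tau),U^k(1)\big)$ for all $n,\tau\in\mathbb{Z}$ and $j,k=0,\ldots,q-1$. A process $V(n)$, $n\in\mathbb{Z}$, is a multi-dimensional embedded self-similar process if $V(n)=U(l^n)$ for such a $U$. "Covariance function" of $V^u(\tau)$ and $V^\nu(0)$ means the second moment $E[V^u(\tau)V^\nu(0)]$. The $\phi_u$ are random measures on $[0,2\pi)$, and $G^H_{u,\nu}(A)=E[\phi_u(A)\overline{\phi_\nu(A)}]$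 for Borel sets $A$, with $E[\phi_u(A)\overline{\phi_\nu(A')}]=0$ for disjoint $A,A'$; the $G^H_{u,\nu}$ are complex-valued, $\sigma$-additive set functions of bounded variation.
   Formalization: In (ii), since dG/dω need not exist nor the series converge (e.g. X(t)=t^H ξ), the formula is shown for any existing density at a.e. ω where the symmetric partial sums converge; existence of the density is shown when the sum over τ of |l^{-Hτ}Q(τ)| is finite. *)

theory Defs
  imports "HOL-Probability.Probability"
begin

text \<open>Processes are families of real random variables on a probability space \<open>M\<close>.
  Only the values \<open>X t\<close> at times \<open>t > 0\<close> are relevant.\<close>

definition wide_sense_DSI :: "'a measure \<Rightarrow> real \<Rightarrow> real \<Rightarrow> (real \<Rightarrow> 'a \<Rightarrow> real) \<Rightarrow> bool" where
  "wide_sense_DSI M H l X \<longleftrightarrow>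
     (\<forall>t>0. X t \<in> borel_measurable M \<and> integrable M (\<lambda>x. (X t x)\<^sup>2) \<and>
        (\<integral>x. X (l * t) x \<partial>M) = l powr H * (\<integral>x. X t x \<partial>M)) \<and>
     (\<forall>t>0. \<forall>s>0.
        (\<integral>x. X (l * t) x * X (l * s) x \<partial>M) = l powr (2 * H) * (\<integral>x. X t x * X s x \<partial>M))"

definition wide_sense_self_similar ::
  "'a measure \<Rightarrow> real \<Rightarrow> real set \<Rightarrow> (real \<Rightarrow> 'a \<Rightarrow> real) \<Rightarrow> bool" where
  "wide_sense_self_similar M H T Z \<longleftrightarrow>
     countable T \<and> T \<subseteq> {0<..} \<and>
     (\<forall>k\<in>T. Z k \<in> borel_measurable M \<and> integrable M (\<lambda>x. (Z k x)\<^sup>2)) \<and>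
     (\<forall>k\<in>T. \<forall>c>0. c * k \<in> T \<longrightarrow>
        (\<integral>x. Z (c * k) x \<partial>M) = c powr H * (\<integral>x. Z k x \<partial>M)) \<and>
     (\<forall>k\<in>T. \<forall>k1\<in>T. \<forall>c>0. c * k \<in> T \<longrightarrow> c * k1 \<in> T \<longrightarrow>
        (\<integral>x. Z (c * k) x * Z (c * k1) x \<partial>M) = c powr (2 * H) * (\<integral>x. Z k x * Z k1 x \<partial>M))"

definition covariance :: "'a measure \<Rightarrow> ('a \<Rightarrow> real) \<Rightarrow> ('a \<Rightarrow> real) \<Rightarrow> real" where
  "covariance M Y Z = (\<integral>x. (Y x - (\<integral>y. Y y \<partial>M)) * (Z x - (\<integral>y. Z y \<partial>M)) \<partial>M)"

text \<open>\<open>U j t\<close> is the \<open>j\<close>-th component (\<open>j < q\<close>) of the process at time \<open>t\<close>.\<close>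

definition multi_dim_self_similar ::
  "'a measure \<Rightarrow> real \<Rightarrow> real \<Rightarrow> nat \<Rightarrow> (nat \<Rightarrow> real \<Rightarrow> 'a \<Rightarrow> real) \<Rightarrow> bool" where
  "multi_dim_self_similar M H l q U \<longleftrightarrow>
     (\<forall>j<q. wide_sense_self_similar M H (range (\<lambda>n::int. l powi n)) (U j)) \<and>
     (\<forall>n \<tau> :: int. \<forall>j<q. \<forall>k<q.
        covariance M (U j (l powi (n + \<tau>))) (U k (l powi n)) =
        l powr (2 * of_int n * H) * covariance M (U j (l powi \<tau>)) (U k 1))"

definition multi_dim_embedded_self_similar ::
  "'a measure \<Rightarrow> real \<Rightarrow> real \<Rightarrow> nat \<Rightarrow> (nat \<Rightarrow> int \<Rightarrow> 'a \<Rightarrow> real) \<Rightarrow> bool" where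
  "multi_dim_embedded_self_similar M H l q V \<longleftrightarrow>
     (\<exists>U. multi_dim_self_similar M H l q U \<and> (\<forall>j<q. \<forall>n. V j n = U j (l powi n)))"

definition freq_space :: "real measure" where
  "freq_space = restrict_space borel {0..<2 * pi}"

definition mean_square_tendsto ::
  "'a measure \<Rightarrow> (nat \<Rightarrow> 'a \<Rightarrow> complex) \<Rightarrow> ('a \<Rightarrow> complex) \<Rightarrow> bool" where
  "mean_square_tendsto M Y Z \<longleftrightarrow>
     (\<lambda>N. \<integral>\<^sup>+x. ennreal ((cmod (Y N x - Z x))\<^sup>2) \<partial>M) \<longlonglongrightarrow> 0"

definition random_measure :: "'a measure \<Rightarrow> (real set \<Rightarrow> 'a \<Rightarrow> complex) \<Rightarrow> bool" where
  "random_measure M \<phi> \<longleftrightarrow>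
     (\<forall>A\<in>sets freq_space.
        \<phi> A \<in> borel_measurable M \<and> integrable M (\<lambda>x. (cmod (\<phi> A x))\<^sup>2)) \<and>
     (\<forall>A :: nat \<Rightarrow> real set. range A \<subseteq> sets freq_space \<longrightarrow> disjoint_family A \<longrightarrow>
        mean_square_tendsto M (\<lambda>N x. \<Sum>i<N. \<phi> (A i) x) (\<phi> (\<Union>i. A i)))"

definition orthogonal_spectral_measures ::
  "'a measure \<Rightarrow> nat \<Rightarrow> (nat \<Rightarrow> real set \<Rightarrow> 'a \<Rightarrow> complex) \<Rightarrow> bool" where
  "orthogonal_spectral_measures M q \<phi> \<longleftrightarrow>
     (\<forall>u<q. random_measure M (\<phi> u)) \<and>
     (\<forall>u<q. \<forall>\<nu><q. \<forall>A\<in>sets freq_space. \<forall>B\<in>sets freq_space. A \<inter> B = {} \<longrightarrow>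
        (\<integral>x. \<phi> u A x * cnj (\<phi> \<nu> B x) \<partial>M) = 0)"

definition spectral_distribution ::
  "'a measure \<Rightarrow> (nat \<Rightarrow> real set \<Rightarrow> 'a \<Rightarrow> complex) \<Rightarrow> nat \<Rightarrow> nat \<Rightarrow> real set \<Rightarrow> complex" where
  "spectral_distribution M \<phi> u \<nu> A = (\<integral>x. \<phi> u A x * cnj (\<phi> \<nu> A x) \<partial>M)"

definition complex_measure_BV :: "(real set \<Rightarrow> complex) \<Rightarrow> bool" where
  "complex_measure_BV G \<longleftrightarrow>
     (\<forall>A :: nat \<Rightarrow> real set. range A \<subseteq> sets freq_space \<longrightarrow> disjoint_family A \<longrightarrow>
        (\<lambda>i. G (A i)) sums G (\<Union>i. A i)) \<and>
     (\<exists>B. \<forall>\<A>. finite \<A> \<longrightarrow> \<A> \<subseteq> sets freq_space \<longrightarrow> disjoint \<A> \<longrightarrow>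
        (\<Sum>A\<in>\<A>. cmod (G A)) \<le> B)"

text \<open>The control measure \<open>A \<mapsto> E[|\<phi>(A)|^2]\<close>. It is countably additive, so that
  \<open>measure_of\<close> does not degenerate to the null measure, when \<open>\<phi>\<close> is a random measure
  taking orthogonal values on disjoint sets.\<close>

definition control_measure :: "'a measure \<Rightarrow> (real set \<Rightarrow> 'a \<Rightarrow> complex) \<Rightarrow> real measure" where
  "control_measure M \<phi> =
     measure_of {0..<2 * pi} (sets freq_space)
       (\<lambda>A. ennreal (\<integral>x. (cmod (\<phi> A x))\<^sup>2 \<partial>M))"

definition simple_stochastic_integral ::
  "(real set \<Rightarrow> 'a \<Rightarrow> complex) \<Rightarrow> (real \<Rightarrow> complex) \<Rightarrow> 'a \<Rightarrow> complex" where
  "simple_stochastic_integral \<phi> F x =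
     (\<Sum>y\<in>F ` {0..<2 * pi}. y * \<phi> (F -` {y} \<inter> {0..<2 * pi}) x)"

text \<open>The random variable \<open>I\<close> is (a version of) the integral of \<open>f\<close> with respect to \<open>\<phi>\<close> over
  \<open>[0, 2 pi)\<close>: it is the mean-square limit of the integrals of simple functions that approximate
  \<open>f\<close> in \<open>L^2\<close> of the control measure. For orthogonal \<open>\<phi>\<close> the limit does not depend, up to null
  sets, on the approximating sequence.\<close>

definition has_stochastic_integral ::
  "'a measure \<Rightarrow> (real set \<Rightarrow> 'a \<Rightarrow> complex) \<Rightarrow> (real \<Rightarrow> complex) \<Rightarrow> ('a \<Rightarrow> complex) \<Rightarrow> bool" where
  "has_stochastic_integral M \<phi> f I \<longleftrightarrow>
     I \<in> borel_measurable M \<and>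
     (\<exists>F. (\<forall>k. simple_function freq_space (F k)) \<and>
          mean_square_tendsto (control_measure M \<phi>) F f \<and>
          mean_square_tendsto M (\<lambda>k. simple_stochastic_integral \<phi> (F k)) I)"

definition harmonic_like_representation ::
  "'a measure \<Rightarrow> real \<Rightarrow> real \<Rightarrow> nat \<Rightarrow> (nat \<Rightarrow> real) \<Rightarrow> (nat \<Rightarrow> int \<Rightarrow> 'a \<Rightarrow> real) \<Rightarrow>
     (nat \<Rightarrow> real set \<Rightarrow> 'a \<Rightarrow> complex) \<Rightarrow> bool" where
  "harmonic_like_representation M H l q s V \<phi> \<longleftrightarrow>
     (\<forall>u<q. \<forall>n. \<exists>I.
        has_stochastic_integral M (\<phi> u) (\<lambda>\<omega>. exp (\<i> * of_real (\<omega> * of_int n))) I \<and>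
        (AE x in M. of_real (V u n x) = of_real ((l powi n * s u) powr H) * I x))"

definition has_spectral_density :: "(real set \<Rightarrow> complex) \<Rightarrow> (real \<Rightarrow> complex) \<Rightarrow> bool" where
  "has_spectral_density G g \<longleftrightarrow>
     set_integrable lborel {0..<2 * pi} g \<and>
     (\<forall>A\<in>sets freq_space. G A = (LINT \<omega>:A|lborel. g \<omega>))"

definition cov_Q ::
  "'a measure \<Rightarrow> (nat \<Rightarrow> int \<Rightarrow> 'a \<Rightarrow> real) \<Rightarrow> nat \<Rightarrow> nat \<Rightarrow> int \<Rightarrow> real" where
  "cov_Q M V u \<nu> \<tau> = (\<integral>x. V u \<tau> x * V \<nu> 0 x \<partial>M)"

definition density_partial_sum ::
  "'a measure \<Rightarrow> real \<Rightarrow> real \<Rightarrow> (nat \<Rightarrow> int \<Rightarrow> 'a \<Rightarrow> real) \<Rightarrow> nat \<Rightarrow> nat \<Rightarrow> real \<Rightarrow> nat \<Rightarrow> complex" where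
  "density_partial_sum M H l V u \<nu> \<omega> N =
     (\<Sum>\<tau>\<in>{- int N..int N}.
        of_real (l powr (- H * of_int \<tau>)) * exp (- \<i> * of_real (\<omega> * of_int \<tau>)) *
        of_real (cov_Q M V u \<nu> \<tau>))"

text \<open>The two-sided series is the limit of its symmetric partial sums. The value is arbitrary where
  these diverge.\<close>

definition density_series ::
  "'a measure \<Rightarrow> real \<Rightarrow> real \<Rightarrow> (nat \<Rightarrow> real) \<Rightarrow> (nat \<Rightarrow> int \<Rightarrow> 'a \<Rightarrow> real) \<Rightarrow>
     nat \<Rightarrow> nat \<Rightarrow> real \<Rightarrow> complex" where
  "density_series M H l s V u \<nu> \<omega> =
     of_real ((s u * s \<nu>) powr (- H) / (2 * pi)) * lim (density_partial_sum M H l V u \<nu> \<omega>)"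

end

theory Submission
  imports Defs
begin

text \<open>
  Dividing \<open>V\<^sup>u(n) = X(l\<^sup>n s\<^sub>u)\<close> by \<open>(l\<^sup>n s\<^sub>u)\<^sup>H\<close> turns scale invariance into joint (wide sense) stationarity
  in \<open>n\<close>. By Herglotz' theorem the covariances of the \<open>u\<close>-th component are the Fourier coefficients of a
  finite measure \<open>\<mu>\<^sub>u\<close> on \<open>[0, 2\<pi>)\<close>, so \<open>e\<^sup>i\<^sup>\<omega>\<^sup>n \<mapsto> (l\<^sup>n s\<^sub>u)\<^sup>-\<^sup>H V\<^sup>u(n)\<close> extends to an isometry from \<open>L\<^sup>2(\<mu>\<^sub>u)\<close>
  into \<open>L\<^sup>2\<close> of the probability space, and \<open>\<phi>\<^sub>u(A)\<close> is the image of the indicator of \<open>A\<close>. Stationarity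
  across components gives orthogonality of \<open>\<phi>\<^sub>u(A)\<close> and \<open>\<phi>\<^sub>\<nu>(B)\<close> for disjoint \<open>A\<close>, \<open>B\<close>.

  Conversely, for arbitrary orthogonal \<open>\<phi>\<^sub>u\<close> that represent \<open>V\<close>, an integrable \<open>g\<close> is a density of
  \<open>G\<^sub>u\<^sub>\<nu>\<close> iff its Fourier coefficients are the normalised covariances. Hence the asserted series is
  the Fourier series of any density. By Fejer's theorem in \<open>L\<^sup>1\<close> a subsequence of its Cesaro means
  converges to the density almost everywhere, which identifies the limit wherever the series
  converges; an absolutely summable series has the right coefficients by dominated convergence.
\<close>

section \<open>Square-integrable functions\<close>

text \<open>\<open>L2\<close> consists of functions rather than of classes, so whatever the isometry
  produces is determined only up to null sets. Hence the isometry is kept as a relation between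
  functions, a version of \<open>\<phi> A\<close> is picked by choice, and identities are stated for
  inner products, which do not see the version. The recurring obstacle is the passage between
  exponentials, where the covariances live, and indicators, where the random measures live.
  Trigonometric polynomials approximate uniformly only functions whose values at 0 and 2 pi agree,
  so the approximation takes place on the circle. A single class-of-functions argument then
  constructs the measures, proves their orthogonality, compares densities and proves Fejer's
  theorem. Cross covariances of two components are not positive definite, so Herglotz' theorem
  cannot be applied to them; the cross spectral distributions arise only afterwards, by pairing the
  two random measures. Their densities are merely integrable, which is why Fejer's theorem is used
  in L1 and not the Hilbert space theory of Fourier series.\<close>

definition L2 :: "'a measure \<Rightarrow> ('a \<Rightarrow> complex) set" where
  "L2 M = {f \<in> borel_measurable M. integrable M (\<lambda>x. (cmod (f x))\<^sup>2)}"

definition ip :: "'a measure \<Rightarrow> ('a \<Rightarrow> complex) \<Rightarrow> ('a \<Rightarrow> complex) \<Rightarrow> complex" where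
  "ip M f g = (\<integral>x. f x * cnj (g x) \<partial>M)"

text \<open>A Bochner integral, hence a real number and meaningful only on \<open>L2\<close>. The
  notion \<open>mean_square_tendsto\<close> uses the integral with values in [0, \<infinity>]; the
  two are matched by \<open>mean_square_tendsto_L2_iff\<close>.\<close>

definition sq_norm :: "'a measure \<Rightarrow> ('a \<Rightarrow> complex) \<Rightarrow> real" where
  "sq_norm M f = (\<integral>x. (cmod (f x))\<^sup>2 \<partial>M)"

lemma measurable_cnj [measurable (raw)]:
  "f \<in> borel_measurable M \<Longrightarrow> (\<lambda>x. cnj (f x)) \<in> borel_measurable M"
  by (rule borel_measurable_continuous_on[where f = cnj]) (auto intro: continuous_intros)

lemma L2_measurable [measurable_dest]: "f \<in> L2 M \<Longrightarrow> f \<in> borel_measurable M"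
  by (simp add: L2_def)

lemma L2_integrable_sq: "f \<in> L2 M \<Longrightarrow> integrable M (\<lambda>x. (cmod (f x))\<^sup>2)"
  by (simp add: L2_def)

lemma cmod_add_sq_le: "(cmod (a + b))\<^sup>2 \<le> 2 * (cmod a)\<^sup>2 + 2 * (cmod b)\<^sup>2"
proof -
  have "(cmod (a + b))\<^sup>2 \<le> (cmod a + cmod b)\<^sup>2"
    by (intro power_mono norm_triangle_ineq) auto
  also have "\<dots> \<le> 2 * (cmod a)\<^sup>2 + 2 * (cmod b)\<^sup>2"
    using sum_squares_bound[of "cmod a" "cmod b"] by (simp add: power2_sum)
  finally show ?thesis .
qed

lemma L2_zero [simp]: "(\<lambda>_. 0) \<in> L2 M"
  by (simp add: L2_def)

lemma L2_add:
  assumes "f \<in> L2 M" "g \<in> L2 M"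
  shows "(\<lambda>x. f x + g x) \<in> L2 M"
proof -
  have [measurable]: "f \<in> borel_measurable M" "g \<in> borel_measurable M"
    using assms by (auto simp: L2_def)
  have "integrable M (\<lambda>x. (cmod (f x + g x))\<^sup>2)"
  proof (rule Bochner_Integration.integrable_bound)
    show "integrable M (\<lambda>x. 2 * (cmod (f x))\<^sup>2 + 2 * (cmod (g x))\<^sup>2)"
      using assms by (simp add: L2_def)
  qed (auto intro!: AE_I2 cmod_add_sq_le)
  then show ?thesis by (simp add: L2_def)
qed

lemma L2_scale: "f \<in> L2 M \<Longrightarrow> (\<lambda>x. c * f x) \<in> L2 M"
  by (auto simp: L2_def norm_mult power_mult_distrib)

lemma L2_diff: "f \<in> L2 M \<Longrightarrow> g \<in> L2 M \<Longrightarrow> (\<lambda>x. f x - g x) \<in> L2 M"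
  using L2_add[of f M "\<lambda>x. (-1) * g x"] L2_scale[of g M "-1"] by simp

lemma L2_bounded:
  assumes "finite_measure M" "f \<in> borel_measurable M" "\<And>x. x \<in> space M \<Longrightarrow> cmod (f x) \<le> C"
  shows "f \<in> L2 M"
proof -
  interpret finite_measure M by fact
  have "integrable M (\<lambda>x. (cmod (f x))\<^sup>2)"
    by (rule integrable_const_bound[where B = "C\<^sup>2"]) (use assms in \<open>auto intro!: AE_I2 power_mono\<close>)
  with assms show ?thesis by (simp add: L2_def)
qed

lemma L2_mult_integrable:
  assumes "f \<in> L2 M" "g \<in> L2 M"
  shows "integrable M (\<lambda>x. f x * cnj (g x))"
proof -
  have [measurable]: "f \<in> borel_measurable M" "g \<in> borel_measurable M"
    using assms by (auto simp: L2_def)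
  show ?thesis
  proof (rule Bochner_Integration.integrable_bound)
    show "integrable M (\<lambda>x. (cmod (f x))\<^sup>2 + (cmod (g x))\<^sup>2)"
      using assms by (simp add: L2_def)
    have "cmod (f x) * cmod (g x) \<le> (cmod (f x))\<^sup>2 + (cmod (g x))\<^sup>2" for x
      using sum_squares_bound[of "cmod (f x)" "cmod (g x)"]
        mult_nonneg_nonneg[OF norm_ge_zero[of "f x"] norm_ge_zero[of "g x"]] by linarith
    then show "AE x in M. norm (f x * cnj (g x)) \<le> norm ((cmod (f x))\<^sup>2 + (cmod (g x))\<^sup>2)"
      by (auto simp: norm_mult)
  qed auto
qed

lemma sq_norm_nonneg [simp]: "sq_norm M f \<ge> 0"
  by (simp add: sq_norm_def)

lemma ip_self: "ip M f f = of_real (sq_norm M f)"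
  by (simp add: ip_def sq_norm_def flip: complex_norm_square integral_complex_of_real)

lemma ip_cnj: "cnj (ip M f g) = ip M g f"
  unfolding ip_def by (subst Bochner_Integration.integral_cnj[symmetric]) (simp add: mult.commute)

lemma ip_cong_AE:
  assumes "f \<in> L2 M" "g \<in> L2 M" "f' \<in> borel_measurable M" "g' \<in> borel_measurable M"
    "AE x in M. f x = f' x" "AE x in M. g x = g' x"
  shows "ip M f g = ip M f' g'"
proof -
  have [measurable]: "f \<in> borel_measurable M" "g \<in> borel_measurable M"
    "f' \<in> borel_measurable M" "g' \<in> borel_measurable M"
    using assms by (auto simp: L2_def)
  show ?thesis
    unfolding ip_def using assms(5,6) by (intro integral_cong_AE borel_measurable_times measurable_cnj) auto
qed

lemma ip_add_left:
  assumes "f \<in> L2 M" "f' \<in> L2 M" "g \<in> L2 M"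
  shows "ip M (\<lambda>x. f x + c * f' x) g = ip M f g + c * ip M f' g"
  using L2_mult_integrable[OF assms(1,3)] L2_mult_integrable[OF assms(2,3)]
  by (simp add: ip_def distrib_right mult.assoc)

lemma ip_add_right:
  assumes "f \<in> L2 M" "g \<in> L2 M" "g' \<in> L2 M"
  shows "ip M f (\<lambda>x. g x + c * g' x) = ip M f g + cnj c * ip M f g'"
proof -
  have "ip M f (\<lambda>x. g x + c * g' x) = cnj (ip M (\<lambda>x. g x + c * g' x) f)"
    by (simp add: ip_cnj)
  also have "\<dots> = cnj (ip M g f) + cnj c * cnj (ip M g' f)"
    by (simp add: ip_add_left assms)
  finally show ?thesis by (simp add: ip_cnj)
qed

lemma ip_diff_left:
  assumes "f \<in> L2 M" "f' \<in> L2 M" "g \<in> L2 M"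
  shows "ip M (\<lambda>x. f x - f' x) g = ip M f g - ip M f' g"
  using ip_add_left[OF assms, of "-1"] by simp

lemma sq_norm_add_le:
  assumes "f \<in> L2 M" "g \<in> L2 M"
  shows "sq_norm M (\<lambda>x. f x + g x) \<le> 2 * sq_norm M f + 2 * sq_norm M g"
proof -
  have "sq_norm M (\<lambda>x. f x + g x) \<le> (\<integral>x. 2 * (cmod (f x))\<^sup>2 + 2 * (cmod (g x))\<^sup>2 \<partial>M)"
    unfolding sq_norm_def
    using assms L2_add[OF assms]
    by (intro integral_mono cmod_add_sq_le) (auto simp: L2_def)
  also have "\<dots> = 2 * sq_norm M f + 2 * sq_norm M g"
    using assms by (simp add: L2_def sq_norm_def)
  finally show ?thesis .
qed

lemma sq_norm_diff_commute: "sq_norm M (\<lambda>x. f x - g x) = sq_norm M (\<lambda>x. g x - f x)"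
  by (simp add: sq_norm_def norm_minus_commute)

text \<open>A substitute for Minkowski's inequality. The factors 2 are harmless, because it only
  serves to make distances small.\<close>

lemma sq_norm_triangle:
  assumes "f \<in> L2 M" "g \<in> L2 M" "h \<in> L2 M"
  shows "sq_norm M (\<lambda>x. f x - h x) \<le> 2 * sq_norm M (\<lambda>x. f x - g x) + 2 * sq_norm M (\<lambda>x. g x - h x)"
  using sq_norm_add_le[of "\<lambda>x. f x - g x" M "\<lambda>x. g x - h x"] assms by (simp add: L2_diff)

lemma sq_norm_zero_iff:
  assumes "f \<in> L2 M"
  shows "sq_norm M f = 0 \<longleftrightarrow> (AE x in M. f x = 0)"
  using integral_nonneg_eq_0_iff_AE[of M "\<lambda>x. (cmod (f x))\<^sup>2"] assms
  by (simp add: sq_norm_def L2_def)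

text \<open>The inequality for extended nonnegative integrals is applied to the moduli, and its
  finite terms are read back as real numbers through \<open>A\<close>.\<close>

lemma Cauchy_Schwarz_L2:
  assumes "f \<in> L2 M" "g \<in> L2 M"
  shows "cmod (ip M f g) \<le> sqrt (sq_norm M f) * sqrt (sq_norm M g)"
proof -
  have [measurable]: "f \<in> borel_measurable M" "g \<in> borel_measurable M"
    using assms by (auto simp: L2_def)
  have int: "integrable M (\<lambda>x. cmod (f x) * cmod (g x))"
    using integrable_norm[OF L2_mult_integrable[OF assms]] by (simp add: norm_mult)
  define A where "A = (\<integral>x. cmod (f x) * cmod (g x) \<partial>M)"
  have A: "A \<ge> 0" by (simp add: A_def)
  have "(ennreal A)\<^sup>2 = (\<integral>\<^sup>+x. cmod (f x) * cmod (g x) \<partial>M)\<^sup>2"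
    unfolding A_def by (subst nn_integral_eq_integral[OF int]) auto
  also have "\<dots> = (\<integral>\<^sup>+x. ennreal (cmod (f x)) * ennreal (cmod (g x)) \<partial>M)\<^sup>2"
    by (simp add: ennreal_mult)
  also have "\<dots> \<le> (\<integral>\<^sup>+x. ennreal (cmod (f x)) ^ 2 \<partial>M) * (\<integral>\<^sup>+x. ennreal (cmod (g x)) ^ 2 \<partial>M)"
    by (rule Cauchy_Schwarz_nn_integral) auto
  also have "\<dots> = ennreal (sq_norm M f) * ennreal (sq_norm M g)"
    using assms by (simp add: ennreal_power nn_integral_eq_integral L2_def sq_norm_def)
  finally have "ennreal (A\<^sup>2) \<le> ennreal (sq_norm M f * sq_norm M g)"
    by (simp add: ennreal_power A ennreal_mult)
  then have "A\<^sup>2 \<le> sq_norm M f * sq_norm M g"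
    by (subst (asm) ennreal_le_iff) auto
  then have "A \<le> sqrt (sq_norm M f) * sqrt (sq_norm M g)"
    by (simp add: real_le_rsqrt flip: real_sqrt_mult)
  moreover have "cmod (ip M f g) \<le> A"
    unfolding ip_def A_def using integral_norm_bound[of M "\<lambda>x. f x * cnj (g x)"] by (simp add: norm_mult)
  ultimately show ?thesis by simp
qed

lemma tendsto_ip_left:
  assumes "\<And>k. f k \<in> L2 M" "f' \<in> L2 M" "g \<in> L2 M"
    and "(\<lambda>k. sq_norm M (\<lambda>x. f k x - f' x)) \<longlonglongrightarrow> 0"
  shows "(\<lambda>k. ip M (f k) g) \<longlonglongrightarrow> ip M f' g"
proof (rule LIM_zero_cancel, rule Lim_null_comparison)
  have "(\<lambda>k. sqrt (sq_norm M (\<lambda>x. f k x - f' x)) * sqrt (sq_norm M g)) \<longlonglongrightarrow> sqrt 0 * sqrt (sq_norm M g)"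
    by (intro tendsto_intros assms)
  then show "(\<lambda>k. sqrt (sq_norm M (\<lambda>x. f k x - f' x)) * sqrt (sq_norm M g)) \<longlonglongrightarrow> 0"
    by simp
  show "\<forall>\<^sub>F k in sequentially. norm (ip M (f k) g - ip M f' g) \<le>
      sqrt (sq_norm M (\<lambda>x. f k x - f' x)) * sqrt (sq_norm M g)"
  proof (intro always_eventually allI)
    show "norm (ip M (f k) g - ip M f' g) \<le> sqrt (sq_norm M (\<lambda>x. f k x - f' x)) * sqrt (sq_norm M g)" for k
      unfolding ip_diff_left[OF assms(1,2,3), symmetric]
      by (rule Cauchy_Schwarz_L2[OF L2_diff[OF assms(1,2)] assms(3)])
  qed
qed

text \<open>Riesz-Fischer. On a probability space Cauchy-Schwarz against the constant 1 makes the
  sequence Cauchy in L1, so a subsequence converges almost everywhere; Fatou's lemma along it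
  transfers the Cauchy estimates to the limit.\<close>

lemma L2_complete:
  assumes "prob_space M" and P: "\<And>k. P k \<in> L2 M"
    and Cauchy: "\<And>e::real. e > 0 \<Longrightarrow> \<exists>N. \<forall>i\<ge>N. \<forall>j\<ge>N. sq_norm M (\<lambda>x. P i x - P j x) < e"
  shows "\<exists>Z\<in>L2 M. (\<lambda>k. sq_norm M (\<lambda>x. P k x - Z x)) \<longlonglongrightarrow> 0"
proof -
  interpret prob_space M by fact
  have [measurable]: "P k \<in> borel_measurable M" for k
    using P by (auto simp: L2_def)
  have one: "(\<lambda>_. 1) \<in> L2 M" by (simp add: L2_def)
  have l1: "(\<integral>x. cmod (f x) \<partial>M) \<le> sqrt (sq_norm M f)" and i1: "integrable M f" if f: "f \<in> L2 M" for f
  proof -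
    have [measurable]: "f \<in> borel_measurable M" using f by (simp add: L2_def)
    have n: "(\<lambda>x. of_real (cmod (f x))) \<in> L2 M" using f by (simp add: L2_def)
    have "ip M (\<lambda>x. of_real (cmod (f x))) (\<lambda>_. 1) = of_real (\<integral>x. cmod (f x) \<partial>M)"
      by (simp add: ip_def)
    then show "(\<integral>x. cmod (f x) \<partial>M) \<le> sqrt (sq_norm M f)"
      using Cauchy_Schwarz_L2[OF n one] by (simp add: sq_norm_def prob_space)
    show "integrable M f" using L2_mult_integrable[OF f one] by simp
  qed
  have "\<exists>N. \<forall>i\<ge>N. \<forall>j\<ge>N. (\<integral>x. norm (P i x - P j x) \<partial>M) < e" if "e > 0" for e :: real
  proof -
    \<comment> \<open>The square compensates for the root in \<open>l1\<close>.\<close>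
    obtain N where N: "\<forall>i\<ge>N. \<forall>j\<ge>N. sq_norm M (\<lambda>x. P i x - P j x) < e\<^sup>2"
      using Cauchy[of "e\<^sup>2"] \<open>e > 0\<close> by auto
    have "(\<integral>x. norm (P i x - P j x) \<partial>M) < e" if "i \<ge> N" "j \<ge> N" for i j
    proof -
      have "(\<integral>x. norm (P i x - P j x) \<partial>M) \<le> sqrt (sq_norm M (\<lambda>x. P i x - P j x))"
        by (intro l1 L2_diff P)
      also have "\<dots> < sqrt (e\<^sup>2)" using N that by (intro real_sqrt_less_mono) auto
      finally show ?thesis using \<open>e > 0\<close> by simp
    qed
    then show ?thesis by blast
  qed
  then obtain r where r: "strict_mono r" "AE x in M. Cauchy (\<lambda>i. P (r i) x)"
    using cauchy_L1_AE_cauchy_subseq[of M P thesis] i1[OF P] by blast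
  define Z where "Z x = lim (\<lambda>i. P (r i) x)" for x
  have [measurable]: "Z \<in> borel_measurable M"
    unfolding Z_def by (rule borel_measurable_lim_metric) simp
  have conv: "AE x in M. (\<lambda>i. P (r i) x) \<longlonglongrightarrow> Z x"
    using r(2) by eventually_elim (auto simp: Z_def Cauchy_convergent_iff convergent_LIMSEQ_iff)
  have fatou: "(\<integral>\<^sup>+x. ennreal ((cmod (P k x - Z x))\<^sup>2) \<partial>M) \<le> ennreal e"
    if "\<And>j. j \<ge> N \<Longrightarrow> sq_norm M (\<lambda>x. P k x - P j x) < e" for k N e
  proof -
    have "(\<integral>\<^sup>+x. ennreal ((cmod (P k x - Z x))\<^sup>2) \<partial>M)
      = (\<integral>\<^sup>+x. liminf (\<lambda>i. ennreal ((cmod (P k x - P (r i) x))\<^sup>2)) \<partial>M)"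
    proof (rule nn_integral_cong_AE)
      show "AE x in M. ennreal ((cmod (P k x - Z x))\<^sup>2) = liminf (\<lambda>i. ennreal ((cmod (P k x - P (r i) x))\<^sup>2))"
        using conv
      proof eventually_elim
        case (elim x)
        have "(\<lambda>i. ennreal ((cmod (P k x - P (r i) x))\<^sup>2)) \<longlonglongrightarrow> ennreal ((cmod (P k x - Z x))\<^sup>2)"
          by (intro tendsto_intros elim)
        then show ?case by (metis lim_imp_Liminf trivial_limit_sequentially)
      qed
    qed
    also have "\<dots> \<le> liminf (\<lambda>i. \<integral>\<^sup>+x. ennreal ((cmod (P k x - P (r i) x))\<^sup>2) \<partial>M)"
      by (rule nn_integral_liminf) measurable
    also have "\<dots> = liminf (\<lambda>i. ennreal (sq_norm M (\<lambda>x. P k x - P (r i) x)))"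
      by (subst nn_integral_eq_integral) (auto simp: sq_norm_def intro: L2_integrable_sq[OF L2_diff] P)
    also have "\<dots> \<le> liminf (\<lambda>i. ennreal e)"
    proof (rule Liminf_mono)
      show "\<forall>\<^sub>F i in sequentially. ennreal (sq_norm M (\<lambda>x. P k x - P (r i) x)) \<le> ennreal e"
        using eventually_ge_at_top[of N]
      proof eventually_elim
        case (elim i)
        then have "r i \<ge> N" using seq_suble[OF r(1), of i] by linarith
        then show ?case using that by (intro ennreal_leI less_imp_le) auto
      qed
    qed
    also have "\<dots> = ennreal e" by (simp add: Liminf_const)
    finally show ?thesis .
  qed
  \<comment> \<open>One finite distance suffices for \<open>Z\<close> to be in \<open>L2\<close>: it
    is the difference of \<open>P N1\<close> and \<open>P N1 - Z\<close>.\<close>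
  obtain N1 where N1: "\<forall>i\<ge>N1. \<forall>j\<ge>N1. sq_norm M (\<lambda>x. P i x - P j x) < 1"
    using Cauchy[of 1] by auto
  have "(\<integral>\<^sup>+x. ennreal ((cmod (P N1 x - Z x))\<^sup>2) \<partial>M) \<le> ennreal 1"
    by (rule fatou[of N1]) (use N1 in auto)
  then have "(\<lambda>x. P N1 x - Z x) \<in> L2 M"
    by (auto simp: L2_def integrable_iff_bounded intro: le_less_trans[OF _ ennreal_one_less_top])
  from L2_diff[OF P[of N1] this] have Z: "Z \<in> L2 M" by simp
  have "(\<lambda>k. sq_norm M (\<lambda>x. P k x - Z x)) \<longlonglongrightarrow> 0"
  proof (rule LIMSEQ_I)
    fix e :: real assume "e > 0"
    \<comment> \<open>Half of \<open>e\<close> is asked for, because Fatou's lemma returns a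
      non-strict bound.\<close>
    obtain N where N: "\<forall>i\<ge>N. \<forall>j\<ge>N. sq_norm M (\<lambda>x. P i x - P j x) < e/2"
      using Cauchy[of "e/2"] \<open>e > 0\<close> by auto
    have "sq_norm M (\<lambda>x. P k x - Z x) < e" if "k \<ge> N" for k
    proof -
      have "ennreal (sq_norm M (\<lambda>x. P k x - Z x)) = (\<integral>\<^sup>+x. ennreal ((cmod (P k x - Z x))\<^sup>2) \<partial>M)"
        unfolding sq_norm_def
        by (subst nn_integral_eq_integral) (auto intro: L2_integrable_sq[OF L2_diff] P Z)
      also have "\<dots> \<le> ennreal (e/2)"
        by (rule fatou[of N]) (use N that in auto)
      finally have "sq_norm M (\<lambda>x. P k x - Z x) \<le> e/2"
        using \<open>e > 0\<close> by (subst (asm) ennreal_le_iff) auto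
      then show ?thesis using \<open>e > 0\<close> by linarith
    qed
    then show "\<exists>no. \<forall>n\<ge>no. norm (sq_norm M (\<lambda>x. P n x - Z x) - 0) < e" by auto
  qed
  with Z show ?thesis by blast
qed

lemma mean_square_tendsto_L2_iff:
  assumes "\<And>k. f k \<in> L2 M" "g \<in> L2 M"
  shows "mean_square_tendsto M f g \<longleftrightarrow> (\<lambda>k. sq_norm M (\<lambda>x. f k x - g x)) \<longlonglongrightarrow> 0"
proof -
  have "(\<integral>\<^sup>+x. ennreal ((cmod (f k x - g x))\<^sup>2) \<partial>M) = ennreal (sq_norm M (\<lambda>x. f k x - g x))" for k
    unfolding sq_norm_def
    by (subst nn_integral_eq_integral) (auto intro: L2_integrable_sq[OF L2_diff] assms)
  then show ?thesis
    unfolding mean_square_tendsto_def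
    using tendsto_ennreal_iff[of "\<lambda>k. sq_norm M (\<lambda>x. f k x - g x)" sequentially 0] by simp
qed

text \<open>Convergence to 0 in [0, \<infinity>] forces one of the integrals below 1, and a single
  function of \<open>L2\<close> at finite distance is enough.\<close>

lemma mean_square_limit_L2:
  assumes "\<And>k. f k \<in> L2 M" "g \<in> borel_measurable M" "mean_square_tendsto M f g"
  shows "g \<in> L2 M"
proof -
  have [measurable]: "f k \<in> borel_measurable M" "g \<in> borel_measurable M" for k
    using assms by (auto simp: L2_def)
  have "\<forall>\<^sub>F k in sequentially. (\<integral>\<^sup>+x. ennreal ((cmod (f k x - g x))\<^sup>2) \<partial>M) < 1"
    using assms(3) unfolding mean_square_tendsto_def by (rule order_tendstoD) simp
  then obtain k where "(\<integral>\<^sup>+x. ennreal ((cmod (f k x - g x))\<^sup>2) \<partial>M) < 1"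
    by (auto simp: eventually_sequentially)
  then have "(\<lambda>x. f k x - g x) \<in> L2 M"
    by (auto simp: L2_def integrable_iff_bounded intro: less_trans[OF _ ennreal_one_less_top])
  from L2_diff[OF assms(1)[of k] this] show ?thesis by simp
qed

section \<open>Closed isometric relations\<close>

text \<open>The graph of a linear isometry between two \<open>L\<^sup>2\<close> spaces, known only on generators. Since limits are
  part of the inductive definition, preservation of inner products is a plain rule induction and no
  extension by density has to be carried out.\<close>

inductive_set closed_span ::
  "'b measure \<Rightarrow> 'a measure \<Rightarrow> (('b \<Rightarrow> complex) \<times> ('a \<Rightarrow> complex)) set \<Rightarrow>
   (('b \<Rightarrow> complex) \<times> ('a \<Rightarrow> complex)) set"
  for \<mu> :: "'b measure" and M :: "'a measure" and G where
  gen: "(f, Z) \<in> G \<Longrightarrow> (f, Z) \<in> closed_span \<mu> M G"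
| zero: "((\<lambda>_. 0), (\<lambda>_. 0)) \<in> closed_span \<mu> M G"
| add: "(f, Z) \<in> closed_span \<mu> M G \<Longrightarrow> (g, W) \<in> closed_span \<mu> M G \<Longrightarrow>
    ((\<lambda>x. f x + c * g x), (\<lambda>x. Z x + c * W x)) \<in> closed_span \<mu> M G"
| lim: "(\<And>k. (p k, P k) \<in> closed_span \<mu> M G) \<Longrightarrow> f \<in> L2 \<mu> \<Longrightarrow> Z \<in> L2 M \<Longrightarrow>
    (\<lambda>k. sq_norm \<mu> (\<lambda>x. p k x - f x)) \<longlonglongrightarrow> 0 \<Longrightarrow> (\<lambda>k. sq_norm M (\<lambda>x. P k x - Z x)) \<longlonglongrightarrow> 0 \<Longrightarrow>
    (f, Z) \<in> closed_span \<mu> M G"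

locale isometric_generators =
  prob_space M for \<mu> :: "'b measure" and M :: "'a measure"
    and G :: "(('b \<Rightarrow> complex) \<times> ('a \<Rightarrow> complex)) set" +
  assumes gen_L2: "(f, Z) \<in> G \<Longrightarrow> f \<in> L2 \<mu>" "(f, Z) \<in> G \<Longrightarrow> Z \<in> L2 M"
    and gen_ip: "(f, Z) \<in> G \<Longrightarrow> (g, W) \<in> G \<Longrightarrow> ip \<mu> f g = ip M Z W"
begin

abbreviation C where "C \<equiv> closed_span \<mu> M G"

lemma C_L2:
  assumes "(f, Z) \<in> C"
  shows "f \<in> L2 \<mu>" "Z \<in> L2 M"
proof -
  have "f \<in> L2 \<mu> \<and> Z \<in> L2 M"
    using assms by induction (auto intro: gen_L2 L2_add L2_scale)
  then show "f \<in> L2 \<mu>" "Z \<in> L2 M" by auto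
qed

text \<open>The induction runs over the left pair with the right pair fixed, and it is used twice:
  with a generator on the right, and then, after conjugating the result, with an arbitrary pair on
  the right.\<close>

lemma C_ip:
  assumes "(f, Z) \<in> C" "(g, W) \<in> C"
  shows "ip \<mu> f g = ip M Z W"
proof -
  have *: "ip \<mu> f g = ip M Z W" if "g \<in> L2 \<mu>" "W \<in> L2 M" 
    "\<And>a b. (a, b) \<in> G \<Longrightarrow> ip \<mu> a g = ip M b W" "(f, Z) \<in> C" for f Z g W
    using that(4)
  proof induction
    case zero
    then show ?case by (simp add: ip_def)
  next
    case (add f Z g W c)
    then show ?case using that C_L2 by (simp add: ip_add_left)
  next
    case (lim p P f Z)
    have "(\<lambda>k. ip \<mu> (p k) g) \<longlonglongrightarrow> ip \<mu> f g" "(\<lambda>k. ip M (P k) W) \<longlonglongrightarrow> ip M Z W"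
      by (rule tendsto_ip_left[OF C_L2(1)[OF lim.hyps(1)] lim.hyps(2) that(1) lim.hyps(4)],
          rule tendsto_ip_left[OF C_L2(2)[OF lim.hyps(1)] lim.hyps(3) that(2) lim.hyps(5)])
    with lim.IH show ?case by (simp add: LIMSEQ_unique)
  qed (use that in blast)
  have "ip \<mu> f a = ip M Z b" if "(a, b) \<in> G" for a b
    by (rule *[OF gen_L2[OF that] gen_ip[OF _ that] assms(1)])
  then have "ip \<mu> a f = ip M b Z" if "(a, b) \<in> G" for a b
    using that by (metis ip_cnj)
  then have "ip \<mu> g f = ip M W Z"
    by (rule *[OF C_L2[OF assms(1)] _ assms(2)])
  then show ?thesis using ip_cnj[of \<mu> g f] ip_cnj[of M W Z] by simp
qed

lemma C_sq_norm: "(f, Z) \<in> C \<Longrightarrow> sq_norm \<mu> f = sq_norm M Z"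
  using C_ip[of f Z f Z] unfolding ip_self of_real_eq_iff by blast

lemma C_diff: "(f, Z) \<in> C \<Longrightarrow> (g, W) \<in> C \<Longrightarrow> ((\<lambda>x. f x - g x), (\<lambda>x. Z x - W x)) \<in> C"
  by (drule (1) closed_span.add[where c = "-1"]) simp

text \<open>The difference of the two pairs has first component 0, and the isometry gives its second
  component norm 0.\<close>

lemma C_unique:
  assumes "(f, Z) \<in> C" "(f, W) \<in> C"
  shows "AE x in M. Z x = W x"
proof -
  have "sq_norm M (\<lambda>x. Z x - W x) = 0"
    unfolding C_sq_norm[OF C_diff[OF assms], symmetric] by (simp add: sq_norm_def)
  then show ?thesis
    by (subst (asm) sq_norm_zero_iff[OF L2_diff[OF C_L2(2)[OF assms(1)] C_L2(2)[OF assms(2)]]]) simp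
qed

text \<open>Isometry makes the partners a Cauchy sequence, and completeness of \<open>L2\<close> on
  the probability side supplies the new partner.\<close>

lemma C_limit:
  assumes p: "\<And>k. (p k, P k) \<in> C" and f: "f \<in> L2 \<mu>"
    and lim: "(\<lambda>k. sq_norm \<mu> (\<lambda>x. p k x - f x)) \<longlonglongrightarrow> 0"
  shows "\<exists>Z. (f, Z) \<in> C \<and> (\<lambda>k. sq_norm M (\<lambda>x. P k x - Z x)) \<longlonglongrightarrow> 0"
proof -
  have "\<exists>Z\<in>L2 M. (\<lambda>k. sq_norm M (\<lambda>x. P k x - Z x)) \<longlonglongrightarrow> 0"
  proof (rule L2_complete)
    show "prob_space M" by (rule prob_space_axioms)
    show "P k \<in> L2 M" for k using C_L2(2)[OF p] .
    fix e :: real assume e: "e > 0"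
    \<comment> \<open>A quarter, since \<open>sq_norm_triangle\<close> doubles each of two
      terms.\<close>
    then have "\<forall>\<^sub>F k in sequentially. sq_norm \<mu> (\<lambda>x. p k x - f x) < e/4"
      by (intro order_tendstoD[OF lim]) simp
    then obtain N where N: "\<And>k. k \<ge> N \<Longrightarrow> sq_norm \<mu> (\<lambda>x. p k x - f x) < e/4"
      by (auto simp: eventually_sequentially)
    have "sq_norm M (\<lambda>x. P i x - P j x) < e" if "i \<ge> N" "j \<ge> N" for i j
    proof -
      have "sq_norm M (\<lambda>x. P i x - P j x) = sq_norm \<mu> (\<lambda>x. p i x - p j x)"
        using C_sq_norm[OF C_diff[OF p p]] by simp
      also have "\<dots> \<le> 2 * sq_norm \<mu> (\<lambda>x. p i x - f x) + 2 * sq_norm \<mu> (\<lambda>x. f x - p j x)"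
        by (intro sq_norm_triangle C_L2(1)[OF p] f)
      also have "\<dots> < e"
        using N[OF that(1)] N[OF that(2)] by (simp add: sq_norm_diff_commute[of \<mu> f])
      finally show ?thesis .
    qed
    then show "\<exists>N. \<forall>i\<ge>N. \<forall>j\<ge>N. sq_norm M (\<lambda>x. P i x - P j x) < e" by blast
  qed
  then obtain Z where "Z \<in> L2 M" "(\<lambda>k. sq_norm M (\<lambda>x. P k x - Z x)) \<longlonglongrightarrow> 0" by blast
  with closed_span.lim[OF p f _ lim] show ?thesis by blast
qed

lemma C_limit_tendsto:
  assumes p: "\<And>k. (p k, P k) \<in> C" and f: "(f, Z) \<in> C"
    and lim: "(\<lambda>k. sq_norm \<mu> (\<lambda>x. p k x - f x)) \<longlonglongrightarrow> 0"
  shows "(\<lambda>k. sq_norm M (\<lambda>x. P k x - Z x)) \<longlonglongrightarrow> 0"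
proof -
  have eq: "(\<lambda>k. sq_norm \<mu> (\<lambda>x. p k x - f x)) = (\<lambda>k. sq_norm M (\<lambda>x. P k x - Z x))"
    by (intro ext C_sq_norm C_diff p f)
  show ?thesis using lim by (simp only: eq)
qed

text \<open>A change on null sets is a limit of the constant sequence, so the inductive definition
  needs no separate rule for versions.\<close>

lemma C_cong:
  assumes "(f, Z) \<in> C" "g \<in> L2 \<mu>" "W \<in> L2 M" "AE x in \<mu>. f x = g x" "AE x in M. Z x = W x"
  shows "(g, W) \<in> C"
proof (rule closed_span.lim[where p = "\<lambda>_. f" and P = "\<lambda>_. Z"])
  have "sq_norm \<mu> (\<lambda>x. f x - g x) = 0" "sq_norm M (\<lambda>x. Z x - W x) = 0"
    unfolding sq_norm_zero_iff[OF L2_diff[OF C_L2(1)[OF assms(1)] assms(2)]]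
      sq_norm_zero_iff[OF L2_diff[OF C_L2(2)[OF assms(1)] assms(3)]]
    using assms(4,5) by simp_all
  then show "(\<lambda>k::nat. sq_norm \<mu> (\<lambda>x. f x - g x)) \<longlonglongrightarrow> 0" "(\<lambda>k::nat. sq_norm M (\<lambda>x. Z x - W x)) \<longlonglongrightarrow> 0"
    by (metis tendsto_const)+
  show "(f, Z) \<in> C" by (rule assms(1))
qed (rule assms)+

end

section \<open>Bounded measurable functions on the frequency interval\<close>

lemma space_freq_space [simp]: "space freq_space = {0..<2 * pi}"
  by (simp add: freq_space_def space_restrict_space)

lemma sets_freq_space: "A \<in> sets freq_space \<longleftrightarrow> A \<in> sets borel \<and> A \<subseteq> {0..<2 * pi}"
  by (subst freq_space_def, subst sets_restrict_space_iff) auto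

definition fexp :: "int \<Rightarrow> real \<Rightarrow> complex" where
  "fexp n \<omega> = exp (\<i> * of_real (\<omega> * of_int n))"

lemma norm_fexp [simp]: "cmod (fexp n \<omega>) = 1"
  by (simp add: fexp_def flip: cis_conv_exp)

lemma fexp_0 [simp]: "fexp 0 = (\<lambda>_. 1)"
  by (simp add: fexp_def fun_eq_iff)

lemma fexp_mult: "fexp m \<omega> * fexp n \<omega> = fexp (m + n) \<omega>"
  by (simp add: fexp_def distrib_left flip: exp_add)

lemma cnj_fexp: "cnj (fexp n \<omega>) = fexp (- n) \<omega>"
  by (simp add: fexp_def exp_cnj)

lemma continuous_fexp: "continuous_on A (fexp n)"
  unfolding fexp_def by (intro continuous_intros)

lemma fexp_borel [measurable]: "fexp n \<in> borel_measurable borel"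
  by (rule borel_measurable_continuous_onI[OF continuous_fexp])

lemma fexp_measurable_freq [measurable]: "fexp n \<in> borel_measurable freq_space"
  unfolding freq_space_def by (intro measurable_restrict_space1) simp

text \<open>\<open>Arg2pi\<close> is continuous off the nonnegative real axis and equals 0 on that
  closed set.\<close>

lemma borel_measurable_Arg2pi [measurable]: "Arg2pi \<in> borel_measurable borel"
proof -
  have meas: "(\<lambda>z. if z \<in> \<real>\<^sub>\<ge>\<^sub>0 then 0 else Arg2pi z) \<in> borel_measurable borel"
  proof (rule borel_measurable_continuous_on_if)
    show "(\<real>\<^sub>\<ge>\<^sub>0 :: complex set) \<in> sets borel" by (intro borel_closed) simp
    show "continuous_on (- \<real>\<^sub>\<ge>\<^sub>0) Arg2pi"
      by (auto intro!: continuous_at_imp_continuous_on continuous_at_Arg2pi)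
  qed auto
  moreover have "(\<lambda>z. if z \<in> \<real>\<^sub>\<ge>\<^sub>0 then 0 else Arg2pi z) = Arg2pi"
    using Arg2pi_eq_0 by (auto simp: fun_eq_iff complex_nonneg_Reals_iff complex_is_Real_iff)
  ultimately show ?thesis by simp
qed

section \<open>Trigonometric polynomials\<close>

inductive_set trig_poly :: "(real \<Rightarrow> complex) set" where
  fexp: "fexp n \<in> trig_poly"
| add: "f \<in> trig_poly \<Longrightarrow> g \<in> trig_poly \<Longrightarrow> (\<lambda>x. f x + c * g x) \<in> trig_poly"

lemma trig_poly_const: "(\<lambda>_. c) \<in> trig_poly"
  using trig_poly.add[OF trig_poly.fexp[of 0] trig_poly.fexp[of 0], of "c - 1"] by simp

lemma trig_poly_scale: "f \<in> trig_poly \<Longrightarrow> (\<lambda>x. c * f x) \<in> trig_poly"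
  using trig_poly.add[OF trig_poly_const[of 0], of f c] by simp

lemma trig_poly_mult:
  assumes "f \<in> trig_poly" "g \<in> trig_poly"
  shows "(\<lambda>x. f x * g x) \<in> trig_poly"
  using assms(1)
proof induction
  case (fexp n)
  show ?case using assms(2)
  proof induction
    case (fexp m)
    then show ?case by (simp add: fexp_mult trig_poly.fexp)
  next
    case (add f g c)
    then show ?case using trig_poly.add[OF add.IH, of c] by (simp add: algebra_simps)
  qed
next
  case (add f1 f2 c)
  then show ?case using trig_poly.add[OF add.IH, of c] by (simp add: algebra_simps)
qed

text \<open>Stone-Weierstrass on the circle delivers real polynomials in the two coordinates. Linear
  forms in the coordinates are combinations of the exponentials of frequency 1 and -1, and
  trigonometric polynomials are closed under products.\<close>

lemma real_polynomial_trig_poly: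
  fixes g :: "complex \<Rightarrow> real"
  assumes "real_polynomial_function g"
  shows "(\<lambda>\<omega>. complex_of_real (g (cis \<omega>))) \<in> trig_poly"
  using assms
proof induction
  case (linear f)
  interpret bounded_linear f by fact
  have "f (cis \<omega>) = cos \<omega> * f 1 + sin \<omega> * f \<i>" for \<omega>
  proof -
    have "cis \<omega> = cos \<omega> *\<^sub>R 1 + sin \<omega> *\<^sub>R \<i>" by (simp add: complex_eq_iff)
    then show ?thesis by (simp add: add scaleR)
  qed
  \<comment> \<open>The coefficients come from Euler's formulas for cosine and sine.\<close>
  moreover have "complex_of_real (cos \<omega> * f 1 + sin \<omega> * f \<i>) =
      ((of_real (f 1) - \<i> * of_real (f \<i>)) / 2) * fexp 1 \<omega> + ((of_real (f 1) + \<i> * of_real (f \<i>)) / 2) * fexp (- 1) \<omega>" for \<omega>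
  proof -
    have "fexp 1 \<omega> = cis \<omega>" "fexp (- 1) \<omega> = cis (- \<omega>)" by (simp_all add: fexp_def cis_conv_exp)
    then show ?thesis by (simp add: complex_eq_iff field_simps)
  qed
  ultimately show ?case
    by (simp only:) (intro trig_poly.add trig_poly_scale trig_poly.fexp)
next
  case (const c)
  then show ?case by (rule trig_poly_const)
next
  case (add f g)
  then show ?case using trig_poly.add[OF add.IH, of 1] by simp
next
  case (mult f g)
  then show ?case using trig_poly_mult[OF mult.IH] by simp
qed

text \<open>No measure is mentioned here, so that a single density argument serves all control measures and
  Lebesgue measure alike.\<close>

locale bounded_limit_closed =
  fixes D :: "(real \<Rightarrow> complex) set"
  assumes D_add: "f \<in> D \<Longrightarrow> g \<in> D \<Longrightarrow> (\<lambda>x. f x + c * g x) \<in> D"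
    and D_lim: "(\<And>k. p k \<in> D) \<Longrightarrow> (\<And>k x. x \<in> {0..<2 * pi} \<Longrightarrow> cmod (p k x) \<le> B) \<Longrightarrow>
      (\<And>x. x \<in> {0..<2 * pi} \<Longrightarrow> (\<lambda>k. p k x) \<longlonglongrightarrow> f x) \<Longrightarrow> f \<in> D"
begin

text \<open>\<open>D_lim\<close> ignores values outside the frequency interval, so a constant
  sequence may be given a limit that differs there.\<close>

lemma D_cong:
  assumes "f \<in> D" "\<And>x. x \<in> {0..<2 * pi} \<Longrightarrow> cmod (f x) \<le> B"
    "\<And>x. x \<in> {0..<2 * pi} \<Longrightarrow> f x = g x"
  shows "g \<in> D"
proof (rule D_lim[where p = "\<lambda>_. f" and B = B])
  show "(\<lambda>k. f x) \<longlonglongrightarrow> g x" if "x \<in> {0..<2 * pi}" for x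
    using assms(3)[OF that] by simp
qed (use assms in auto)

lemma D_zero: "f \<in> D \<Longrightarrow> (\<lambda>_. 0) \<in> D"
  using D_add[of f f "-1"] by simp

lemma D_scale: "f \<in> D \<Longrightarrow> (\<lambda>x. c * f x) \<in> D"
  using D_add[OF D_zero[of f], of f c] by simp

text \<open>The function \<open>h\<close> witnesses that \<open>D\<close> is non-empty, which the
  empty sum requires.\<close>

lemma D_sum:
  assumes "finite I" "\<And>i. i \<in> I \<Longrightarrow> f i \<in> D" "h \<in> D"
  shows "(\<lambda>x. \<Sum>i\<in>I. f i x) \<in> D"
  using assms(1,2)
proof (induction rule: finite_induct)
  case empty
  then show ?case using D_zero[OF assms(3)] by simp
next
  case (insert i I)
  then show ?case using D_add[of "f i" "\<lambda>x. \<Sum>i\<in>I. f i x" 1] by simp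
qed

lemma simple_in_D:
  assumes ind: "\<And>A. A \<in> sets freq_space \<Longrightarrow> (\<lambda>x. indicator A x) \<in> D"
    and F: "simple_function freq_space F"
  shows "F \<in> D"
proof -
  let ?\<Omega> = "{0..<2 * pi}"
  \<comment> \<open>The canonical form of \<open>F\<close>. It agrees with \<open>F\<close> only on
    the frequency interval and vanishes outside, whence the appeal to \<open>D_cong\<close> at the
    end.\<close>
  define S where "S x = (\<Sum>y\<in>F ` ?\<Omega>. y * indicator (F -` {y} \<inter> ?\<Omega>) x)" for x
  have fin: "finite (F ` ?\<Omega>)" using simple_functionD(1)[OF F] by simp
  have "(\<lambda>x. S x) \<in> D"
    unfolding S_def
  proof (intro D_sum fin D_scale ind)
    show "F -` {y} \<inter> ?\<Omega> \<in> sets freq_space" for y using simple_functionD(2)[OF F, of "{y}"] by simp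
    show "(\<lambda>x. indicator {} x) \<in> D" by (rule ind) simp
  qed
  moreover have SF: "S x = F x" if "x \<in> ?\<Omega>" for x
  proof -
    have "S x = (\<Sum>y\<in>F ` ?\<Omega>. if y = F x then F x else 0)"
      unfolding S_def using that by (intro sum.cong) (auto simp: indicator_def)
    then show ?thesis using that fin by simp
  qed
  moreover have "cmod (S x) \<le> (\<Sum>y\<in>F ` ?\<Omega>. cmod y)" if "x \<in> ?\<Omega>" for x
    unfolding SF[OF that] using that fin by (intro member_le_sum) auto
  ultimately show ?thesis by (intro D_cong[of "\<lambda>x. S x" "\<Sum>y\<in>F ` ?\<Omega>. cmod y" F]) auto
qed

lemma bounded_measurable_in_D:
  assumes ind: "\<And>A. A \<in> sets freq_space \<Longrightarrow> (\<lambda>x. indicator A x) \<in> D"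
    and f: "f \<in> borel_measurable freq_space" and B: "\<And>x. x \<in> {0..<2 * pi} \<Longrightarrow> cmod (f x) \<le> B"
  shows "f \<in> D"
proof -
  \<comment> \<open>This form of approximation by simple functions also controls the moduli, which
    gives the uniform bound that \<open>D_lim\<close> asks for.\<close>
  obtain F where F: "\<And>i. simple_function freq_space (F i)"
    "\<And>x. x \<in> {0..<2 * pi} \<Longrightarrow> (\<lambda>i. F i x) \<longlonglongrightarrow> f x"
    "\<And>i x. x \<in> {0..<2 * pi} \<Longrightarrow> dist (F i x) 0 \<le> 2 * dist (f x) 0"
    using borel_measurable_implies_sequence_metric[OF f, of 0] unfolding space_freq_space by blast
  show ?thesis
  proof (rule D_lim[where p = F and B = "2 * B"])
    show "F k \<in> D" for k by (rule simple_in_D[OF ind F(1)])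
    show "cmod (F k x) \<le> 2 * B" if "x \<in> {0..<2 * pi}" for k x
      using F(3)[OF that, of k] B[OF that] by simp
  qed (use F in auto)
qed

text \<open>Everything is transported to the circle, where Stone-Weierstrass puts all continuous
  functions into \<open>D\<close>. Truncated multiples of a distance function increase to the
  indicator of an open set, and a Dynkin class argument passes from open to Borel sets.\<close>

lemma indicator_in_D:
  assumes fexp: "\<And>n. fexp n \<in> D" and A: "A \<in> sets freq_space"
  shows "(\<lambda>x. indicator A x) \<in> D"
proof -
  have trig: "f \<in> D" if "f \<in> trig_poly" for f
    using that by induction (auto intro: fexp D_add)
  have cont: "(\<lambda>\<omega>. complex_of_real (f (cis \<omega>))) \<in> D" if f: "continuous_on (sphere 0 1) f" for f
  proof -
    have "\<exists>g. real_polynomial_function g \<and> (\<forall>z\<in>sphere 0 1. \<bar>f z - g z\<bar> < 1 / Suc k)" for k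
      by (rule Stone_Weierstrass_real_polynomial_function[OF compact_sphere f, of "1 / Suc k"]) auto
    then have "\<exists>g. \<forall>k. real_polynomial_function (g k) \<and> (\<forall>z\<in>sphere 0 1. \<bar>f z - g k z\<bar> < 1 / Suc k)"
      by (intro choice allI)
    then obtain g where "\<forall>k. real_polynomial_function (g k) \<and> (\<forall>z\<in>sphere 0 1. \<bar>f z - g k z\<bar> < 1 / Suc k)"
      by blast
    then have g: "\<And>k. real_polynomial_function (g k)"
      "\<And>k z. cmod z = 1 \<Longrightarrow> \<bar>f z - g k z\<bar> < 1 / Suc k" by simp_all
    have "bounded (f ` sphere 0 1)" 
      using compact_continuous_image[OF f compact_sphere] compact_imp_bounded by blast
    then obtain B where "\<forall>z\<in>sphere 0 1. \<bar>f z\<bar> \<le> B" by (auto simp: bounded_iff)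
    then have B: "\<And>z. cmod z = 1 \<Longrightarrow> \<bar>f z\<bar> \<le> B" by simp
    \<comment> \<open>The error \<open>1 / Suc k\<close> is at most 1, hence the bound
      \<open>B + 1\<close>.\<close>
    show ?thesis
    proof (rule D_lim[where p = "\<lambda>k \<omega>. of_real (g k (cis \<omega>))" and B = "B + 1"])
      show "(\<lambda>\<omega>. complex_of_real (g k (cis \<omega>))) \<in> D" for k
        by (intro trig real_polynomial_trig_poly g)
      show "cmod (of_real (g k (cis x))) \<le> B + 1" for k x
      proof -
        have "\<bar>f (cis x) - g k (cis x)\<bar> < 1 / Suc k" by (rule g) simp
        moreover have "1 / real (Suc k) \<le> 1" by simp
        moreover have "\<bar>f (cis x)\<bar> \<le> B" by (rule B) simp
        ultimately show ?thesis unfolding norm_of_real by linarith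
      qed
      show "(\<lambda>k. complex_of_real (g k (cis x))) \<longlonglongrightarrow> of_real (f (cis x))" for x
      proof (intro tendsto_of_real, rule LIM_zero_cancel, rule Lim_null_comparison[OF _ lim_inverse_n'])
        have "norm (g k (cis x) - f (cis x)) \<le> 1 / k" if "k > 0" for k
        proof -
          have "\<bar>f (cis x) - g k (cis x)\<bar> < 1 / Suc k" by (rule g) simp
          also have "\<dots> \<le> 1 / k" using that by (simp add: field_simps)
          finally show ?thesis by simp
        qed
        then show "\<forall>\<^sub>F k in sequentially. norm (g k (cis x) - f (cis x)) \<le> 1 / k"
          by (rule eventually_mono[OF eventually_gt_at_top[of 0]])
      qed
    qed
  qed
  have D1: "(\<lambda>_. 1) \<in> D" using fexp[of 0] by simp
  \<comment> \<open>The whole plane is treated apart: its complement is empty, where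
    \<open>infdist\<close> is 0 by convention and the approximants would vanish.\<close>
  have opn: "(\<lambda>x. indicator U (cis x)) \<in> D" if U: "open U" for U
  proof (cases "U = UNIV")
    case True
    then show ?thesis using D1 by simp
  next
    case False
    show ?thesis
    proof (rule D_lim[where p = "\<lambda>k \<omega>. of_real (min 1 (real k * infdist (cis \<omega>) (- U)))" and B = 1])
      show "(\<lambda>\<omega>. complex_of_real (min 1 (real k * infdist (cis \<omega>) (- U)))) \<in> D" for k
        by (rule cont) (intro continuous_intros)
      show "cmod (complex_of_real (min 1 (real k * infdist (cis x) (- U)))) \<le> 1" for k x
        using mult_nonneg_nonneg[OF of_nat_0_le_iff[of k] infdist_nonneg[of "cis x" "- U"]]
        unfolding norm_of_real by linarith
      show "(\<lambda>k. complex_of_real (min 1 (real k * infdist (cis x) (- U)))) \<longlonglongrightarrow> indicator U (cis x)" for x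
      proof (cases "cis x \<in> U")
        case True
        have cl: "closed (- U)" using U by auto
        have pos: "infdist (cis x) (- U) > 0"
          using in_closed_iff_infdist_zero[OF cl, of "cis x"] False True infdist_nonneg[of "cis x" "- U"]
          by (auto simp: less_le)
        have "\<forall>\<^sub>F k in sequentially. complex_of_real (min 1 (real k * infdist (cis x) (- U))) = 1"
          using eventually_ge_at_top[of "nat \<lceil>1 / infdist (cis x) (- U)\<rceil>"]
        proof eventually_elim
          case (elim k)
          then have "1 / infdist (cis x) (- U) \<le> k" by linarith
          then show ?case using pos by (simp add: min_def field_simps)
        qed
        then show ?thesis using True by (simp add: tendsto_eventually)
      qed auto
    qed
  qed
  have borel: "(\<lambda>x. indicator (W :: complex set) (cis x)) \<in> D" if W: "W \<in> sets borel" for W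
  proof -
    \<comment> \<open>Open sets are a generator stable under intersections, so closure under
      complements and countable disjoint unions is enough; the disjointness keeps the partial sums
      bounded by 1.\<close>
    have "Int_stable {S :: complex set. open S}" by (auto simp: Int_stable_def)
    moreover have "{S :: complex set. open S} \<subseteq> Pow UNIV" by simp
    moreover have "W \<in> sigma_sets UNIV {S. open S}" using W by (simp add: borel_def)
    ultimately show ?thesis
    proof (induction rule: sigma_sets_induct_disjoint)
      case (basic U)
      then show ?case using opn by simp
    next
      case empty
      then show ?case using D_zero[OF D1] by simp
    next
      case (compl W)
      have "(\<lambda>x. indicator (UNIV - W) (cis x)) = (\<lambda>x. 1 + (- 1) * indicator W (cis x) :: complex)"
        by (auto simp: indicator_def)
      then show ?case using D_add[OF D1 compl(2), of "-1"] by simp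
    next
      case (union Q)
      show ?case
      proof (rule D_lim[where p = "\<lambda>k x. \<Sum>i<k. indicator (Q i) (cis x)" and B = 1])
        show "(\<lambda>x. \<Sum>i<k. indicator (Q i) (cis x)) \<in> D" for k
          by (rule D_sum) (use union D1 in auto)
        have eq: "(\<Sum>i<k. indicator (Q i) z) = (indicator (\<Union>i<k. Q i) z :: complex)" for k z
          using union(1) by (subst indicator_UN_disjoint) (auto simp: disjoint_family_on_def)
        show "cmod (\<Sum>i<k. indicator (Q i) (cis x)) \<le> 1" for k x
          unfolding eq by (simp add: indicator_def)
        show "(\<lambda>k. \<Sum>i<k. indicator (Q i) (cis x)) \<longlonglongrightarrow> (indicator (\<Union> (range Q)) (cis x) :: complex)" for x
          unfolding eq by (rule LIMSEQ_indicator_UN)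
      qed
    qed
  qed
  \<comment> \<open>Back from the circle: on the half-open interval \<open>Arg2pi\<close> is a left
    inverse of \<open>cis\<close>, so the indicator of this preimage at \<open>cis x\<close> is the
    indicator of \<open>A\<close> at \<open>x\<close>.\<close>
  have "Arg2pi -` A \<in> sets borel"
    using A measurable_sets[OF borel_measurable_Arg2pi, of A] by (simp add: sets_freq_space)
  from borel[OF this] have "(\<lambda>x. indicator (Arg2pi -` A) (cis x)) \<in> D" .
  moreover have "Arg2pi (cis x) = x" if "x \<in> {0..<2 * pi}" for x
    by (rule Arg2pi_unique[of 1]) (use that in \<open>auto simp: cis_conv_exp\<close>)
  ultimately show ?thesis
    by (elim D_cong[where B = 1]) (auto simp: indicator_def)
qed

lemma fexp_bounded_measurable_in_D:
  assumes "\<And>n. fexp n \<in> D" "f \<in> borel_measurable freq_space" "\<And>x. x \<in> {0..<2 * pi} \<Longrightarrow> cmod (f x) \<le> B"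
  shows "f \<in> D"
  using bounded_measurable_in_D[OF indicator_in_D] assms by blast

end

section \<open>Orthogonal random measures\<close>

definition freq_lebesgue :: "real measure" where
  "freq_lebesgue = restrict_space lborel {0..<2 * pi}"

lemma space_freq_lebesgue [simp]: "space freq_lebesgue = {0..<2 * pi}"
  by (simp add: freq_lebesgue_def space_restrict_space)

lemma sets_freq_lebesgue [measurable_cong, simp]: "sets freq_lebesgue = sets freq_space"
  by (simp add: freq_lebesgue_def freq_space_def sets_restrict_space)

lemma finite_measure_freq_lebesgue: "finite_measure freq_lebesgue"
  by (rule finite_measureI) (simp add: freq_lebesgue_def emeasure_restrict_space space_restrict_space)

text \<open>Dominated convergence with a constant majorant. This is how the measure-free premise of
  \<open>D_lim\<close> becomes convergence in \<open>L2\<close> of any finite measure on the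
  frequency interval.\<close>

lemma sq_norm_bounded_limit:
  assumes "finite_measure \<mu>" and sets: "sets \<mu> = sets freq_space"
    and p: "\<And>k. p k \<in> borel_measurable freq_space" and f: "f \<in> borel_measurable freq_space"
    and B: "\<And>k x. x \<in> {0..<2 * pi} \<Longrightarrow> cmod (p k x) \<le> B"
    and lim: "\<And>x. x \<in> {0..<2 * pi} \<Longrightarrow> (\<lambda>k. p k x) \<longlonglongrightarrow> f x"
  shows "(\<lambda>k. sq_norm \<mu> (\<lambda>x. p k x - f x)) \<longlonglongrightarrow> 0"
proof -
  interpret finite_measure \<mu> by fact
  note [measurable_cong] = sets
  note [measurable] = p f
  have sp: "space \<mu> = {0..<2 * pi}" using sets_eq_imp_space_eq[OF sets] by simp
  have fB: "cmod (f x) \<le> B" if "x \<in> {0..<2 * pi}" for x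
    by (rule LIMSEQ_le_const2[OF tendsto_norm[OF lim[OF that]]]) (use B that in auto)
  have "(\<lambda>k. \<integral>x. (cmod (p k x - f x))\<^sup>2 \<partial>\<mu>) \<longlonglongrightarrow> (\<integral>x. 0 \<partial>\<mu>)"
  proof (rule integral_dominated_convergence[where w = "\<lambda>_. (2 * B)\<^sup>2"])
    show "AE x in \<mu>. (\<lambda>k. (cmod (p k x - f x))\<^sup>2) \<longlonglongrightarrow> 0"
    proof (rule AE_I2)
      fix x assume "x \<in> space \<mu>"
      then have "(\<lambda>k. (cmod (p k x - f x))\<^sup>2) \<longlonglongrightarrow> (cmod (f x - f x))\<^sup>2"
        unfolding sp by (intro tendsto_intros lim)
      then show "(\<lambda>k. (cmod (p k x - f x))\<^sup>2) \<longlonglongrightarrow> 0" by simp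
    qed
    show "AE x in \<mu>. norm ((cmod (p k x - f x))\<^sup>2) \<le> (2 * B)\<^sup>2" for k
    proof (rule AE_I2)
      fix x assume x: "x \<in> space \<mu>"
      have "cmod (p k x - f x) \<le> 2 * B"
        using norm_triangle_ineq4[of "p k x" "f x"] B[of x k] fB[of x] x sp by simp
      then have "(cmod (p k x - f x))\<^sup>2 \<le> (2 * B)\<^sup>2" by (rule power_mono) simp
      then show "norm ((cmod (p k x - f x))\<^sup>2) \<le> (2 * B)\<^sup>2" unfolding real_norm_def abs_power2 .
    qed
  qed auto
  then show ?thesis by (simp add: sq_norm_def)
qed

lemma bounded_limit_measurable:
  fixes p :: "nat \<Rightarrow> real \<Rightarrow> complex"
  assumes p: "\<And>k. p k \<in> borel_measurable freq_space"
    and lim: "\<And>x. x \<in> {0..<2 * pi} \<Longrightarrow> (\<lambda>k. p k x) \<longlonglongrightarrow> f x"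
  shows "f \<in> borel_measurable freq_space"
  by (rule borel_measurable_LIMSEQ_metric[where f = p]) (use p lim in auto)

lemma bounded_mult_integrable:
  assumes g: "integrable freq_lebesgue (g :: real \<Rightarrow> complex)" and [measurable]: "f \<in> borel_measurable freq_space"
    and B: "\<And>x. x \<in> {0..<2 * pi} \<Longrightarrow> cmod (f x) \<le> B"
  shows "integrable freq_lebesgue (\<lambda>x. f x * g x)"
proof (rule Bochner_Integration.integrable_bound[where f = "\<lambda>x. of_real B * g x"])
  show "integrable freq_lebesgue (\<lambda>x. of_real B * g x)" using g by simp
  have [measurable]: "g \<in> borel_measurable freq_lebesgue" using g by simp
  show "(\<lambda>x. f x * g x) \<in> borel_measurable freq_lebesgue" by measurable
  show "AE x in freq_lebesgue. norm (f x * g x) \<le> norm (of_real B * g x)"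
  proof (rule AE_I2)
    fix x assume "x \<in> space freq_lebesgue"
    then have "cmod (f x) \<le> \<bar>B\<bar>" using B[of x] by simp
    then show "norm (f x * g x) \<le> norm (of_real B * g x)" by (simp add: norm_mult mult_right_mono)
  qed
qed

text \<open>The weight \<open>g\<close> is only integrable, so convergence in mean square would not
  give this limit; \<open>g\<close> itself provides the majorant.\<close>

lemma bounded_mult_limit:
  assumes g: "integrable freq_lebesgue (g :: real \<Rightarrow> complex)"
    and p: "\<And>k. p k \<in> borel_measurable freq_space"
    and B: "\<And>k x. x \<in> {0..<2 * pi} \<Longrightarrow> cmod (p k x) \<le> B"
    and lim: "\<And>x. x \<in> {0..<2 * pi} \<Longrightarrow> (\<lambda>k. p k x) \<longlonglongrightarrow> f x"
  shows "(\<lambda>k. \<integral>x. p k x * g x \<partial>freq_lebesgue) \<longlonglongrightarrow> (\<integral>x. f x * g x \<partial>freq_lebesgue)"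
proof (rule integral_dominated_convergence[where w = "\<lambda>x. B * cmod (g x)"])
  have [measurable]: "g \<in> borel_measurable freq_lebesgue" using g by simp
  note [measurable] = p bounded_limit_measurable[OF p lim]
  show "(\<lambda>x. f x * g x) \<in> borel_measurable freq_lebesgue" by measurable
  show "(\<lambda>x. p k x * g x) \<in> borel_measurable freq_lebesgue" for k by measurable
  show "integrable freq_lebesgue (\<lambda>x. B * cmod (g x))" using g by simp
  show "AE x in freq_lebesgue. (\<lambda>k. p k x * g x) \<longlonglongrightarrow> f x * g x"
    by (rule AE_I2) (auto intro!: tendsto_intros lim)
  show "AE x in freq_lebesgue. norm (p k x * g x) \<le> B * cmod (g x)" for k
    by (rule AE_I2) (auto simp: norm_mult intro!: mult_right_mono B)
qed

locale frequency_isometry = isometric_generators \<mu> M G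
  for \<mu> :: "real measure" and M :: "'a measure" and G +
  assumes finite_mu: "finite_measure \<mu>" and sets_mu: "sets \<mu> = sets freq_space"
begin

lemma bounded_in_L2:
  assumes "f \<in> borel_measurable freq_space" "\<And>x. x \<in> {0..<2 * pi} \<Longrightarrow> cmod (f x) \<le> B"
  shows "f \<in> L2 \<mu>"
proof (rule L2_bounded[OF finite_mu])
  show "f \<in> borel_measurable \<mu>" using assms(1) measurable_cong_sets[OF sets_mu refl] by blast
  show "cmod (f x) \<le> B" if "x \<in> space \<mu>" for x
    using that assms(2) sets_eq_imp_space_eq[OF sets_mu] by simp
qed

lemma C_measurable:
  assumes "(f, P) \<in> C"
  shows "f \<in> borel_measurable freq_space"
  using L2_measurable[OF C_L2(1)[OF assms]] unfolding measurable_cong_sets[OF sets_mu refl] .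

text \<open>The existence of a partner \<open>P\<close> and the pairing identity are carried
  together, so that one limit argument preserves both: completeness gives the partner of the limit,
  dominated convergence the right-hand side. With \<open>W\<close> and \<open>g\<close> equal to 0
  only the existence of partners remains, and it is used in this form as well.\<close>

lemma pairing_closed:
  assumes W: "W \<in> L2 M" and g: "integrable freq_lebesgue g"
  shows "bounded_limit_closed
    {f. \<exists>P. (f, P) \<in> C \<and> integrable freq_lebesgue (\<lambda>x. f x * g x) \<and>
       ip M P W = (\<integral>x. f x * g x \<partial>freq_lebesgue)}"
    (is "bounded_limit_closed ?D")
proof
  fix f h c assume "f \<in> ?D" "h \<in> ?D"
  then obtain P Q where
    P: "(f, P) \<in> C" "integrable freq_lebesgue (\<lambda>x. f x * g x)" "ip M P W = (\<integral>x. f x * g x \<partial>freq_lebesgue)" and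
    Q: "(h, Q) \<in> C" "integrable freq_lebesgue (\<lambda>x. h x * g x)" "ip M Q W = (\<integral>x. h x * g x \<partial>freq_lebesgue)"
    by blast
  have eq: "(\<lambda>x. (f x + c * h x) * g x) = (\<lambda>x. f x * g x + c * (h x * g x))"
    by (simp add: algebra_simps)
  show "(\<lambda>x. f x + c * h x) \<in> ?D"
  proof (intro CollectI exI conjI)
    show "((\<lambda>x. f x + c * h x), (\<lambda>x. P x + c * Q x)) \<in> C" by (rule closed_span.add[OF P(1) Q(1)])
    show "integrable freq_lebesgue (\<lambda>x. (f x + c * h x) * g x)"
      unfolding eq using P(2) Q(2) by simp
    show "ip M (\<lambda>x. P x + c * Q x) W = (\<integral>x. (f x + c * h x) * g x \<partial>freq_lebesgue)"
      unfolding eq ip_add_left[OF C_L2(2)[OF P(1)] C_L2(2)[OF Q(1)] W] P(3) Q(3)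
      using P(2) Q(2) by simp
  qed
next
  fix p B f assume p: "\<And>k. p k \<in> ?D" and B: "\<And>k x. x \<in> {0..<2 * pi} \<Longrightarrow> cmod (p k x) \<le> B"
    and lim: "\<And>x. x \<in> {0..<2 * pi} \<Longrightarrow> (\<lambda>k. p k x) \<longlonglongrightarrow> f x"
  from p have "\<exists>P. \<forall>k. (p k, P k) \<in> C \<and> ip M (P k) W = (\<integral>x. p k x * g x \<partial>freq_lebesgue)"
    by (intro choice) blast
  then obtain P where P: "\<And>k. (p k, P k) \<in> C" "\<And>k. ip M (P k) W = (\<integral>x. p k x * g x \<partial>freq_lebesgue)"
    by blast
  have pm: "p k \<in> borel_measurable freq_space" for k by (rule C_measurable[OF P(1)])
  have fm: "f \<in> borel_measurable freq_space" by (rule bounded_limit_measurable[OF pm lim])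
  have fB: "cmod (f x) \<le> B" if "x \<in> {0..<2 * pi}" for x
    by (rule LIMSEQ_le_const2[OF tendsto_norm[OF lim[OF that]]]) (use B that in auto)
  have f: "f \<in> L2 \<mu>" by (rule bounded_in_L2[OF fm fB])
  obtain Z where Z: "(f, Z) \<in> C" "(\<lambda>k. sq_norm M (\<lambda>x. P k x - Z x)) \<longlonglongrightarrow> 0"
    using C_limit[OF P(1) f sq_norm_bounded_limit[OF finite_mu sets_mu pm fm B lim]] by blast
  have "(\<lambda>k. ip M (P k) W) \<longlonglongrightarrow> ip M Z W"
    by (rule tendsto_ip_left[OF C_L2(2)[OF P(1)] C_L2(2)[OF Z(1)] W Z(2)])
  moreover have "(\<lambda>k. ip M (P k) W) \<longlonglongrightarrow> (\<integral>x. f x * g x \<partial>freq_lebesgue)"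
    unfolding P(2) by (rule bounded_mult_limit[OF g pm B lim])
  ultimately have "ip M Z W = (\<integral>x. f x * g x \<partial>freq_lebesgue)"
    by (rule LIMSEQ_unique)
  with Z(1) bounded_mult_integrable[OF g fm fB] show "f \<in> ?D" by blast
qed

end

section \<open>A single orthogonal random measure and its control measure\<close>

locale orthogonal_random_measure = prob_space M for M :: "'a measure" +
  fixes \<phi> :: "real set \<Rightarrow> 'a \<Rightarrow> complex"
  assumes random: "random_measure M \<phi>"
    and orthogonal: "A \<in> sets freq_space \<Longrightarrow> B \<in> sets freq_space \<Longrightarrow> A \<inter> B = {} \<Longrightarrow> ip M (\<phi> A) (\<phi> B) = 0"
begin

lemma phi_L2: "A \<in> sets freq_space \<Longrightarrow> \<phi> A \<in> L2 M"
  using random by (simp add: random_measure_def L2_def)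

lemma phi_sum_L2: "(\<And>i. i \<in> I \<Longrightarrow> A i \<in> sets freq_space) \<Longrightarrow> finite I \<Longrightarrow> (\<lambda>x. \<Sum>i\<in>I. \<phi> (A i) x) \<in> L2 M"
proof (induction I rule: infinite_finite_induct)
  case (insert i I)
  then show ?case by (simp add: L2_add phi_L2)
qed auto

text \<open>The empty set is disjoint from itself, so its value is orthogonal to itself.\<close>

lemma phi_empty: "AE x in M. \<phi> {} x = 0"
proof -
  have "of_real (sq_norm M (\<phi> {})) = ip M (\<phi> {}) (\<phi> {})" by (simp add: ip_self)
  also have "\<dots> = 0" by (rule orthogonal) auto
  finally show ?thesis using sq_norm_zero_iff[OF phi_L2[of "{}"]] by simp
qed

lemma phi_sigma_additive:
  assumes "\<And>i. A i \<in> sets freq_space" "disjoint_family A"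
  shows "(\<lambda>N. sq_norm M (\<lambda>x. (\<Sum>i<N. \<phi> (A i) x) - \<phi> (\<Union>i. A i) x)) \<longlonglongrightarrow> 0"
proof -
  have "mean_square_tendsto M (\<lambda>N x. \<Sum>i<N. \<phi> (A i) x) (\<phi> (\<Union>i. A i))"
    using random assms by (auto simp: random_measure_def)
  then show ?thesis
    by (subst (asm) mean_square_tendsto_L2_iff) (use assms in \<open>auto intro!: phi_sum_L2 phi_L2\<close>)
qed

text \<open>A random measure is additive over sequences only. The two sets are padded with empty
  sets, whose values vanish almost everywhere, so the distance to the limit is constant from the
  second partial sum on.\<close>

lemma phi_Un:
  assumes A: "A \<in> sets freq_space" and B: "B \<in> sets freq_space" and "A \<inter> B = {}"
  shows "AE x in M. \<phi> (A \<union> B) x = \<phi> A x + \<phi> B x"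
proof -
  define F where "F i = (if i = 0 then A else if i = 1 then B else {})" for i :: nat
  have F: "F i \<in> sets freq_space" for i using A B by (simp add: F_def)
  have UF: "(\<Union>i. F i) = A \<union> B" by (auto simp: F_def split: if_splits)
  have dF: "disjoint_family F" using \<open>A \<inter> B = {}\<close> by (auto simp: disjoint_family_on_def F_def)
  have AB: "\<phi> (A \<union> B) \<in> L2 M" using A B by (intro phi_L2) auto
  have eq: "sq_norm M (\<lambda>x. (\<Sum>i<N. \<phi> (F i) x) - \<phi> (A \<union> B) x) =
      sq_norm M (\<lambda>x. \<phi> A x + \<phi> B x - \<phi> (A \<union> B) x)" if "N \<ge> 2" for N
  proof -
    have "AE x in M. (\<Sum>i<N. \<phi> (F i) x) = \<phi> A x + \<phi> B x"
      using phi_empty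
    proof eventually_elim
      case (elim x)
      have "(\<Sum>i<N. \<phi> (F i) x) = (\<Sum>i\<in>{0, 1}. \<phi> (F i) x)"
        using that elim by (intro sum.mono_neutral_right) (auto simp: F_def)
      then show ?case by (simp add: F_def)
    qed
    moreover have "(\<lambda>x. \<Sum>i<N. \<phi> (F i) x) \<in> borel_measurable M"
      using F by (intro L2_measurable phi_sum_L2) auto
    ultimately show ?thesis
      unfolding sq_norm_def
      using L2_measurable[OF AB] L2_measurable[OF phi_L2[OF A]] L2_measurable[OF phi_L2[OF B]]
      by (intro integral_cong_AE) auto
  qed
  have "(\<lambda>N. sq_norm M (\<lambda>x. (\<Sum>i<N. \<phi> (F i) x) - \<phi> (A \<union> B) x)) \<longlonglongrightarrow> 0"
    using phi_sigma_additive[OF F dF] by (simp add: UF)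
  moreover have "\<forall>\<^sub>F N in sequentially. sq_norm M (\<lambda>x. (\<Sum>i<N. \<phi> (F i) x) - \<phi> (A \<union> B) x) =
      sq_norm M (\<lambda>x. \<phi> A x + \<phi> B x - \<phi> (A \<union> B) x)"
    using eventually_ge_at_top[of 2] by eventually_elim (rule eq)
  ultimately have "(\<lambda>N::nat. sq_norm M (\<lambda>x. \<phi> A x + \<phi> B x - \<phi> (A \<union> B) x)) \<longlonglongrightarrow> 0"
    by (rule Lim_transform_eventually)
  then have "sq_norm M (\<lambda>x. \<phi> A x + \<phi> B x - \<phi> (A \<union> B) x) = 0"
    by (simp add: LIMSEQ_const_iff)
  then have "AE x in M. \<phi> A x + \<phi> B x - \<phi> (A \<union> B) x = 0"
    using sq_norm_zero_iff[OF L2_diff[OF L2_add[OF phi_L2[OF A] phi_L2[OF B]] AB]] by simp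
  then show ?thesis by eventually_elim simp
qed

text \<open>Both sets are split along \<open>A \<inter> B\<close>. The terms that drop out pair
  \<open>A - B\<close> with \<open>B\<close> and \<open>A \<inter> B\<close> with
  \<open>B - A\<close>. A second measure \<psi> is allowed, so the same identity serves the cross
  spectral distributions.\<close>

lemma ip_phi:
  assumes A: "A \<in> sets freq_space" and B: "B \<in> sets freq_space"
    and \<psi>: "orthogonal_random_measure M \<psi>"
    and cross: "\<And>A B. A \<in> sets freq_space \<Longrightarrow> B \<in> sets freq_space \<Longrightarrow> A \<inter> B = {} \<Longrightarrow> ip M (\<phi> A) (\<psi> B) = 0"
  shows "ip M (\<phi> A) (\<psi> B) = ip M (\<phi> (A \<inter> B)) (\<psi> (A \<inter> B))"
proof -
  interpret \<psi>: orthogonal_random_measure M \<psi> by fact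
  have I: "A \<inter> B \<in> sets freq_space" and DA: "A - B \<in> sets freq_space" and DB: "B - A \<in> sets freq_space"
    using A B by auto
  have "AE x in M. \<phi> (A \<inter> B \<union> (A - B)) x = \<phi> (A \<inter> B) x + \<phi> (A - B) x" by (rule phi_Un[OF I DA]) auto
  moreover have "A \<inter> B \<union> (A - B) = A" by auto
  ultimately have 1: "AE x in M. \<phi> A x = \<phi> (A \<inter> B) x + 1 * \<phi> (A - B) x" by simp
  have "AE x in M. \<psi> (A \<inter> B \<union> (B - A)) x = \<psi> (A \<inter> B) x + \<psi> (B - A) x" by (rule \<psi>.phi_Un[OF I DB]) auto
  moreover have "A \<inter> B \<union> (B - A) = B" by auto
  ultimately have 2: "AE x in M. \<psi> B x = \<psi> (A \<inter> B) x + 1 * \<psi> (B - A) x" by simp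
  have "ip M (\<phi> A) (\<psi> B) = ip M (\<lambda>x. \<phi> (A \<inter> B) x + 1 * \<phi> (A - B) x) (\<psi> B)"
    by (rule ip_cong_AE[OF phi_L2[OF A] \<psi>.phi_L2[OF B] _ _ 1])
      (use phi_L2[OF I] phi_L2[OF DA] \<psi>.phi_L2[OF B] in \<open>auto dest!: L2_measurable\<close>)
  also have "\<dots> = ip M (\<phi> (A \<inter> B)) (\<psi> B)"
    unfolding ip_add_left[OF phi_L2[OF I] phi_L2[OF DA] \<psi>.phi_L2[OF B]]
    using cross[OF DA B] by auto
  also have "\<dots> = ip M (\<phi> (A \<inter> B)) (\<lambda>x. \<psi> (A \<inter> B) x + 1 * \<psi> (B - A) x)"
    by (rule ip_cong_AE[OF phi_L2[OF I] \<psi>.phi_L2[OF B] _ _ _ 2])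
      (use phi_L2[OF I] \<psi>.phi_L2[OF I] \<psi>.phi_L2[OF DB] in \<open>auto dest!: L2_measurable\<close>)
  also have "\<dots> = ip M (\<phi> (A \<inter> B)) (\<psi> (A \<inter> B))"
    unfolding ip_add_right[OF phi_L2[OF I] \<psi>.phi_L2[OF I] \<psi>.phi_L2[OF DB]]
    using cross[OF I DB] by auto
  finally show ?thesis .
qed

lemma ip_phi_self:
  assumes "A \<in> sets freq_space" "B \<in> sets freq_space"
  shows "ip M (\<phi> A) (\<phi> B) = of_real (sq_norm M (\<phi> (A \<inter> B)))"
  by (rule trans[OF ip_phi[OF assms orthogonal_random_measure_axioms orthogonal] ip_self])

text \<open>Pairing the partial sums with the value on the union turns mean-square additivity into
  convergence of numbers: each \<open>\<phi> (A i)\<close> contributes exactly its squared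
  norm.\<close>

lemma sq_norm_phi_sums:
  assumes A: "\<And>i. A i \<in> sets freq_space" "disjoint_family A"
  shows "(\<lambda>i. sq_norm M (\<phi> (A i))) sums sq_norm M (\<phi> (\<Union>i. A i))"
proof -
  have U: "(\<Union>i. A i) \<in> sets freq_space" using A by auto
  have "(\<lambda>N. ip M (\<lambda>x. \<Sum>i<N. \<phi> (A i) x) (\<phi> (\<Union>i. A i))) \<longlonglongrightarrow> ip M (\<phi> (\<Union>i. A i)) (\<phi> (\<Union>i. A i))"
    by (rule tendsto_ip_left) (use A in \<open>auto intro!: phi_sum_L2 phi_L2 phi_sigma_additive\<close>)
  moreover have "ip M (\<lambda>x. \<Sum>i<N. \<phi> (A i) x) (\<phi> (\<Union>i. A i)) = of_real (\<Sum>i<N. sq_norm M (\<phi> (A i)))" for N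
  proof (induction N)
    case 0
    then show ?case by (simp add: ip_def)
  next
    case (Suc N)
    have "A N \<inter> (\<Union>i. A i) = A N" by auto
    then have "ip M (\<phi> (A N)) (\<phi> (\<Union>i. A i)) = of_real (sq_norm M (\<phi> (A N)))"
      using ip_phi_self[OF A(1)[of N] U] by simp
    moreover have "(\<lambda>x. \<Sum>i<N. \<phi> (A i) x) \<in> L2 M" using A by (intro phi_sum_L2) auto
    ultimately show ?case
      using ip_add_left[of "\<lambda>x. \<Sum>i<N. \<phi> (A i) x" M "\<phi> (A N)" "\<phi> (\<Union>i. A i)" 1] A U Suc
      by (simp add: phi_L2)
  qed
  ultimately have "(\<lambda>N. complex_of_real (\<Sum>i<N. sq_norm M (\<phi> (A i)))) \<longlonglongrightarrow> of_real (sq_norm M (\<phi> (\<Union>i. A i)))"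
    by (simp only: ip_self)
  then show ?thesis unfolding sums_def by (simp only: tendsto_of_real_iff)
qed

lemma sets_control [simp]: "sets (control_measure M \<phi>) = sets freq_space"
proof -
  have "sets (control_measure M \<phi>) = sigma_sets {0..<2 * pi} (sets freq_space)"
    unfolding control_measure_def
    by (rule sets_measure_of) (use sets.space_closed[of freq_space] in simp)
  also have "\<dots> = sets freq_space"
    using sets.sigma_sets_eq[of freq_space] by (simp only: space_freq_space)
  finally show ?thesis .
qed

lemma space_control [simp]: "space (control_measure M \<phi>) = {0..<2 * pi}"
  using sets_eq_imp_space_eq[OF sets_control] by (simp only: space_freq_space)

text \<open>\<open>measure_of\<close> returns the given set function only if that function is
  positive and countably additive, which is the content of \<open>phi_empty\<close> and
  \<open>sq_norm_phi_sums\<close>.\<close>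

lemma emeasure_control:
  assumes A: "A \<in> sets freq_space"
  shows "emeasure (control_measure M \<phi>) A = ennreal (sq_norm M (\<phi> A))"
proof -
  have "emeasure (control_measure M \<phi>) A = ennreal (\<integral>x. (cmod (\<phi> A x))\<^sup>2 \<partial>M)"
  proof (rule emeasure_measure_of[OF control_measure_def])
    show "sets freq_space \<subseteq> Pow {0..<2 * pi}" using sets.space_closed[of freq_space] by simp
    show "A \<in> sets (control_measure M \<phi>)" using A by simp
    have "sq_norm M (\<phi> {}) = 0" using phi_empty sq_norm_zero_iff[OF phi_L2[of "{}"]] by simp
    then show "positive (sets (control_measure M \<phi>)) (\<lambda>A. ennreal (\<integral>x. (cmod (\<phi> A x))\<^sup>2 \<partial>M))"
      by (simp add: positive_def sq_norm_def)
    show "countably_additive (sets (control_measure M \<phi>)) (\<lambda>A. ennreal (\<integral>x. (cmod (\<phi> A x))\<^sup>2 \<partial>M))"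
    proof (rule countably_additiveI)
      fix F :: "nat \<Rightarrow> real set" assume F: "range F \<subseteq> sets (control_measure M \<phi>)" "disjoint_family F"
      then have s: "(\<lambda>i. sq_norm M (\<phi> (F i))) sums sq_norm M (\<phi> (\<Union>i. F i))"
        by (intro sq_norm_phi_sums) auto
      then have "(\<Sum>i. ennreal (sq_norm M (\<phi> (F i)))) = ennreal (sq_norm M (\<phi> (\<Union>i. F i)))"
        by (subst suminf_ennreal2) (auto simp: sums_iff)
      then show "(\<Sum>i. ennreal (\<integral>x. (cmod (\<phi> (F i) x))\<^sup>2 \<partial>M)) = ennreal (\<integral>x. (cmod (\<phi> (\<Union> (range F)) x))\<^sup>2 \<partial>M)"
        by (simp add: sq_norm_def)
    qed
  qed
  then show ?thesis by (simp add: sq_norm_def)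
qed

lemma finite_control: "finite_measure (control_measure M \<phi>)"
  by (rule finite_measureI) (simp add: emeasure_control sets_freq_space)

text \<open>The closed span of these pairs plays the role of the graph of the stochastic integral
  with respect to \<phi>.\<close>

definition indicator_pairs where
  "indicator_pairs = {((\<lambda>x. indicator A x :: complex), \<phi> A) |A. A \<in> sets freq_space}"

sublocale frequency_isometry "control_measure M \<phi>" M indicator_pairs
proof (intro frequency_isometry.intro isometric_generators.intro isometric_generators_axioms.intro
    frequency_isometry_axioms.intro)
  fix f Z assume "(f, Z) \<in> indicator_pairs"
  then obtain A where A: "A \<in> sets freq_space" "f = (\<lambda>x. indicator A x)" "Z = \<phi> A"
    by (auto simp: indicator_pairs_def)
  show "Z \<in> L2 M" using A by (simp add: phi_L2)
  show "f \<in> L2 (control_measure M \<phi>)"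
  proof (rule L2_bounded[OF finite_control])
    show "f \<in> borel_measurable (control_measure M \<phi>)"
      unfolding A(2) by (rule borel_measurable_indicator) (simp add: A(1))
    show "cmod (f x) \<le> 1" for x using A by (simp add: indicator_def)
  qed
  fix g W assume "(g, W) \<in> indicator_pairs"
  then obtain B where B: "B \<in> sets freq_space" "g = (\<lambda>x. indicator B x)" "W = \<phi> B"
    by (auto simp: indicator_pairs_def)
  have I: "A \<inter> B \<in> sets freq_space" using A B by auto
  have "A \<inter> B \<subseteq> {0..<2 * pi}" using sets.sets_into_space[OF I] by (simp only: space_freq_space)
  then have "A \<inter> B \<inter> {0..<2 * pi} = A \<inter> B" by (rule inf_absorb1)
  then have sp: "A \<inter> B \<inter> space (control_measure M \<phi>) = A \<inter> B" by (simp only: space_control)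
  have "ip (control_measure M \<phi>) f g = (\<integral>x. complex_of_real (indicator (A \<inter> B) x) \<partial>control_measure M \<phi>)"
    unfolding ip_def A B by (intro Bochner_Integration.integral_cong) (auto simp: indicator_def)
  also have "\<dots> = of_real (measure (control_measure M \<phi>) (A \<inter> B))"
    unfolding integral_complex_of_real Bochner_Integration.integral_indicator sp ..
  also have "\<dots> = of_real (sq_norm M (\<phi> (A \<inter> B)))"
    unfolding measure_def emeasure_control[OF I] by simp
  also have "\<dots> = ip M Z W" unfolding A B ip_phi_self[OF A(1) B(1)] ..
  finally show "ip (control_measure M \<phi>) f g = ip M Z W" .
qed (rule prob_space_axioms finite_control sets_control)+

end

text \<open>Formulated for any isometric relation that contains the pairs of indicators, because it
  is used both where indicators are the generators and where exponentials are.\<close>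

lemma simple_integral_in_closed_span:
  assumes "isometric_generators \<mu> M G" "finite_measure \<mu>" and sets: "sets \<mu> = sets freq_space"
    and phi: "\<And>A. A \<in> sets freq_space \<Longrightarrow> ((\<lambda>x. indicator A x), \<phi> A) \<in> closed_span \<mu> M G"
    and F: "simple_function freq_space F"
  shows "(F, simple_stochastic_integral \<phi> F) \<in> closed_span \<mu> M G"
proof -
  interpret isometric_generators \<mu> M G by fact
  let ?\<Omega> = "{0..<2 * pi}"
  have fin: "finite (F ` ?\<Omega>)" using simple_functionD(1)[OF F] by simp
  have sp: "space \<mu> = ?\<Omega>" using sets_eq_imp_space_eq[OF sets] by simp
  define S where "S Y x = (\<Sum>y\<in>Y. y * indicator (F -` {y} \<inter> ?\<Omega>) x)" for Y x
  have S: "(S Y, (\<lambda>x. \<Sum>y\<in>Y. y * \<phi> (F -` {y} \<inter> ?\<Omega>) x)) \<in> C" if "finite Y" for Y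
    using that
  proof induction
    case empty
    then show ?case unfolding S_def by (simp add: closed_span.zero)
  next
    case (insert y Y)
    have "F -` {y} \<inter> ?\<Omega> \<in> sets freq_space" using simple_functionD(2)[OF F, of "{y}"] by simp
    from closed_span.add[OF insert.IH phi[OF this], of y] show ?case
      unfolding S_def sum.insert[OF insert.hyps(1,2)] by (simp only: add.commute)
  qed
  have SF: "S (F ` ?\<Omega>) x = F x" if "x \<in> ?\<Omega>" for x
  proof -
    have "S (F ` ?\<Omega>) x = (\<Sum>y\<in>F ` ?\<Omega>. if y = F x then F x else 0)"
      unfolding S_def using that by (intro sum.cong) (auto simp: indicator_def)
    then show ?thesis using that fin by simp
  qed
  have "F \<in> L2 \<mu>"
  proof (rule L2_bounded[OF assms(2)])
    show "F \<in> borel_measurable \<mu>"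
      using borel_measurable_simple_function[OF F] measurable_cong_sets[OF sets refl] by blast
    show "cmod (F x) \<le> (\<Sum>y\<in>F ` ?\<Omega>. cmod y)" if "x \<in> space \<mu>" for x
      using that fin sp by (intro member_le_sum) auto
  qed
  moreover have "simple_stochastic_integral \<phi> F = (\<lambda>x. \<Sum>y\<in>F ` ?\<Omega>. y * \<phi> (F -` {y} \<inter> ?\<Omega>) x)"
    by (rule ext) (rule simple_stochastic_integral_def)
  ultimately show ?thesis
    by (simp only:) (rule C_cong[OF S[OF fin] _ C_L2(2)[OF S[OF fin]]], use SF sp in \<open>auto intro!: AE_I2\<close>)
qed

context orthogonal_random_measure begin

text \<open>Replaces the approximating sequence in the definition of the integral by membership in a
  closed relation; uniqueness of the integral up to null sets is then
  \<open>C_unique\<close>.\<close>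

lemma stochastic_integral_in_C:
  assumes I: "has_stochastic_integral M \<phi> f I"
    and f: "f \<in> borel_measurable freq_space" and B: "\<And>x. x \<in> {0..<2 * pi} \<Longrightarrow> cmod (f x) \<le> B"
  shows "(f, I) \<in> C"
proof -
  obtain F where F: "\<And>k. simple_function freq_space (F k)"
    "mean_square_tendsto (control_measure M \<phi>) F f"
    "mean_square_tendsto M (\<lambda>k. simple_stochastic_integral \<phi> (F k)) I" and Im: "I \<in> borel_measurable M"
    using I by (auto simp: has_stochastic_integral_def)
  have FC: "(F k, simple_stochastic_integral \<phi> (F k)) \<in> C" for k
  proof (rule simple_integral_in_closed_span[OF isometric_generators_axioms finite_control sets_control _ F(1)])
    show "((\<lambda>x. indicator A x), \<phi> A) \<in> C" if "A \<in> sets freq_space" for A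
      using that by (intro closed_span.gen) (auto simp: indicator_pairs_def)
  qed
  have f2: "f \<in> L2 (control_measure M \<phi>)" by (rule bounded_in_L2[OF f B])
  have I2: "I \<in> L2 M" by (rule mean_square_limit_L2[OF C_L2(2)[OF FC] Im F(3)])
  show ?thesis
    using F(2,3) unfolding mean_square_tendsto_L2_iff[OF C_L2(1)[OF FC] f2]
      mean_square_tendsto_L2_iff[OF C_L2(2)[OF FC] I2]
    by (rule closed_span.lim[OF FC f2 I2])
qed

end

section \<open>Fejer means\<close>

text \<open>Enlarging the square of index pairs \<open>(j, k)\<close> from side \<open>N\<close> to
  \<open>N + 1\<close> adds one column and one row. Their differences \<open>j - N\<close> and
  \<open>N - k\<close> run through the interval once.\<close>

lemma sum_symmetric_Suc:
  fixes a :: "int \<Rightarrow> 'b::comm_monoid_add"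
  shows "(\<Sum>\<tau>\<in>{- int N..int N}. a \<tau>) = (\<Sum>j<N. a (int j - int N)) + (\<Sum>k<Suc N. a (int N - int k))"
proof -
  have "{- int N..int N} = (\<lambda>j. int j - int N) ` {..<N} \<union> (\<lambda>k. int N - int k) ` {..<Suc N}"
  proof (intro equalityI subsetI)
    fix x assume x: "x \<in> {- int N..int N}"
    show "x \<in> (\<lambda>j. int j - int N) ` {..<N} \<union> (\<lambda>k. int N - int k) ` {..<Suc N}"
    proof (cases "x < 0")
      case True
      then have "x = int (nat (x + int N)) - int N" "nat (x + int N) < N" using x by auto
      then show ?thesis by blast
    next
      case False
      then have "x = int N - int (nat (int N - x))" "nat (int N - x) < Suc N" using x by auto
      then show ?thesis by blast
    qed
  qed auto
  moreover have "(\<lambda>j. int j - int N) ` {..<N} \<inter> (\<lambda>k. int N - int k) ` {..<Suc N} = {}" by auto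
  ultimately have "(\<Sum>\<tau>\<in>{- int N..int N}. a \<tau>) =
      (\<Sum>\<tau>\<in>(\<lambda>j. int j - int N) ` {..<N}. a \<tau>) + (\<Sum>\<tau>\<in>(\<lambda>k. int N - int k) ` {..<Suc N}. a \<tau>)"
    by (simp add: sum.union_disjoint)
  then show ?thesis by (simp add: sum.reindex inj_on_def del: sum.lessThan_Suc)
qed

text \<open>Both sides contain a difference \<tau> with \<open>\<bar>\<tau>\<bar> < N\<close>
  exactly \<open>N - \<bar>\<tau>\<bar>\<close> times. The left side is a Cesaro sum; the right side
  can be recognised as a squared modulus or a positive quadratic form.\<close>

lemma sum_Cesaro_eq_double_sum:
  fixes a :: "int \<Rightarrow> 'b::comm_monoid_add"
  shows "(\<Sum>n<N. \<Sum>\<tau>\<in>{- int n..int n}. a \<tau>) = (\<Sum>j<N. \<Sum>k<N. a (int j - int k))"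
proof (induction N)
  case (Suc N)
  have "(\<Sum>j<Suc N. \<Sum>k<Suc N. a (int j - int k)) =
      (\<Sum>j<N. (\<Sum>k<N. a (int j - int k)) + a (int j - int N)) + (\<Sum>k<Suc N. a (int N - int k))"
    by simp
  also have "\<dots> = (\<Sum>n<Suc N. \<Sum>\<tau>\<in>{- int n..int n}. a \<tau>)"
    unfolding sum.lessThan_Suc[of _ N] sum_symmetric_Suc[of a N] Suc.IH sum.distrib
    by (simp add: add.assoc)
  finally show ?case by simp
qed simp

lemma Cesaro_mean_tendsto:
  fixes s :: "nat \<Rightarrow> complex"
  assumes "s \<longlonglongrightarrow> L"
  shows "(\<lambda>N. (\<Sum>n<N. s n) / of_nat N) \<longlonglongrightarrow> L"
proof (rule LIMSEQ_I)
  fix e :: real assume e: "e > 0"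
  obtain n0 where n0: "\<And>n. n \<ge> n0 \<Longrightarrow> cmod (s n - L) < e / 2"
    using LIMSEQ_D[OF assms, of "e / 2"] e by auto
  define K where "K = (\<Sum>n<n0. cmod (s n - L))"
  have K: "K \<ge> 0" by (simp add: K_def sum_nonneg)
  \<comment> \<open>Beyond \<open>2 * K / e\<close> the fixed head of the sum contributes less than
    \<open>e / 2\<close> to the mean.\<close>
  obtain N0 where N0: "N0 > 0" "real N0 > 2 * K / e"
    by (metis less_trans neq0_conv of_nat_0_less_iff reals_Archimedean2 zero_less_Suc of_nat_less_iff lessI not_gr_zero)
  have "cmod ((\<Sum>n<N. s n) / of_nat N - L) < e" if "N \<ge> max N0 n0" for N
  proof -
    have N: "N > 0" using that N0 by linarith
    then have "(\<Sum>n<N. s n) / of_nat N - L = (\<Sum>n<N. s n - L) / of_nat N"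
      by (simp add: sum_subtractf field_simps)
    also have "cmod \<dots> \<le> (\<Sum>n<N. cmod (s n - L)) / N"
      by (simp add: norm_divide divide_right_mono norm_sum)
    also have "(\<Sum>n<N. cmod (s n - L)) = K + (\<Sum>n\<in>{n0..<N}. cmod (s n - L))"
      unfolding K_def using that by (subst sum.union_disjoint[symmetric]) (auto intro!: sum.cong)
    also have "(\<Sum>n\<in>{n0..<N}. cmod (s n - L)) \<le> (\<Sum>n\<in>{n0..<N}. e / 2)"
      by (intro sum_mono less_imp_le[OF n0]) auto
    also have "\<dots> \<le> real N * (e / 2)" using e by (simp add: mult_right_mono)
    finally have "cmod ((\<Sum>n<N. s n) / of_nat N - L) \<le> (K + real N * (e / 2)) / N"
      using N by (simp add: divide_right_mono)
    also have "\<dots> = K / N + e / 2" using N by (simp add: field_simps)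
    also have "K / N < e / 2"
    proof -
      have "2 * K / e < real N" using N0 that by linarith
      then show ?thesis using e N by (simp add: field_simps)
    qed
    finally show ?thesis by simp
  qed
  then show "\<exists>no. \<forall>n\<ge>no. norm ((\<Sum>n<n. s n) / of_nat n - L) < e" by blast
qed

section \<open>Fourier coefficients and the Fejer kernel\<close>

lemma integrable_fexp [simp]: "integrable freq_lebesgue (fexp n)"
proof -
  interpret finite_measure freq_lebesgue by (rule finite_measure_freq_lebesgue)
  show ?thesis by (rule integrable_const_bound[where B = 1]) auto
qed

lemma integral_fexp: "(\<integral>x. fexp n x \<partial>freq_lebesgue) = (if n = 0 then 2 * of_real pi else 0)"
proof -
  have "(\<integral>x. fexp n x \<partial>freq_lebesgue) = (\<integral>x. indicator {0..<2 * pi} x *\<^sub>R fexp n x \<partial>lborel)"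
    unfolding freq_lebesgue_def by (subst integral_restrict_space) auto
  also have "\<dots> = (LINT x:{0..2 * pi}|lborel. fexp n x)"
    unfolding set_lebesgue_integral_def
  proof (rule integral_cong_AE)
    show "AE x in lborel. indicator {0..<2 * pi} x *\<^sub>R fexp n x = indicator {0..2 * pi} x *\<^sub>R fexp n x"
      by (rule eventually_mono[OF AE_lborel_singleton[of "2 * pi"]]) (auto simp: indicator_def)
  qed auto
  also have "\<dots> = integral {0..2 * pi} (fexp n)"
    by (rule set_borel_integral_eq_integral(2)[OF borel_integrable_atLeastAtMost'[OF continuous_fexp]])
  also have "\<dots> = (if n = 0 then 2 * of_real pi else 0)"
  proof (cases "n = 0")
    case True
    then show ?thesis by (simp add: scaleR_conv_of_real)
  next
    case False
    have "((\<lambda>x. fexp n x / (\<i> * of_int n)) has_vector_derivative fexp n x) (at x within {0..2 * pi})" for x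
    proof -
      have "fexp n = (\<lambda>x. exp (x *\<^sub>R (\<i> * of_int n)))"
        by (simp add: fexp_def fun_eq_iff scaleR_conv_of_real mult.left_commute)
      then have "(fexp n has_vector_derivative fexp n x * (\<i> * of_int n)) (at x within {0..2 * pi})"
        by (simp only: exp_scaleR_has_vector_derivative_right)
      from has_vector_derivative_divide[OF this, of "\<i> * of_int n"] show ?thesis using False by simp
    qed
    then have "(fexp n has_integral fexp n (2 * pi) / (\<i> * of_int n) - fexp n 0 / (\<i> * of_int n)) {0..2 * pi}"
      by (intro fundamental_theorem_of_calculus) auto
    moreover have "fexp n (2 * pi) = fexp n 0"
    proof -
      have "fexp n (2 * pi) = cis (2 * pi * of_int n)" by (simp add: fexp_def cis_conv_exp)
      then show ?thesis by (simp add: cis_multiple_2pi fexp_def)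
    qed
    ultimately show ?thesis using False by (simp add: integral_unique)
  qed
  finally show ?thesis .
qed

text \<open>The sign is that of a characteristic function, so that coefficients of a spectral
  density are covariances. Accordingly the synthesis in \<open>fourier_sum\<close> carries the
  opposite sign and the factor \<open>1 / (2 * pi)\<close>.\<close>

definition fourier_coeff :: "(real \<Rightarrow> complex) \<Rightarrow> int \<Rightarrow> complex" where
  "fourier_coeff g \<tau> = (\<integral>x. fexp \<tau> x * g x \<partial>freq_lebesgue)"

definition fourier_sum :: "(real \<Rightarrow> complex) \<Rightarrow> nat \<Rightarrow> real \<Rightarrow> complex" where
  "fourier_sum g n x = (\<Sum>\<tau>\<in>{- int n..int n}. fexp (- \<tau>) x * fourier_coeff g \<tau>) / (2 * of_real pi)"

definition fejer_mean :: "(real \<Rightarrow> complex) \<Rightarrow> nat \<Rightarrow> real \<Rightarrow> complex" where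
  "fejer_mean g N x = (\<Sum>n<N. fourier_sum g n x) / of_nat N"

text \<open>The quotient of squared sines is avoided: a squared Dirichlet-type sum has no
  singularity at 0 and is visibly nonnegative.\<close>

definition fejer_kernel :: "nat \<Rightarrow> real \<Rightarrow> real" where
  "fejer_kernel N t = (cmod (\<Sum>j<N. fexp (int j) t))\<^sup>2 / (2 * pi * N)"

lemma fejer_kernel_nonneg [simp]: "fejer_kernel N t \<ge> 0"
  by (simp add: fejer_kernel_def)

lemma fejer_kernel_eq:
  "of_real (fejer_kernel N t) = (\<Sum>n<N. \<Sum>\<tau>\<in>{- int n..int n}. fexp \<tau> t) / (2 * of_real pi * of_nat N)"
proof -
  have "complex_of_real ((cmod (\<Sum>j<N. fexp (int j) t))\<^sup>2) = (\<Sum>j<N. \<Sum>k<N. fexp (int j - int k) t)"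
    unfolding complex_norm_square cnj_sum sum_product
    by (simp add: cnj_fexp fexp_mult)
  then show ?thesis
    unfolding sum_Cesaro_eq_double_sum fejer_kernel_def by simp
qed

lemma fejer_kernel_measurable [measurable]: "fejer_kernel N \<in> borel_measurable borel"
  unfolding fejer_kernel_def[abs_def] by measurable

lemma fexp_diff: "fexp \<tau> (y - x) = fexp (- \<tau>) x * fexp \<tau> y"
  by (simp add: fexp_def algebra_simps flip: exp_add)

lemma fexp_mult_integrable [simp]:
  "integrable freq_lebesgue g \<Longrightarrow> integrable freq_lebesgue (\<lambda>x. fexp \<tau> x * g x)"
  by (rule bounded_mult_integrable[where B = 1]) auto

lemma integral_mult_sum_fexp:
  assumes g: "integrable freq_lebesgue g"
  shows "integrable freq_lebesgue (\<lambda>y. (\<Sum>\<tau>\<in>T. c \<tau> * fexp \<tau> y) * g y)"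
    "(\<integral>y. (\<Sum>\<tau>\<in>T. c \<tau> * fexp \<tau> y) * g y \<partial>freq_lebesgue) = (\<Sum>\<tau>\<in>T. c \<tau> * fourier_coeff g \<tau>)"
  using g by (auto simp: sum_distrib_right mult.assoc fourier_coeff_def)

lemma fejer_mean_kernel:
  assumes g: "integrable freq_lebesgue g"
  shows "integrable freq_lebesgue (\<lambda>y. of_real (fejer_kernel N (y - x)) * g y)"
    and "fejer_mean g N x = (\<integral>y. of_real (fejer_kernel N (y - x)) * g y \<partial>freq_lebesgue)"
proof -
  have eq: "of_real (fejer_kernel N (y - x)) * g y =
      (\<Sum>n<N. (\<Sum>\<tau>\<in>{- int n..int n}. fexp (- \<tau>) x * fexp \<tau> y) * g y) / (2 * of_real pi * of_nat N)" for y
    unfolding fejer_kernel_eq fexp_diff by (simp add: sum_distrib_right)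
  show "integrable freq_lebesgue (\<lambda>y. of_real (fejer_kernel N (y - x)) * g y)"
    unfolding eq using integral_mult_sum_fexp(1)[OF g] by simp
  show "fejer_mean g N x = (\<integral>y. of_real (fejer_kernel N (y - x)) * g y \<partial>freq_lebesgue)"
    unfolding eq fejer_mean_def fourier_sum_def using integral_mult_sum_fexp[OF g]
    by (simp add: sum_divide_distrib[symmetric])
qed

text \<open>Only \<tau> = 0 survives, once for each of the \<open>N\<close> symmetric sums. The
  integral is over the shift \<open>x\<close>, the variable that comes first after Fubini's
  theorem.\<close>

lemma integral_fejer_kernel:
  assumes "N > 0"
  shows "(\<integral>\<^sup>+x. ennreal (fejer_kernel N (y - x)) \<partial>freq_lebesgue) = 1"
proof -
  have eq: "complex_of_real (fejer_kernel N (y - x)) =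
      (\<Sum>n<N. \<Sum>\<tau>\<in>{- int n..int n}. fexp \<tau> y * fexp (- \<tau>) x) / (2 * of_real pi * of_nat N)" for x
    unfolding fejer_kernel_eq fexp_diff by (simp add: mult.commute)
  have "integrable freq_lebesgue (\<lambda>x. complex_of_real (fejer_kernel N (y - x)))"
    unfolding eq by simp
  then have int: "integrable freq_lebesgue (\<lambda>x. fejer_kernel N (y - x))"
    by (simp add: complex_of_real_integrable_eq)
  have "complex_of_real (\<integral>x. fejer_kernel N (y - x) \<partial>freq_lebesgue) =
      (\<integral>x. complex_of_real (fejer_kernel N (y - x)) \<partial>freq_lebesgue)"
    by simp
  also have "\<dots> = (\<Sum>n<N. \<Sum>\<tau>\<in>{- int n..int n}. fexp \<tau> y * (if \<tau> = 0 then 2 * of_real pi else 0)) / (2 * of_real pi * of_nat N)"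
    unfolding eq by (simp add: integral_fexp)
  also have "\<dots> = (\<Sum>n<N. 2 * of_real pi) / (2 * of_real pi * of_nat N)"
  proof -
    have "(\<Sum>\<tau>\<in>{- int n..int n}. fexp \<tau> y * (if \<tau> = 0 then 2 * complex_of_real pi else 0)) = 2 * of_real pi" for n
    proof -
      have "(\<Sum>\<tau>\<in>{- int n..int n}. fexp \<tau> y * (if \<tau> = 0 then 2 * complex_of_real pi else 0)) =
         (\<Sum>\<tau>\<in>{- int n..int n}. if \<tau> = 0 then 2 * complex_of_real pi else 0)"
        by (intro sum.cong) auto
      then show ?thesis by simp
    qed
    then show ?thesis by simp
  qed
  also have "\<dots> = of_real 1" using assms by simp
  finally have "(\<integral>x. fejer_kernel N (y - x) \<partial>freq_lebesgue) = 1" by (simp only: of_real_eq_iff)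
  then show ?thesis using int by (simp add: nn_integral_eq_integral)
qed

text \<open>Young's inequality for a nonnegative kernel of mass 1. The constant does not depend on
  \<open>N\<close>, which is what makes an approximation argument possible.\<close>

lemma fejer_mean_contraction:
  assumes g: "integrable freq_lebesgue g"
  shows "integrable freq_lebesgue (fejer_mean g N)"
    and "(\<integral>x. cmod (fejer_mean g N x) \<partial>freq_lebesgue) \<le> (\<integral>x. cmod (g x) \<partial>freq_lebesgue)"
proof -
  show int: "integrable freq_lebesgue (fejer_mean g N)"
    unfolding fejer_mean_def[abs_def] fourier_sum_def by simp
  show "(\<integral>x. cmod (fejer_mean g N x) \<partial>freq_lebesgue) \<le> (\<integral>x. cmod (g x) \<partial>freq_lebesgue)"
  \<comment> \<open>For \<open>N = 0\<close> the mean is 0 because division by zero gives 0, and the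
    kernel does not have mass 1.\<close>
  proof (cases "N = 0")
    case True
    then show ?thesis by (simp add: fejer_mean_def)
  next
    case False
    interpret finite_measure freq_lebesgue by (rule finite_measure_freq_lebesgue)
    interpret pair_sigma_finite freq_lebesgue freq_lebesgue
      by (intro pair_sigma_finite.intro) (rule sigma_finite_measure_axioms)+
    have [measurable]: "g \<in> borel_measurable freq_lebesgue" using g by simp
    have [measurable]: "(\<lambda>x. x) \<in> freq_lebesgue \<rightarrow>\<^sub>M borel"
      unfolding freq_lebesgue_def by (intro measurable_restrict_space1) simp
    have "ennreal (\<integral>x. cmod (fejer_mean g N x) \<partial>freq_lebesgue) = (\<integral>\<^sup>+x. ennreal (cmod (fejer_mean g N x)) \<partial>freq_lebesgue)"
      using int by (simp add: nn_integral_eq_integral)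
    also have "\<dots> \<le> (\<integral>\<^sup>+x. (\<integral>\<^sup>+y. ennreal (fejer_kernel N (y - x)) * ennreal (cmod (g y)) \<partial>freq_lebesgue) \<partial>freq_lebesgue)"
    proof (rule nn_integral_mono)
      fix x
      have i: "integrable freq_lebesgue (\<lambda>y. fejer_kernel N (y - x) * cmod (g y))"
        using integrable_norm[OF fejer_mean_kernel(1)[OF g]] by (simp add: norm_mult)
      have "cmod (fejer_mean g N x) \<le> (\<integral>y. fejer_kernel N (y - x) * cmod (g y) \<partial>freq_lebesgue)"
        unfolding fejer_mean_kernel(2)[OF g]
        using integral_norm_bound[of freq_lebesgue "\<lambda>y. of_real (fejer_kernel N (y - x)) * g y"] by (simp add: norm_mult)
      also have "ennreal \<dots> = (\<integral>\<^sup>+y. ennreal (fejer_kernel N (y - x)) * ennreal (cmod (g y)) \<partial>freq_lebesgue)"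
        using i by (simp add: nn_integral_eq_integral flip: ennreal_mult)
      finally show "ennreal (cmod (fejer_mean g N x)) \<le> \<dots>"
        by (simp add: ennreal_leI)
    qed
    also have "\<dots> = (\<integral>\<^sup>+y. (\<integral>\<^sup>+x. ennreal (fejer_kernel N (y - x)) * ennreal (cmod (g y)) \<partial>freq_lebesgue) \<partial>freq_lebesgue)"
      by (rule Fubini') measurable
    also have "\<dots> = (\<integral>\<^sup>+y. ennreal (cmod (g y)) \<partial>freq_lebesgue)"
      using False by (simp add: nn_integral_multc integral_fejer_kernel)
    also have "\<dots> = ennreal (\<integral>x. cmod (g x) \<partial>freq_lebesgue)"
      using g by (simp add: nn_integral_eq_integral)
    finally show ?thesis by (subst (asm) ennreal_le_iff) auto
  qed
qed

lemma fejer_mean_add: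
  assumes f: "integrable freq_lebesgue f" and g: "integrable freq_lebesgue g"
  shows "fejer_mean (\<lambda>x. f x + c * g x) N x = fejer_mean f N x + c * fejer_mean g N x"
proof -
  have "fourier_coeff (\<lambda>x. f x + c * g x) \<tau> = fourier_coeff f \<tau> + c * fourier_coeff g \<tau>" for \<tau>
  proof -
    have "(\<lambda>x. fexp \<tau> x * (f x + c * g x)) = (\<lambda>x. fexp \<tau> x * f x + c * (fexp \<tau> x * g x))"
      by (simp add: algebra_simps)
    then show ?thesis unfolding fourier_coeff_def using f g by simp
  qed
  then show ?thesis
    by (simp add: fejer_mean_def fourier_sum_def sum.distrib sum_distrib_left algebra_simps add_divide_distrib sum_divide_distrib)
qed

section \<open>Convergence of the Fejer means in L1\<close>

definition fejer_convergent :: "(real \<Rightarrow> complex) \<Rightarrow> bool" where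
  "fejer_convergent g \<longleftrightarrow> integrable freq_lebesgue g \<and>
    (\<lambda>N. \<integral>x. cmod (fejer_mean g N x - g x) \<partial>freq_lebesgue) \<longlonglongrightarrow> 0"

lemma fejer_convergent_limit:
  assumes p: "\<And>k. fejer_convergent (p k)" and g: "integrable freq_lebesgue g"
    and lim: "(\<lambda>k. \<integral>x. cmod (p k x - g x) \<partial>freq_lebesgue) \<longlonglongrightarrow> 0"
  shows "fejer_convergent g"
  unfolding fejer_convergent_def
proof (intro conjI g LIMSEQ_I)
  fix e :: real assume e: "e > 0"
  obtain k where k: "(\<integral>x. cmod (p k x - g x) \<partial>freq_lebesgue) < e / 3"
    using LIMSEQ_D[OF lim, of "e / 3"] e by auto
  have pk: "integrable freq_lebesgue (p k)"
    "(\<lambda>N. \<integral>x. cmod (fejer_mean (p k) N x - p k x) \<partial>freq_lebesgue) \<longlonglongrightarrow> 0"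
    using p[of k] by (auto simp: fejer_convergent_def)
  obtain N0 where N0: "\<And>N. N \<ge> N0 \<Longrightarrow> (\<integral>x. cmod (fejer_mean (p k) N x - p k x) \<partial>freq_lebesgue) < e / 3"
    using LIMSEQ_D[OF pk(2), of "e / 3"] e by auto
  have "(\<integral>x. cmod (fejer_mean g N x - g x) \<partial>freq_lebesgue) < e" if "N \<ge> N0" for N
  proof -
    \<comment> \<open>Linearity turns the change from \<open>p k\<close> to \<open>g\<close> into
      the mean of \<open>d\<close>, and the contraction bounds it uniformly in \<open>N\<close>;
      hence three terms, each below \<open>e / 3\<close>.\<close>
    define d where "d x = g x - p k x" for x
    have d: "integrable freq_lebesgue d" unfolding d_def[abs_def] using g pk by simp
    have md: "fejer_mean d N x = fejer_mean g N x - fejer_mean (p k) N x" for x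
      unfolding d_def using fejer_mean_add[OF g pk(1), of "-1" N x] by simp
    note [simp] = fejer_mean_contraction(1)[OF g] fejer_mean_contraction(1)[OF d]
      fejer_mean_contraction(1)[OF pk(1)] g pk(1) d
    have "(\<integral>x. cmod (fejer_mean g N x - g x) \<partial>freq_lebesgue) \<le>
        (\<integral>x. cmod (fejer_mean d N x) + cmod (fejer_mean (p k) N x - p k x) + cmod (p k x - g x) \<partial>freq_lebesgue)"
    proof (rule integral_mono)
      fix x
      have "fejer_mean g N x - g x = fejer_mean d N x + (fejer_mean (p k) N x - p k x) + (p k x - g x)"
        by (simp add: md)
      then show "cmod (fejer_mean g N x - g x) \<le> cmod (fejer_mean d N x) + cmod (fejer_mean (p k) N x - p k x) + cmod (p k x - g x)"
        by (metis norm_triangle_ineq norm_triangle_le add_right_mono order_trans)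
    qed auto
    also have "\<dots> = (\<integral>x. cmod (fejer_mean d N x) \<partial>freq_lebesgue) +
        (\<integral>x. cmod (fejer_mean (p k) N x - p k x) \<partial>freq_lebesgue) + (\<integral>x. cmod (p k x - g x) \<partial>freq_lebesgue)"
      by simp
    also have "(\<integral>x. cmod (fejer_mean d N x) \<partial>freq_lebesgue) \<le> (\<integral>x. cmod (d x) \<partial>freq_lebesgue)"
      by (rule fejer_mean_contraction(2)[OF d])
    also have "(\<integral>x. cmod (d x) \<partial>freq_lebesgue) = (\<integral>x. cmod (p k x - g x) \<partial>freq_lebesgue)"
      unfolding d_def by (simp add: norm_minus_commute)
    finally show ?thesis using k N0[OF that] by linarith
  qed
  then show "\<exists>no. \<forall>N\<ge>no. norm ((\<integral>x. cmod (fejer_mean g N x - g x) \<partial>freq_lebesgue) - 0) < e"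
    by auto
qed

text \<open>The only non-zero coefficient sits at \<open>- m\<close>, so the partial sums equal
  \<open>fexp m\<close> from \<open>\<bar>m\<bar>\<close> on and the mean is a scalar multiple
  \<open>r N\<close> of \<open>fexp m\<close> with \<open>r N\<close> tending to 1.\<close>

lemma fejer_convergent_fexp: "fejer_convergent (fexp m)"
proof -
  have c: "fourier_coeff (fexp m) \<tau> = (if \<tau> = - m then 2 * of_real pi else 0)" for \<tau>
    unfolding fourier_coeff_def fexp_mult integral_fexp by auto
  have s: "fourier_sum (fexp m) n x = (if \<bar>m\<bar> \<le> int n then 1 else 0) * fexp m x" for n x
  proof -
    have "(\<Sum>\<tau>\<in>{- int n..int n}. fexp (- \<tau>) x * fourier_coeff (fexp m) \<tau>) =
       (\<Sum>\<tau>\<in>{- int n..int n}. if \<tau> = - m then fexp m x * (2 * of_real pi) else 0)"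
      unfolding c by (intro sum.cong) auto
    then show ?thesis by (auto simp: fourier_sum_def)
  qed
  define r :: "nat \<Rightarrow> complex" where "r N = (\<Sum>n<N. if \<bar>m\<bar> \<le> int n then 1 else 0) / of_nat N" for N
  have "\<forall>\<^sub>F n in sequentially. (if \<bar>m\<bar> \<le> int n then 1 else 0 :: complex) = 1"
    using eventually_ge_at_top[of "nat \<bar>m\<bar>"] by eventually_elim auto
  then have r: "r \<longlonglongrightarrow> 1"
    unfolding r_def by (intro Cesaro_mean_tendsto tendsto_eventually)
  have "fejer_mean (fexp m) N x = r N * fexp m x" for N x
    by (simp add: fejer_mean_def s r_def sum_distrib_right)
  then have "cmod (fejer_mean (fexp m) N x - fexp m x) = cmod (r N - 1)" for N x
    by (metis mult.left_neutral norm_fexp norm_mult left_diff_distrib mult.right_neutral)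
  moreover have "(\<lambda>N. cmod (r N - 1) * (2 * pi)) \<longlonglongrightarrow> cmod (1 - 1) * (2 * pi)"
    by (intro tendsto_intros r)
  moreover have "measure freq_lebesgue {0..<2 * pi} = 2 * pi"
    unfolding freq_lebesgue_def by (subst measure_restrict_space) auto
  ultimately show ?thesis by (simp add: fejer_convergent_def mult.commute)
qed

lemma fejer_convergent_closed: "bounded_limit_closed {g \<in> borel_measurable freq_space. fejer_convergent g}"
proof
  fix f g c assume fg: "f \<in> {g \<in> borel_measurable freq_space. fejer_convergent g}"
    "g \<in> {g \<in> borel_measurable freq_space. fejer_convergent g}"
  then have f: "integrable freq_lebesgue f" and g: "integrable freq_lebesgue g"
    and fl: "(\<lambda>N. \<integral>x. cmod (fejer_mean f N x - f x) \<partial>freq_lebesgue) \<longlonglongrightarrow> 0"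
    and gl: "(\<lambda>N. \<integral>x. cmod (fejer_mean g N x - g x) \<partial>freq_lebesgue) \<longlonglongrightarrow> 0"
    by (auto simp: fejer_convergent_def)
  note [simp] = fejer_mean_contraction(1)[OF g] fejer_mean_contraction(1)[OF f] f g
  have "fejer_convergent (\<lambda>x. f x + c * g x)"
    unfolding fejer_convergent_def
  proof
    show int: "integrable freq_lebesgue (\<lambda>x. f x + c * g x)" by simp
    show "(\<lambda>N. \<integral>x. cmod (fejer_mean (\<lambda>x. f x + c * g x) N x - (f x + c * g x)) \<partial>freq_lebesgue) \<longlonglongrightarrow> 0"
    proof (rule Lim_null_comparison[OF always_eventually], intro allI)
      fix N
      have "(\<integral>x. cmod (fejer_mean (\<lambda>x. f x + c * g x) N x - (f x + c * g x)) \<partial>freq_lebesgue) \<le>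
        (\<integral>x. cmod (fejer_mean f N x - f x) + cmod c * cmod (fejer_mean g N x - g x) \<partial>freq_lebesgue)"
      proof (rule integral_mono)
        fix x
        have "fejer_mean (\<lambda>x. f x + c * g x) N x - (f x + c * g x) =
          (fejer_mean f N x - f x) + c * (fejer_mean g N x - g x)"
          by (simp add: fejer_mean_add algebra_simps)
        then show "cmod (fejer_mean (\<lambda>x. f x + c * g x) N x - (f x + c * g x)) \<le>
            cmod (fejer_mean f N x - f x) + cmod c * cmod (fejer_mean g N x - g x)"
          by (metis norm_triangle_ineq norm_mult)
      qed (use fejer_mean_contraction(1)[OF int] in auto)
      then show "norm (\<integral>x. cmod (fejer_mean (\<lambda>x. f x + c * g x) N x - (f x + c * g x)) \<partial>freq_lebesgue) \<le>
          (\<integral>x. cmod (fejer_mean f N x - f x) \<partial>freq_lebesgue) + cmod c * (\<integral>x. cmod (fejer_mean g N x - g x) \<partial>freq_lebesgue)"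
        by simp
    next
      show "(\<lambda>N. (\<integral>x. cmod (fejer_mean f N x - f x) \<partial>freq_lebesgue) + cmod c * (\<integral>x. cmod (fejer_mean g N x - g x) \<partial>freq_lebesgue)) \<longlonglongrightarrow> 0"
        using tendsto_add[OF fl tendsto_mult[OF tendsto_const gl]] by simp
    qed
  qed
  with fg show "(\<lambda>x. f x + c * g x) \<in> {g \<in> borel_measurable freq_space. fejer_convergent g}" by auto
next
  fix p B f assume "\<And>k. p k \<in> {g \<in> borel_measurable freq_space. fejer_convergent g}"
    and B: "\<And>k x. x \<in> {0..<2 * pi} \<Longrightarrow> cmod (p k x) \<le> B"
    and lim: "\<And>x. x \<in> {0..<2 * pi} \<Longrightarrow> (\<lambda>k. p k x) \<longlonglongrightarrow> f x"
  then have pm: "\<And>k. p k \<in> borel_measurable freq_space" and pc: "\<And>k. fejer_convergent (p k)" by auto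
  have fm: "f \<in> borel_measurable freq_space" by (rule bounded_limit_measurable[OF pm lim])
  have fB: "cmod (f x) \<le> B" if "x \<in> {0..<2 * pi}" for x
    by (rule LIMSEQ_le_const2[OF tendsto_norm[OF lim[OF that]]]) (use B that in auto)
  interpret finite_measure freq_lebesgue by (rule finite_measure_freq_lebesgue)
  have fi: "integrable freq_lebesgue f"
    by (rule integrable_const_bound[where B = B]) (use fm fB in auto)
  have "(\<lambda>k. \<integral>x. cmod (p k x - f x) \<partial>freq_lebesgue) \<longlonglongrightarrow> (\<integral>x. 0 \<partial>freq_lebesgue)"
  proof (rule integral_dominated_convergence[where w = "\<lambda>_. 2 * B"])
    show "AE x in freq_lebesgue. norm (cmod (p k x - f x)) \<le> 2 * B" for k
    proof (rule AE_I2)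
      fix x assume "x \<in> space freq_lebesgue"
      then show "norm (cmod (p k x - f x)) \<le> 2 * B"
        using norm_triangle_ineq4[of "p k x" "f x"] B[of x k] fB[of x] by simp
    qed
    show "AE x in freq_lebesgue. (\<lambda>k. cmod (p k x - f x)) \<longlonglongrightarrow> 0"
      by (rule AE_I2) (use lim in \<open>auto intro!: tendsto_norm_zero simp: LIM_zero_iff\<close>)
  qed (use pm fm in auto)
  then have "fejer_convergent f"
    by (intro fejer_convergent_limit[OF pc fi]) simp
  with fm show "f \<in> {g \<in> borel_measurable freq_space. fejer_convergent g}" by simp
qed

text \<open>Bounded functions are reached from the exponentials by the class argument, and a general
  \<open>g\<close> is the L1 limit of its truncations, which are set to 0 where the modulus exceeds
  \<open>k\<close>.\<close>

theorem fejer_L1: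
  assumes g: "integrable freq_lebesgue g"
  shows "fejer_convergent g"
proof -
  interpret bounded_limit_closed "{g \<in> borel_measurable freq_space. fejer_convergent g}"
    by (rule fejer_convergent_closed)
  have [measurable]: "g \<in> borel_measurable freq_lebesgue" using g by simp
  then have gm: "g \<in> borel_measurable freq_space" using measurable_cong_sets[OF sets_freq_lebesgue refl] by blast
  define p where "p k x = (if cmod (g x) \<le> real k then g x else 0)" for k x
  have pm: "p k \<in> borel_measurable freq_space" for k
    unfolding p_def using gm by measurable
  have pc: "fejer_convergent (p k)" for k
  proof -
    have "p k \<in> {g \<in> borel_measurable freq_space. fejer_convergent g}"
      by (rule fexp_bounded_measurable_in_D[where B = "real k"])
        (auto simp: fejer_convergent_fexp pm, auto simp: p_def)
    then show ?thesis by simp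
  qed
  show ?thesis
  proof (rule fejer_convergent_limit[OF pc g])
    have "(\<lambda>k. \<integral>x. cmod (p k x - g x) \<partial>freq_lebesgue) \<longlonglongrightarrow> (\<integral>x. 0 \<partial>freq_lebesgue)"
    proof (rule integral_dominated_convergence[where w = "\<lambda>x. cmod (g x)"])
      show "AE x in freq_lebesgue. (\<lambda>k. cmod (p k x - g x)) \<longlonglongrightarrow> 0"
      proof (rule AE_I2)
        fix x
        have "\<forall>\<^sub>F k in sequentially. cmod (p k x - g x) = 0"
          using eventually_ge_at_top[of "nat \<lceil>cmod (g x)\<rceil>"]
          by eventually_elim (auto simp: p_def)
        then show "(\<lambda>k. cmod (p k x - g x)) \<longlonglongrightarrow> 0" by (rule tendsto_eventually)
      qed
      show "AE x in freq_lebesgue. norm (cmod (p k x - g x)) \<le> cmod (g x)" for k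
        by (rule AE_I2) (simp add: p_def)
    qed (use pm g in auto)
    then show "(\<lambda>k. \<integral>x. cmod (p k x - g x) \<partial>freq_lebesgue) \<longlonglongrightarrow> 0" by simp
  qed
qed

text \<open>A convergent sequence has the same limit as its Cesaro means, and a subsequence of these
  tends to \<open>g\<close> almost everywhere. The null set comes from that subsequence alone, so
  the quantifier over \<open>L\<close> may stand inside.\<close>

lemma fourier_series_AE_limit:
  assumes g: "integrable freq_lebesgue g"
  shows "AE x in freq_lebesgue. \<forall>L. (\<lambda>n. fourier_sum g n x) \<longlonglongrightarrow> L \<longrightarrow> g x = L"
proof -
  have "(\<lambda>N. \<integral>x. norm (fejer_mean g N x - g x) \<partial>freq_lebesgue) \<longlonglongrightarrow> 0"
    using fejer_L1[OF g] by (simp add: fejer_convergent_def)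
  then obtain r where r: "strict_mono r" "AE x in freq_lebesgue. (\<lambda>n. fejer_mean g (r n) x - g x) \<longlonglongrightarrow> 0"
    using tendsto_L1_AE_subseq[of freq_lebesgue "\<lambda>N x. fejer_mean g N x - g x"] g fejer_mean_contraction(1)[OF g]
    by auto
  show ?thesis
    using r(2)
  proof eventually_elim
    case (elim x)
    show ?case
    proof (intro allI impI)
      fix L assume "(\<lambda>n. fourier_sum g n x) \<longlonglongrightarrow> L"
      then have "(\<lambda>N. fejer_mean g N x) \<longlonglongrightarrow> L"
        unfolding fejer_mean_def by (rule Cesaro_mean_tendsto)
      from LIMSEQ_subseq_LIMSEQ[OF this r(1)] have "(\<lambda>n. fejer_mean g (r n) x) \<longlonglongrightarrow> L"
        by (simp add: o_def)
      moreover have "(\<lambda>n. fejer_mean g (r n) x) \<longlonglongrightarrow> g x"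
        using elim by (simp add: LIM_zero_iff)
      ultimately show "g x = L" by (rule LIMSEQ_unique[rotated])
    qed
  qed
qed

section \<open>Existence of the spectral measures\<close>

text \<open>The Cesaro means of the formal Fourier series of \<open>R\<close> are nonnegative densities. A weak limit point
  of the normalised densities has the right characteristic function at the integers. Folding the line
  by \<open>Arg2pi \<circ> cis\<close> makes it unnecessary to locate the support of the limit, whose mass may have moved
  to the endpoint \<open>2\<pi>\<close>.\<close>

theorem Herglotz:
  fixes R :: "int \<Rightarrow> complex"
  assumes pos: "\<And>N x. \<exists>r\<ge>0. (\<Sum>j<N. \<Sum>k<N. R (int j - int k) * fexp (int k - int j) x) = of_real r"
  obtains \<mu> where "finite_measure \<mu>" "sets \<mu> = sets freq_space" "\<And>n. (\<integral>x. fexp n x \<partial>\<mu>) = R n"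
proof -
  obtain R0 where "R0 \<ge> 0" "(\<Sum>j<Suc 0. \<Sum>k<Suc 0. R (int j - int k) * fexp (int k - int j) 0) = of_real R0"
    using pos by blast
  then have R0: "R0 \<ge> 0" "R 0 = of_real R0" by simp_all
  define S where "S N x = (\<Sum>j<N. \<Sum>k<N. R (int j - int k) * fexp (int k - int j) x)" for N x
  define w where "w N x = Re (S N x) / (2 * pi * N)" for N x
  have S_eq: "S N x = (\<Sum>n<N. \<Sum>\<tau>\<in>{- int n..int n}. R \<tau> * fexp (- \<tau>) x)" for N x
    unfolding S_def using sum_Cesaro_eq_double_sum[of "\<lambda>\<tau>. R \<tau> * fexp (- \<tau>) x" N] by simp
  have w_nonneg: "w N x \<ge> 0" for N x
  proof -
    obtain r where "r \<ge> 0" "S N x = of_real r" unfolding S_def using pos by blast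
    then show ?thesis by (simp add: w_def)
  qed
  have w_eq: "complex_of_real (w N x) = S N x / (2 * of_real pi * of_nat N)" for N x
  proof -
    obtain r where "r \<ge> 0" "S N x = of_real r" unfolding S_def using pos by blast
    then show ?thesis by (simp add: w_def)
  qed
  \<comment> \<open>For \<open>N > 0\<close> this is the triangular weight
    \<open>max 0 (1 - \<bar>m\<bar> / N)\<close> that Cesaro summation puts on frequency
    \<open>m\<close>.\<close>
  define \<kappa> :: "int \<Rightarrow> nat \<Rightarrow> complex" where "\<kappa> m N = (\<Sum>n<N. if \<bar>m\<bar> \<le> int n then 1 else 0) / of_nat N" for m N
  have \<kappa>_lim: "\<kappa> m \<longlonglongrightarrow> 1" for m
  proof -
    have "\<forall>\<^sub>F n in sequentially. (if \<bar>m\<bar> \<le> int n then 1 else 0 :: complex) = 1"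
      using eventually_ge_at_top[of "nat \<bar>m\<bar>"] by eventually_elim auto
    then show ?thesis unfolding \<kappa>_def by (intro Cesaro_mean_tendsto tendsto_eventually)
  qed
  have \<kappa>_0: "\<kappa> 0 N = 1" if "N > 0" for N using that by (simp add: \<kappa>_def)
  have coeff: "integrable freq_lebesgue (\<lambda>x. fexp m x * of_real (w N x))"
    "(\<integral>x. fexp m x * of_real (w N x) \<partial>freq_lebesgue) = R m * \<kappa> m N" for m N
  proof -
    have eq: "fexp m x * of_real (w N x) =
        (\<Sum>n<N. \<Sum>\<tau>\<in>{- int n..int n}. R \<tau> * fexp (m + - \<tau>) x) / (2 * of_real pi * of_nat N)" for x
      unfolding w_eq S_eq fexp_mult[symmetric] by (simp add: sum_distrib_left mult.left_commute)
    show "integrable freq_lebesgue (\<lambda>x. fexp m x * of_real (w N x))" unfolding eq by simp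
    have inner: "(\<Sum>\<tau>\<in>{- int n..int n}. R \<tau> * (if m + - \<tau> = 0 then 2 * complex_of_real pi else 0)) =
        (2 * of_real pi) * (R m * (if \<bar>m\<bar> \<le> int n then 1 else 0))" for n
    proof -
      have "(\<Sum>\<tau>\<in>{- int n..int n}. R \<tau> * (if m + - \<tau> = 0 then 2 * complex_of_real pi else 0)) =
         (\<Sum>\<tau>\<in>{- int n..int n}. if \<tau> = m then R m * (2 * of_real pi) else 0)"
        by (intro sum.cong) auto
      then show ?thesis by auto
    qed
    have "(\<integral>x. fexp m x * of_real (w N x) \<partial>freq_lebesgue) =
       (\<Sum>n<N. \<Sum>\<tau>\<in>{- int n..int n}. R \<tau> * (if m + - \<tau> = 0 then 2 * of_real pi else 0)) / (2 * of_real pi * of_nat N)"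
      unfolding eq by (simp add: integral_fexp)
    also have "\<dots> = (\<Sum>n<N. (2 * of_real pi) * (R m * (if \<bar>m\<bar> \<le> int n then 1 else 0))) / (2 * of_real pi * of_nat N)"
      unfolding inner ..
    finally show "(\<integral>x. fexp m x * of_real (w N x) \<partial>freq_lebesgue) = R m * \<kappa> m N"
      unfolding sum_distrib_left[symmetric] \<kappa>_def by simp
  qed
  have w_int: "integrable freq_lebesgue (w N)" for N
    using coeff(1)[of 0 N] by (simp add: complex_of_real_integrable_eq)
  have w_total: "(\<integral>x. w N x \<partial>freq_lebesgue) = R0" if "N > 0" for N
  proof -
    have "complex_of_real (\<integral>x. w N x \<partial>freq_lebesgue) = of_real R0"
      using coeff(2)[of 0 N] \<kappa>_0[OF that] R0 by simp
    then show ?thesis by (simp only: of_real_eq_iff)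
  qed
  show ?thesis
  proof (cases "R0 = 0")
    \<comment> \<open>With total mass 0 there is nothing to normalise; the densities then vanish
      almost everywhere, every \<open>R m\<close> is 0 and the null measure will do.\<close>
    case True
    have "R m = 0" for m
    proof -
      \<comment> \<open>The least index with a non-zero weight at \<open>m\<close>; that weight is
        \<open>1 / N\<close>.\<close>
      define N where "N = Suc (nat \<bar>m\<bar>)"
      have "cmod (R m * \<kappa> m N) \<le> (\<integral>x. cmod (fexp m x * of_real (w N x)) \<partial>freq_lebesgue)"
        unfolding coeff(2)[symmetric] by (rule integral_norm_bound)
      also have "\<dots> = (\<integral>x. w N x \<partial>freq_lebesgue)" by (simp add: norm_mult w_nonneg)
      also have "\<dots> = 0" using w_total[of N] True by (simp add: N_def)
      finally have "R m * \<kappa> m N = 0" by simp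
      moreover have "\<kappa> m N \<noteq> 0"
      proof -
        have "(\<Sum>n<N. if \<bar>m\<bar> \<le> int n then 1 else 0 :: complex) = (\<Sum>n\<in>{nat \<bar>m\<bar>}. 1)"
          unfolding N_def by (rule sum.mono_neutral_cong_right) auto
        then have "\<kappa> m N = 1 / of_nat N" unfolding \<kappa>_def by (simp only:) simp
        moreover have "N \<noteq> 0" by (simp add: N_def)
        ultimately show ?thesis by simp
      qed
      ultimately show ?thesis by simp
    qed
    then show ?thesis
      by (intro that[of "null_measure freq_space"] finite_measureI) auto
  next
    case False
    with R0 have R0_pos: "R0 > 0" by simp
    \<comment> \<open>The index is shifted since \<open>w 0\<close> is 0 and has no mass. The laws
      are then moved to the real line, where tightness and weak convergence are formulated.\<close>
    define D where "D N = density freq_lebesgue (\<lambda>x. ennreal (w (Suc N) x / R0))" for N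
    define \<nu> where "\<nu> N = distr (D N) borel (\<lambda>x. x)" for N
    have [measurable]: "w N \<in> borel_measurable freq_lebesgue" for N using w_int by simp
    have id_meas [measurable]: "(\<lambda>x. x) \<in> freq_lebesgue \<rightarrow>\<^sub>M borel"
      unfolding freq_lebesgue_def by (intro measurable_restrict_space1) simp
    have id_D [measurable]: "(\<lambda>x. x) \<in> D N \<rightarrow>\<^sub>M borel" for N unfolding D_def by simp
    have prob_D: "prob_space (D N)" for N
    proof
      have "emeasure (D N) (space (D N)) = (\<integral>\<^sup>+x. ennreal (w (Suc N) x / R0) \<partial>freq_lebesgue)"
        unfolding D_def by (subst emeasure_density) (auto intro!: nn_integral_cong simp: indicator_def sets_freq_space)
      also have "\<dots> = ennreal (\<integral>x. w (Suc N) x / R0 \<partial>freq_lebesgue)"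
        using w_int w_nonneg R0_pos by (intro nn_integral_eq_integral) auto
      also have "\<dots> = 1" using w_total[of "Suc N"] R0_pos by simp
      finally show "emeasure (D N) (space (D N)) = 1" .
    qed
    have rd: "real_distribution (\<nu> N)" for N
      unfolding \<nu>_def by (rule prob_space.real_distribution_distr[OF prob_D id_D])
    have space_D: "space (D N) = {0..<2 * pi}" for N by (simp add: D_def)
    have "tight \<nu>"
      unfolding tight_def
    proof (intro conjI allI impI rd)
      fix e :: real assume "e > 0"
      \<comment> \<open>All laws live on [0, 2 pi); the left end is placed below 0 because the
        interval in the definition of tightness is open there.\<close>
      have "measure (\<nu> N) {-1<..2 * pi} = 1" for N
      proof -
        have "measure (\<nu> N) {-1<..2 * pi} = measure (D N) ((\<lambda>x. x) -` {-1<..2 * pi} \<inter> space (D N))"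
          unfolding \<nu>_def by (rule measure_distr[OF id_D]) simp
        also have "(\<lambda>x. x) -` {-1<..2 * pi} \<inter> space (D N) = space (D N)" unfolding space_D by auto
        finally show ?thesis using prob_space.prob_space[OF prob_D] by simp
      qed
      moreover have "-1 < 2 * pi" using pi_gt_zero by linarith
      ultimately have "-1 < 2 * pi \<and> (\<forall>n. 1 - e < measure (\<nu> n) {-1<..2 * pi})"
        using \<open>e > 0\<close> by simp
      then show "\<exists>a b. a < b \<and> (\<forall>n. 1 - e < measure (\<nu> n) {a<..b})" by blast
    qed
    then obtain r \<nu>' where r: "strict_mono r" "real_distribution \<nu>'" "weak_conv_m (\<nu> \<circ> id \<circ> r) \<nu>'"
      using tight_imp_convergent_subsubsequence[of \<nu> id] strict_mono_id by blast
    interpret \<nu>': real_distribution \<nu>' by fact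
    have char_fexp: "char N (of_int m) = (\<integral>x. fexp m x \<partial>N)" for N m
      by (simp add: char_def fexp_def mult.commute)
    have char_\<nu>: "char (\<nu> N) (of_int m) = R m * \<kappa> m (Suc N) / of_real R0" for N m
    proof -
      have "char (\<nu> N) (of_int m) = (\<integral>x. fexp m x \<partial>D N)"
        unfolding char_fexp \<nu>_def by (rule integral_distr[OF id_D]) simp
      also have "\<dots> = (\<integral>x. (w (Suc N) x / R0) *\<^sub>R fexp m x \<partial>freq_lebesgue)"
        unfolding D_def by (rule integral_density) (use w_nonneg R0_pos in auto)
      also have "\<dots> = (\<integral>x. fexp m x * of_real (w (Suc N) x) / of_real R0 \<partial>freq_lebesgue)"
        by (simp add: scaleR_conv_of_real mult.commute)
      also have "\<dots> = R m * \<kappa> m (Suc N) / of_real R0" using coeff by simp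
      finally show ?thesis .
    qed
    have char_lim: "char \<nu>' (of_int m) = R m / of_real R0" for m
    proof (rule LIMSEQ_unique)
      show "(\<lambda>n. char ((\<nu> \<circ> id \<circ> r) n) (of_int m)) \<longlonglongrightarrow> char \<nu>' (of_int m)"
        by (rule levy_continuity1[OF _ r(2,3)]) (simp add: rd)
      have "strict_mono (\<lambda>n. Suc (r n))" using r(1) by (simp add: strict_mono_def)
      from LIMSEQ_subseq_LIMSEQ[OF \<kappa>_lim this] have "(\<lambda>n. \<kappa> m (Suc (r n))) \<longlonglongrightarrow> 1" by (simp add: o_def)
      then have "(\<lambda>n. R m * \<kappa> m (Suc (r n)) / of_real R0) \<longlonglongrightarrow> R m * 1 / of_real R0"
        by (intro tendsto_intros) (use R0_pos in auto)
      then show "(\<lambda>n. char ((\<nu> \<circ> id \<circ> r) n) (of_int m)) \<longlonglongrightarrow> R m / of_real R0"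
        by (simp add: char_\<nu>)
    qed
    define P where "P = distr \<nu>' freq_space (\<lambda>\<omega>. Arg2pi (cis \<omega>))"
    have T: "(\<lambda>\<omega>. Arg2pi (cis \<omega>)) \<in> \<nu>' \<rightarrow>\<^sub>M freq_space"
      unfolding freq_space_def
    proof (rule measurable_restrict_space2)
      have "cis \<in> borel_measurable borel" by (intro borel_measurable_continuous_onI continuous_intros)
      then show "(\<lambda>\<omega>. Arg2pi (cis \<omega>)) \<in> borel_measurable \<nu>'" by simp
    qed (auto simp: Arg2pi_ge_0 Arg2pi_lt_2pi)
    have "finite_measure P"
      unfolding P_def by (rule \<nu>'.finite_measure_distr[OF T])
    moreover have "sets P = sets freq_space" by (simp add: P_def)
    ultimately have sets_P [measurable_cong]: "sets P = sets freq_space" and fin_P: "finite_measure P" by auto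
    \<comment> \<open>Exponentials of integer frequency depend on \<open>x\<close> only through
      \<open>cis x\<close>, so folding does not change their integrals.\<close>
    have fexp_cis: "fexp n x = cis x powi n" for n x
      unfolding cis_power_int by (simp add: fexp_def cis_conv_exp mult.commute)
    have cis_Arg: "cis (Arg2pi (cis x)) = cis x" for x
      using complex_norm_eq_1_exp[of "cis x"] by (simp add: cis_conv_exp)
    have int_P: "(\<integral>x. fexp n x \<partial>P) = R n / of_real R0" for n
    proof -
      have "(\<integral>x. fexp n x \<partial>P) = (\<integral>x. fexp n (Arg2pi (cis x)) \<partial>\<nu>')"
        unfolding P_def by (rule integral_distr[OF T]) simp
      also have "\<dots> = (\<integral>x. fexp n x \<partial>\<nu>')" by (simp add: fexp_cis cis_Arg)
      finally show ?thesis using char_lim[of n] by (simp add: char_fexp)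
    qed
    define \<mu> where "\<mu> = density P (\<lambda>_. ennreal R0)"
    show ?thesis
    proof (rule that[of \<mu>])
      interpret P: finite_measure P by (rule fin_P)
      show "finite_measure \<mu>"
        by (rule finite_measureI) (simp add: \<mu>_def emeasure_density ennreal_mult_eq_top_iff)
      show "sets \<mu> = sets freq_space" by (simp add: \<mu>_def sets_P)
      show "(\<integral>x. fexp n x \<partial>\<mu>) = R n" for n
      proof -
        have "(\<integral>x. fexp n x \<partial>\<mu>) = (\<integral>x. R0 *\<^sub>R fexp n x \<partial>P)"
          unfolding \<mu>_def by (rule integral_density) (use R0 in auto)
        then show ?thesis using R0_pos by (simp add: int_P scaleR_conv_of_real)
      qed
    qed
  qed
qed

lemma sq_norm_sum_expand:
  fixes N :: nat
  assumes "\<And>j. j < N \<Longrightarrow> f j \<in> L2 M"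
  shows "of_real (sq_norm M (\<lambda>x. \<Sum>j<N. c j * f j x)) = (\<Sum>j<N. \<Sum>k<N. c j * cnj (c k) * ip M (f j) (f k))"
proof -
  have L: "(\<lambda>x. \<Sum>j<n. c j * f j x) \<in> L2 M" if "n \<le> N" for n
    using that by (induction n) (auto intro!: L2_add L2_scale assms)
  have 1: "ip M (\<lambda>x. \<Sum>j<n. c j * f j x) h = (\<Sum>j<n. c j * ip M (f j) h)" if "n \<le> N" "h \<in> L2 M" for n h
    using that by (induction n) (auto simp: ip_add_left L assms ip_def[of M "\<lambda>_. 0"])
  have 2: "ip M h (\<lambda>x. \<Sum>j<n. c j * f j x) = (\<Sum>j<n. cnj (c j) * ip M h (f j))" if "n \<le> N" "h \<in> L2 M" for n h
    unfolding ip_cnj[of M _ h, symmetric] 1[OF that] by (simp add: ip_cnj)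
  have "of_real (sq_norm M (\<lambda>x. \<Sum>j<N. c j * f j x)) = (\<Sum>j<N. c j * ip M (f j) (\<lambda>x. \<Sum>j<N. c j * f j x))"
    unfolding ip_self[symmetric] using 1[OF order_refl L] by simp
  also have "\<dots> = (\<Sum>j<N. c j * (\<Sum>k<N. cnj (c k) * ip M (f j) (f k)))"
    by (intro sum.cong) (auto simp: 2 assms)
  finally show ?thesis by (simp add: sum_distrib_left mult.assoc)
qed

definition exponential_pairs where
  "exponential_pairs Y = {(fexp n, Y n) |n :: int. True}"

text \<open>The quadratic form in Herglotz' theorem is the squared norm of a linear combination of
  the \<open>Y j\<close> with coefficients \<open>fexp (- j) x\<close>; the resulting moments say
  that exponentials and \<open>Y\<close> have the same inner products.\<close>

lemma stationary_frequency_isometry: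
  assumes "prob_space M" and Y: "\<And>n. Y n \<in> L2 M"
    and stat: "\<And>n m. ip M (Y n) (Y m) = ip M (Y (n - m)) (Y 0)"
  obtains \<mu> where "frequency_isometry \<mu> M (exponential_pairs Y)"
proof -
  define R where "R n = ip M (Y n) (Y 0)" for n
  have pos: "\<exists>r\<ge>0. (\<Sum>j<N. \<Sum>k<N. R (int j - int k) * fexp (int k - int j) x) = of_real r" for N x
  proof (intro exI conjI)
    have "(\<Sum>j<N. \<Sum>k<N. R (int j - int k) * fexp (int k - int j) x) =
        (\<Sum>j<N. \<Sum>k<N. fexp (- int j) x * cnj (fexp (- int k) x) * ip M (Y (int j)) (Y (int k)))"
      unfolding R_def stat[symmetric] cnj_fexp fexp_mult by (simp add: mult.commute)
    also have "\<dots> = of_real (sq_norm M (\<lambda>y. \<Sum>j<N. fexp (- int j) x * Y (int j) y))"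
      using sq_norm_sum_expand[of N "\<lambda>j. Y (int j)" M "\<lambda>j. fexp (- int j) x"] Y by simp
    finally show "(\<Sum>j<N. \<Sum>k<N. R (int j - int k) * fexp (int k - int j) x) =
      of_real (sq_norm M (\<lambda>y. \<Sum>j<N. fexp (- int j) x * Y (int j) y))" .
  qed simp
  obtain \<mu> where \<mu>: "finite_measure \<mu>" "sets \<mu> = sets freq_space" "\<And>n. (\<integral>x. fexp n x \<partial>\<mu>) = R n"
    using Herglotz[OF pos] by metis
  have m: "fexp n \<in> borel_measurable \<mu>" for n
    using fexp_measurable_freq measurable_cong_sets[OF \<mu>(2) refl] by blast
  have "frequency_isometry \<mu> M (exponential_pairs Y)"
  proof (intro frequency_isometry.intro isometric_generators.intro isometric_generators_axioms.intro
      frequency_isometry_axioms.intro assms(1) \<mu>(1,2))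
    fix f Z assume "(f, Z) \<in> exponential_pairs Y"
    then obtain n where n: "f = fexp n" "Z = Y n" by (auto simp: exponential_pairs_def)
    show "f \<in> L2 \<mu>" unfolding n by (rule L2_bounded[OF \<mu>(1) m, of _ 1]) simp
    show "Z \<in> L2 M" unfolding n by (rule Y)
    fix g W assume "(g, W) \<in> exponential_pairs Y"
    then obtain k where k: "g = fexp k" "W = Y k" by (auto simp: exponential_pairs_def)
    show "ip \<mu> f g = ip M Z W"
      unfolding n k ip_def[of \<mu>] cnj_fexp fexp_mult \<mu>(3) stat[of n k] by (simp add: R_def)
  qed
  then show ?thesis by (rule that)
qed

text \<open>A common domain for all components: bounded functions lie in \<open>L2\<close> of every
  finite measure on the frequency interval and, unlike \<open>L2\<close>, are closed under
  products.\<close>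

definition bounded_freq :: "(real \<Rightarrow> complex) set" where
  "bounded_freq = {f \<in> borel_measurable freq_space. \<exists>B. \<forall>x\<in>{0..<2 * pi}. cmod (f x) \<le> B}"

lemma bounded_freqI:
  "f \<in> borel_measurable freq_space \<Longrightarrow> (\<And>x. x \<in> {0..<2 * pi} \<Longrightarrow> cmod (f x) \<le> B) \<Longrightarrow> f \<in> bounded_freq"
  unfolding bounded_freq_def by blast

lemma bounded_freq_measurable: "f \<in> bounded_freq \<Longrightarrow> f \<in> borel_measurable freq_space"
  by (simp add: bounded_freq_def)

lemma fexp_bounded_freq [simp]: "fexp n \<in> bounded_freq"
  by (rule bounded_freqI[where B = 1]) simp_all

lemma indicator_bounded_freq [simp]: "A \<in> sets freq_space \<Longrightarrow> (\<lambda>x. indicator A x) \<in> bounded_freq"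
  by (rule bounded_freqI[where B = 1]) (simp_all add: indicator_def)

lemma zero_bounded_freq: "(\<lambda>_. 0) \<in> bounded_freq"
  by (rule bounded_freqI[where B = 0]) simp_all

lemma bounded_freq_add:
  assumes "f \<in> bounded_freq" "g \<in> bounded_freq"
  shows "(\<lambda>x. f x + c * g x) \<in> bounded_freq"
proof -
  obtain B where f: "f \<in> borel_measurable freq_space" and B: "\<And>x. x \<in> {0..<2 * pi} \<Longrightarrow> cmod (f x) \<le> B"
    using assms(1) unfolding bounded_freq_def by blast
  obtain C where g: "g \<in> borel_measurable freq_space" and C: "\<And>x. x \<in> {0..<2 * pi} \<Longrightarrow> cmod (g x) \<le> C"
    using assms(2) unfolding bounded_freq_def by blast
  from B C have "cmod (f x + c * g x) \<le> B + cmod c * C" if "x \<in> {0..<2 * pi}" for x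
    using that by (intro norm_triangle_mono) (auto simp: norm_mult mult_left_mono)
  then show ?thesis by (intro bounded_freqI) (use f g in measurable)
qed

lemma bounded_freq_mult:
  assumes "f \<in> bounded_freq" "g \<in> bounded_freq"
  shows "(\<lambda>x. f x * g x) \<in> bounded_freq"
proof -
  obtain B where f: "f \<in> borel_measurable freq_space" and B: "\<And>x. x \<in> {0..<2 * pi} \<Longrightarrow> cmod (f x) \<le> B"
    using assms(1) unfolding bounded_freq_def by blast
  obtain C where g: "g \<in> borel_measurable freq_space" and C: "\<And>x. x \<in> {0..<2 * pi} \<Longrightarrow> cmod (g x) \<le> C"
    using assms(2) unfolding bounded_freq_def by blast
  from B C have "cmod (f x * g x) \<le> B * C" if "x \<in> {0..<2 * pi}" for x
    using that unfolding norm_mult by (intro mult_mono') auto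
  then show ?thesis by (intro bounded_freqI) (use f g in measurable)
qed

lemma bounded_freq_cnj: "f \<in> bounded_freq \<Longrightarrow> (\<lambda>x. cnj (f x)) \<in> bounded_freq"
  by (simp add: bounded_freq_def measurable_cnj)

lemma bounded_freq_limit:
  assumes "\<And>k. p k \<in> bounded_freq" and B: "\<And>k x. x \<in> {0..<2 * pi} \<Longrightarrow> cmod (p k x) \<le> B"
    and lim: "\<And>x. x \<in> {0..<2 * pi} \<Longrightarrow> (\<lambda>k. p k x) \<longlonglongrightarrow> f x"
  shows "f \<in> bounded_freq"
proof -
  have "cmod (f x) \<le> B" if "x \<in> {0..<2 * pi}" for x
    by (rule LIMSEQ_le_const2[OF tendsto_norm[OF lim[OF that]]]) (use B that in auto)
  moreover have "f \<in> borel_measurable freq_space"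
    by (rule bounded_limit_measurable[OF bounded_freq_measurable[OF assms(1)] lim])
  ultimately show ?thesis by (intro bounded_freqI)
qed

section \<open>The isometry attached to one stationary sequence\<close>

locale spectral_isometry = frequency_isometry \<mu> M "exponential_pairs Y"
  for \<mu> :: "real measure" and M :: "'a measure" and Y :: "int \<Rightarrow> 'a \<Rightarrow> complex"
begin

lemma fexp_in_C: "(fexp n, Y n) \<in> C"
  by (rule closed_span.gen) (auto simp: exponential_pairs_def)

lemma Y_L2: "Y n \<in> L2 M"
  by (rule C_L2(2)[OF fexp_in_C])

text \<open>An arbitrary version is chosen for each \<open>f\<close>, so linearity and continuity
  hold only up to null sets; they are therefore stated for inner products with a fixed
  \<open>W\<close>.\<close>

definition spectral_map :: "(real \<Rightarrow> complex) \<Rightarrow> 'a \<Rightarrow> complex" where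
  "spectral_map f = (SOME P. (f, P) \<in> C)"

lemma spectral_map_in_C:
  assumes "f \<in> bounded_freq"
  shows "(f, spectral_map f) \<in> C"
proof -
  interpret D: bounded_limit_closed "{f. \<exists>P. (f, P) \<in> C \<and> integrable freq_lebesgue (\<lambda>x. f x * 0) \<and>
       ip M P (\<lambda>_. 0) = (\<integral>x. f x * 0 \<partial>freq_lebesgue)}"
    by (rule pairing_closed) auto
  obtain B where "f \<in> borel_measurable freq_space" "\<And>x. x \<in> {0..<2 * pi} \<Longrightarrow> cmod (f x) \<le> B"
    using assms unfolding bounded_freq_def by blast
  from D.fexp_bounded_measurable_in_D[OF _ this] have "\<exists>P. (f, P) \<in> C"
    using fexp_in_C by (auto simp: ip_def)
  then show ?thesis unfolding spectral_map_def by (rule someI_ex)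
qed

lemma spectral_map_L2: "f \<in> bounded_freq \<Longrightarrow> spectral_map f \<in> L2 M"
  by (rule C_L2(2)[OF spectral_map_in_C])

lemma ip_spectral_map_cong:
  assumes "(f, P) \<in> C" "f \<in> bounded_freq" "W \<in> L2 M"
  shows "ip M (spectral_map f) W = ip M P W"
  using C_L2(2)[OF assms(1)] assms(3)
  by (intro ip_cong_AE spectral_map_L2 assms C_unique[OF spectral_map_in_C assms(1)]) (auto dest: L2_measurable)

lemma ip_spectral_map_add:
  assumes f: "f \<in> bounded_freq" and g: "g \<in> bounded_freq" and W: "W \<in> L2 M"
  shows "ip M (spectral_map (\<lambda>x. f x + c * g x)) W = ip M (spectral_map f) W + c * ip M (spectral_map g) W"
  using ip_spectral_map_cong[OF closed_span.add[OF spectral_map_in_C[OF f] spectral_map_in_C[OF g]] bounded_freq_add[OF f g] W]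
    ip_add_left[OF spectral_map_L2[OF f] spectral_map_L2[OF g] W] by simp

lemma ip_spectral_map_limit:
  assumes p: "\<And>k. p k \<in> bounded_freq" and B: "\<And>k x. x \<in> {0..<2 * pi} \<Longrightarrow> cmod (p k x) \<le> B"
    and lim: "\<And>x. x \<in> {0..<2 * pi} \<Longrightarrow> (\<lambda>k. p k x) \<longlonglongrightarrow> f x" and W: "W \<in> L2 M"
  shows "(\<lambda>k. ip M (spectral_map (p k)) W) \<longlonglongrightarrow> ip M (spectral_map f) W"
proof -
  have f: "f \<in> bounded_freq" by (rule bounded_freq_limit[OF p B lim])
  have "(\<lambda>k. sq_norm \<mu> (\<lambda>x. p k x - f x)) \<longlonglongrightarrow> 0"
    by (rule sq_norm_bounded_limit[OF finite_mu sets_mu bounded_freq_measurable[OF p] bounded_freq_measurable[OF f] B lim])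
  from C_limit_tendsto[OF spectral_map_in_C[OF p] spectral_map_in_C[OF f] this] show ?thesis
    by (rule tendsto_ip_left[OF spectral_map_L2[OF p] spectral_map_L2[OF f] W])
qed

definition spectral_measure :: "real set \<Rightarrow> 'a \<Rightarrow> complex" where
  "spectral_measure A = spectral_map (\<lambda>x. indicator A x)"

lemma spectral_measure_in_C: "A \<in> sets freq_space \<Longrightarrow> ((\<lambda>x. indicator A x), spectral_measure A) \<in> C"
  unfolding spectral_measure_def by (rule spectral_map_in_C) simp

text \<open>Additivity is the isometric image of the bounded convergence of the indicators of finite
  unions to that of the whole union.\<close>

lemma random_spectral_measure: "random_measure M spectral_measure"
  unfolding random_measure_def
proof (intro conjI ballI allI impI)
  fix A assume "A \<in> sets freq_space"
  then have "spectral_measure A \<in> L2 M" by (intro C_L2(2)[OF spectral_measure_in_C])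
  then show "spectral_measure A \<in> borel_measurable M" "integrable M (\<lambda>x. (cmod (spectral_measure A x))\<^sup>2)"
    by (auto simp: L2_def)
next
  fix A :: "nat \<Rightarrow> real set" assume A: "range A \<subseteq> sets freq_space" "disjoint_family A"
  then have Ai: "A i \<in> sets freq_space" and U: "(\<Union>i. A i) \<in> sets freq_space" for i by auto
  have S: "((\<lambda>x. \<Sum>i<N. indicator (A i) x), (\<lambda>x. \<Sum>i<N. spectral_measure (A i) x)) \<in> C" for N
  proof (induction N)
    case 0
    then show ?case by (simp add: closed_span.zero)
  next
    case (Suc N)
    from closed_span.add[OF Suc spectral_measure_in_C[OF Ai], of 1] show ?case by simp
  qed
  have eq: "(\<Sum>i<N. indicator (A i) x) = (indicator (\<Union>i<N. A i) x :: complex)" for N x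
    using A(2) by (subst indicator_UN_disjoint) (auto simp: disjoint_family_on_def)
  have "(\<lambda>N. sq_norm \<mu> (\<lambda>x. (\<Sum>i<N. indicator (A i) x) - indicator (\<Union>i. A i) x)) \<longlonglongrightarrow> 0"
    unfolding eq
  proof (rule sq_norm_bounded_limit[OF finite_mu sets_mu, where B = 1])
    show "(\<lambda>N. indicator (\<Union>i<N. A i) x :: complex) \<longlonglongrightarrow> indicator (\<Union>i. A i) x" for x
      by (rule LIMSEQ_indicator_UN)
  qed (use Ai in \<open>auto simp: indicator_def intro!: borel_measurable_indicator\<close>)
  from C_limit_tendsto[OF S spectral_measure_in_C[OF U] this]
  show "mean_square_tendsto M (\<lambda>N x. \<Sum>i<N. spectral_measure (A i) x) (spectral_measure (\<Union> (range A)))"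
    by (subst mean_square_tendsto_L2_iff[OF C_L2(2)[OF S] C_L2(2)[OF spectral_measure_in_C[OF U]]])
qed

lemma orthogonal_spectral_measure: "orthogonal_random_measure M spectral_measure"
proof (intro orthogonal_random_measure.intro orthogonal_random_measure_axioms.intro
    prob_space_axioms random_spectral_measure)
  fix A B assume A: "A \<in> sets freq_space" and B: "B \<in> sets freq_space" and "A \<inter> B = {}"
  then have "(\<lambda>x. indicator A x * cnj (indicator B x)) = (\<lambda>_. 0 :: complex)" 
    by (auto simp: fun_eq_iff indicator_def)
  then have "ip \<mu> (\<lambda>x. indicator A x) (\<lambda>x. indicator B x) = 0" by (simp add: ip_def)
  then show "ip M (spectral_measure A) (spectral_measure B) = 0"
    using C_ip[OF spectral_measure_in_C[OF A] spectral_measure_in_C[OF B]] by simp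
qed

text \<open>The definition of the stochastic integral measures approximation by the control measure
  of \<phi>; this identifies it with the measure from Herglotz' theorem.\<close>

lemma control_measure_eq: "control_measure M spectral_measure = \<mu>"
proof -
  interpret orth: orthogonal_random_measure M spectral_measure by (rule orthogonal_spectral_measure)
  interpret mu: finite_measure \<mu> by (rule finite_mu)
  show ?thesis
  proof (rule measure_eqI)
    show "sets (control_measure M spectral_measure) = sets \<mu>" by (simp add: sets_mu)
    fix A assume "A \<in> sets (control_measure M spectral_measure)"
    then have A: "A \<in> sets freq_space" by simp
    have A\<mu>: "A \<in> sets \<mu>" using A sets_mu by simp
    have "sq_norm M (spectral_measure A) = sq_norm \<mu> (\<lambda>x. indicator A x)"
      by (rule C_sq_norm[OF spectral_measure_in_C[OF A], symmetric])
    also have "\<dots> = (\<integral>x. indicator A x \<partial>\<mu>)"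
      unfolding sq_norm_def by (intro Bochner_Integration.integral_cong) (auto simp: indicator_def)
    also have "\<dots> = measure \<mu> A" using A\<mu> sets.sets_into_space[OF A\<mu>] by (simp add: inf_absorb1)
    finally show "emeasure (control_measure M spectral_measure) A = emeasure \<mu> A"
      by (simp add: orth.emeasure_control[OF A] mu.emeasure_eq_measure)
  qed
qed

lemma has_stochastic_integral_fexp: "has_stochastic_integral M spectral_measure (fexp n) (Y n)"
proof -
  obtain F where F: "\<And>i. simple_function freq_space (F i)"
    "\<And>x. x \<in> {0..<2 * pi} \<Longrightarrow> (\<lambda>i. F i x) \<longlonglongrightarrow> fexp n x"
    "\<And>i x. x \<in> {0..<2 * pi} \<Longrightarrow> dist (F i x) 0 \<le> 2 * dist (fexp n x) 0"
    using borel_measurable_implies_sequence_metric[OF fexp_measurable_freq[of n], of 0]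
    unfolding space_freq_space by blast
  have FC: "(F k, simple_stochastic_integral spectral_measure (F k)) \<in> C" for k
    by (rule simple_integral_in_closed_span[OF isometric_generators_axioms finite_mu sets_mu spectral_measure_in_C F(1)])
  \<comment> \<open>The bound 2 is twice the modulus 1 of an exponential.\<close>
  have lim: "(\<lambda>k. sq_norm \<mu> (\<lambda>x. F k x - fexp n x)) \<longlonglongrightarrow> 0"
    by (rule sq_norm_bounded_limit[OF finite_mu sets_mu borel_measurable_simple_function[OF F(1)] fexp_measurable_freq _ F(2), where B = 2])
      (use F(3) in auto)
  show ?thesis
    unfolding has_stochastic_integral_def control_measure_eq
  proof (intro conjI exI[of _ F] allI F(1))
    show "Y n \<in> borel_measurable M" by (rule L2_measurable[OF Y_L2])
    show "mean_square_tendsto \<mu> F (fexp n)"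
      unfolding mean_square_tendsto_L2_iff[OF C_L2(1)[OF FC] C_L2(1)[OF fexp_in_C]] by (rule lim)
    show "mean_square_tendsto M (\<lambda>k. simple_stochastic_integral spectral_measure (F k)) (Y n)"
      unfolding mean_square_tendsto_L2_iff[OF C_L2(2)[OF FC] Y_L2]
      by (rule C_limit_tendsto[OF FC fexp_in_C lim])
  qed
qed

end

text \<open>Stationarity says \<open>\<langle>S e\<^sub>n, T g\<rangle> = \<langle>S 1, T (e\<^sub>-\<^sub>n g)\<rangle>\<close> for exponentials \<open>g\<close>, where \<open>S\<close> and \<open>T\<close> are the two
  isometries. This extends to bounded measurable \<open>g\<close>, and then to \<open>\<langle>S f, T g\<rangle> = \<langle>S 1, T (cnj f \<cdot> g)\<rangle>\<close> for
  bounded measurable \<open>f\<close>. For indicators of disjoint sets the right-hand side vanishes.\<close>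

lemma cross_orthogonal_spectral_measures:
  assumes "spectral_isometry \<mu> M Y" "spectral_isometry \<mu>' M Z"
    and stat: "\<And>n m. ip M (Y n) (Z m) = ip M (Y (n - m)) (Z 0)"
    and A: "A \<in> sets freq_space" and B: "B \<in> sets freq_space" and disj: "A \<inter> B = {}"
  shows "ip M (spectral_isometry.spectral_measure \<mu> M Y A) (spectral_isometry.spectral_measure \<mu>' M Z B) = 0"
proof -
  interpret Y: spectral_isometry \<mu> M Y by fact
  interpret Z: spectral_isometry \<mu>' M Z by fact
  \<comment> \<open>The two isometries are exchanged here, so that the varying function
    \<open>g\<close> stands in the first slot, where the inner product is linear.\<close>
  have sub: "ip M (Z.spectral_map g) (Y.spectral_map (fexp n)) = ip M (Z.spectral_map (\<lambda>x. fexp (- n) x * g x)) (Y.spectral_map (fexp 0))"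
    if g: "g \<in> bounded_freq" for g n
  proof -
    let ?D = "{g \<in> bounded_freq. ip M (Z.spectral_map g) (Y.spectral_map (fexp n)) =
      ip M (Z.spectral_map (\<lambda>x. fexp (- n) x * g x)) (Y.spectral_map (fexp 0))}"
    interpret bounded_limit_closed ?D
    proof
      fix f g c assume "f \<in> ?D" "g \<in> ?D"
      then have f: "f \<in> bounded_freq" "ip M (Z.spectral_map f) (Y.spectral_map (fexp n)) =
          ip M (Z.spectral_map (\<lambda>x. fexp (- n) x * f x)) (Y.spectral_map (fexp 0))"
        and g: "g \<in> bounded_freq" "ip M (Z.spectral_map g) (Y.spectral_map (fexp n)) =
          ip M (Z.spectral_map (\<lambda>x. fexp (- n) x * g x)) (Y.spectral_map (fexp 0))" by auto
      have eq: "(\<lambda>x. fexp (- n) x * (f x + c * g x)) = (\<lambda>x. fexp (- n) x * f x + c * (fexp (- n) x * g x))"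
        by (simp add: algebra_simps)
      show "(\<lambda>x. f x + c * g x) \<in> ?D"
        unfolding eq mem_Collect_eq
          Z.ip_spectral_map_add[OF f(1) g(1) Y.spectral_map_L2[OF fexp_bounded_freq]]
          Z.ip_spectral_map_add[OF bounded_freq_mult[OF fexp_bounded_freq f(1)] bounded_freq_mult[OF fexp_bounded_freq g(1)] Y.spectral_map_L2[OF fexp_bounded_freq]]
          f(2) g(2)
        by (simp add: bounded_freq_add f(1) g(1))
    next
      fix p B f assume "\<And>k. p k \<in> ?D" and B: "\<And>k x. x \<in> {0..<2 * pi} \<Longrightarrow> cmod (p k x) \<le> B"
        and lim: "\<And>x. x \<in> {0..<2 * pi} \<Longrightarrow> (\<lambda>k. p k x) \<longlonglongrightarrow> f x"
      then have p: "\<And>k. p k \<in> bounded_freq" and e: "\<And>k. ip M (Z.spectral_map (p k)) (Y.spectral_map (fexp n)) =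
          ip M (Z.spectral_map (\<lambda>x. fexp (- n) x * p k x)) (Y.spectral_map (fexp 0))" by auto
      have "(\<lambda>k. ip M (Z.spectral_map (p k)) (Y.spectral_map (fexp n))) \<longlonglongrightarrow> ip M (Z.spectral_map f) (Y.spectral_map (fexp n))"
        by (rule Z.ip_spectral_map_limit[OF p B lim Y.spectral_map_L2[OF fexp_bounded_freq]])
      moreover have "(\<lambda>k. ip M (Z.spectral_map (\<lambda>x. fexp (- n) x * p k x)) (Y.spectral_map (fexp 0))) \<longlonglongrightarrow>
          ip M (Z.spectral_map (\<lambda>x. fexp (- n) x * f x)) (Y.spectral_map (fexp 0))"
      proof (rule Z.ip_spectral_map_limit[OF _ _ _ Y.spectral_map_L2[OF fexp_bounded_freq], where B = B])
        show "(\<lambda>x. fexp (- n) x * p k x) \<in> bounded_freq" for k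
          by (rule bounded_freq_mult[OF fexp_bounded_freq p])
        show "cmod (fexp (- n) x * p k x) \<le> B" if "x \<in> {0..<2 * pi}" for k x
          using B[OF that] by (simp add: norm_mult)
        show "(\<lambda>k. fexp (- n) x * p k x) \<longlonglongrightarrow> fexp (- n) x * f x" if "x \<in> {0..<2 * pi}" for x
          by (intro tendsto_intros lim that)
      qed
      ultimately show "f \<in> ?D"
        unfolding e using bounded_freq_limit[OF p B lim] by (simp add: LIMSEQ_unique)
    qed
    have "fexp m \<in> ?D" for m
    proof -
      have ZY: "ip M (Z.spectral_map (fexp i)) (Y.spectral_map (fexp j)) = cnj (ip M (Y j) (Z i))" for i j
        unfolding Z.ip_spectral_map_cong[OF Z.fexp_in_C fexp_bounded_freq Y.spectral_map_L2[OF fexp_bounded_freq]]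
        using Y.ip_spectral_map_cong[OF Y.fexp_in_C fexp_bounded_freq Z.Y_L2] by (metis ip_cnj)
      have eq: "(\<lambda>x. fexp (- n) x * fexp m x) = fexp (m - n)" by (simp add: fexp_mult)
      \<comment> \<open>Both pairs of times have difference \<open>n - m\<close>, so stationarity
        reduces them to the same value.\<close>
      have "ip M (Y n) (Z m) = ip M (Y 0) (Z (m - n))" using stat[of n m] stat[of 0 "m - n"] by simp
      then show ?thesis unfolding mem_Collect_eq eq ZY by simp
    qed
    moreover obtain K where "g \<in> borel_measurable freq_space" "\<And>x. x \<in> {0..<2 * pi} \<Longrightarrow> cmod (g x) \<le> K"
      using g unfolding bounded_freq_def by blast
    ultimately have "g \<in> ?D" by (rule fexp_bounded_measurable_in_D)
    then show ?thesis by simp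
  qed
  define g :: "real \<Rightarrow> complex" where "g x = indicator B x" for x
  have g: "g \<in> bounded_freq" unfolding g_def using B by simp
  let ?D = "{f \<in> bounded_freq. ip M (Y.spectral_map f) (Z.spectral_map g) =
      cnj (ip M (Z.spectral_map (\<lambda>x. cnj (f x) * g x)) (Y.spectral_map (fexp 0)))}"
  interpret bounded_limit_closed ?D
  proof
    fix f h c assume "f \<in> ?D" "h \<in> ?D"
    then have f: "f \<in> bounded_freq" "ip M (Y.spectral_map f) (Z.spectral_map g) =
        cnj (ip M (Z.spectral_map (\<lambda>x. cnj (f x) * g x)) (Y.spectral_map (fexp 0)))"
      and h: "h \<in> bounded_freq" "ip M (Y.spectral_map h) (Z.spectral_map g) =
        cnj (ip M (Z.spectral_map (\<lambda>x. cnj (h x) * g x)) (Y.spectral_map (fexp 0)))" by auto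
    have eq: "(\<lambda>x. cnj (f x + c * h x) * g x) = (\<lambda>x. cnj (f x) * g x + cnj c * (cnj (h x) * g x))"
      by (simp add: algebra_simps)
    show "(\<lambda>x. f x + c * h x) \<in> ?D"
      unfolding eq mem_Collect_eq Y.ip_spectral_map_add[OF f(1) h(1) Z.spectral_map_L2[OF g]]
        Z.ip_spectral_map_add[OF bounded_freq_mult[OF bounded_freq_cnj[OF f(1)] g] bounded_freq_mult[OF bounded_freq_cnj[OF h(1)] g]
          Y.spectral_map_L2[OF fexp_bounded_freq]] f(2) h(2)
      by (simp add: bounded_freq_add f(1) h(1))
  next
    fix p K f assume "\<And>k. p k \<in> ?D" and K: "\<And>k x. x \<in> {0..<2 * pi} \<Longrightarrow> cmod (p k x) \<le> K"
      and lim: "\<And>x. x \<in> {0..<2 * pi} \<Longrightarrow> (\<lambda>k. p k x) \<longlonglongrightarrow> f x"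
    then have p: "\<And>k. p k \<in> bounded_freq" and e: "\<And>k. ip M (Y.spectral_map (p k)) (Z.spectral_map g) =
        cnj (ip M (Z.spectral_map (\<lambda>x. cnj (p k x) * g x)) (Y.spectral_map (fexp 0)))" by auto
    have "(\<lambda>k. ip M (Y.spectral_map (p k)) (Z.spectral_map g)) \<longlonglongrightarrow> ip M (Y.spectral_map f) (Z.spectral_map g)"
      by (rule Y.ip_spectral_map_limit[OF p K lim Z.spectral_map_L2[OF g]])
    moreover have "(\<lambda>k. ip M (Z.spectral_map (\<lambda>x. cnj (p k x) * g x)) (Y.spectral_map (fexp 0))) \<longlonglongrightarrow>
        ip M (Z.spectral_map (\<lambda>x. cnj (f x) * g x)) (Y.spectral_map (fexp 0))"
    proof (rule Z.ip_spectral_map_limit[OF _ _ _ Y.spectral_map_L2[OF fexp_bounded_freq], where B = K])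
      show "(\<lambda>x. cnj (p k x) * g x) \<in> bounded_freq" for k
        by (rule bounded_freq_mult[OF bounded_freq_cnj[OF p] g])
      show "cmod (cnj (p k x) * g x) \<le> K" if "x \<in> {0..<2 * pi}" for k x
        \<comment> \<open>Off \<open>B\<close> the product is 0, so \<open>0 \<le> K\<close> is also
          required.\<close>
        using K[OF that] order_trans[OF norm_ge_zero K[OF that]] by (simp add: norm_mult g_def indicator_def)
      show "(\<lambda>k. cnj (p k x) * g x) \<longlonglongrightarrow> cnj (f x) * g x" if "x \<in> {0..<2 * pi}" for x
        by (intro tendsto_intros lim that)
    qed
    then have "(\<lambda>k. cnj (ip M (Z.spectral_map (\<lambda>x. cnj (p k x) * g x)) (Y.spectral_map (fexp 0)))) \<longlonglongrightarrow>
        cnj (ip M (Z.spectral_map (\<lambda>x. cnj (f x) * g x)) (Y.spectral_map (fexp 0)))" by (rule tendsto_cnj)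
    ultimately show "f \<in> ?D"
      unfolding e using bounded_freq_limit[OF p K lim] by (simp add: LIMSEQ_unique)
  qed
  have "fexp n \<in> ?D" for n
  proof -
    have "cnj (ip M (Z.spectral_map (\<lambda>x. cnj (fexp n x) * g x)) (Y.spectral_map (fexp 0))) = ip M (Y.spectral_map (fexp n)) (Z.spectral_map g)"
      unfolding cnj_fexp sub[OF g, symmetric] by (rule ip_cnj)
    then show ?thesis by (simp del: fexp_0)
  qed
  from indicator_in_D[OF this A] have "ip M (Y.spectral_map (\<lambda>x. indicator A x)) (Z.spectral_map g) =
      cnj (ip M (Z.spectral_map (\<lambda>x. cnj (indicator A x) * g x)) (Y.spectral_map (fexp 0)))" by simp
  also have "(\<lambda>x. cnj (indicator A x) * g x) = (\<lambda>_. 0)"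
    using disj by (auto simp: g_def indicator_def fun_eq_iff)
  also have "ip M (Z.spectral_map (\<lambda>_. 0)) (Y.spectral_map (fexp 0)) = 0"
    unfolding Z.ip_spectral_map_cong[OF closed_span.zero zero_bounded_freq Y.spectral_map_L2[OF fexp_bounded_freq]]
    by (simp add: ip_def)
  finally show ?thesis unfolding Y.spectral_measure_def Z.spectral_measure_def g_def by simp
qed

text \<open>Additivity follows by pairing partial sums with the value of \<psi> on the union, where
  disjoint parts cancel. For the variation, Cauchy-Schwarz and the inequality between geometric and
  arithmetic mean bound each term by two squared norms, whose sums stay below the total masses of
  the control measures.\<close>

lemma complex_measure_BV_ip:
  assumes "orthogonal_random_measure M \<phi>" and \<psi>: "orthogonal_random_measure M \<psi>"
    and cross: "\<And>A B. A \<in> sets freq_space \<Longrightarrow> B \<in> sets freq_space \<Longrightarrow> A \<inter> B = {} \<Longrightarrow> ip M (\<phi> A) (\<psi> B) = 0"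
  shows "complex_measure_BV (\<lambda>A. ip M (\<phi> A) (\<psi> A))"
proof -
  interpret \<phi>: orthogonal_random_measure M \<phi> by fact
  interpret \<psi>: orthogonal_random_measure M \<psi> by fact
  have "(\<lambda>i. ip M (\<phi> (A i)) (\<psi> (A i))) sums ip M (\<phi> (\<Union>i. A i)) (\<psi> (\<Union>i. A i))"
    if A: "range A \<subseteq> sets freq_space" "disjoint_family A" for A :: "nat \<Rightarrow> real set"
  proof -
    have Ai: "A i \<in> sets freq_space" and U: "(\<Union>i. A i) \<in> sets freq_space" for i using A by auto
    have "(\<lambda>N. ip M (\<lambda>x. \<Sum>i<N. \<phi> (A i) x) (\<psi> (\<Union>i. A i))) \<longlonglongrightarrow> ip M (\<phi> (\<Union>i. A i)) (\<psi> (\<Union>i. A i))"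
      by (rule tendsto_ip_left) (use Ai A(2) U in \<open>auto intro!: \<phi>.phi_sum_L2 \<phi>.phi_L2 \<psi>.phi_L2 \<phi>.phi_sigma_additive\<close>)
    moreover have "ip M (\<lambda>x. \<Sum>i<N. \<phi> (A i) x) (\<psi> (\<Union>i. A i)) = (\<Sum>i<N. ip M (\<phi> (A i)) (\<psi> (A i)))" for N
    proof (induction N)
      case 0
      then show ?case by (simp add: ip_def)
    next
      case (Suc N)
      have "A N \<inter> (\<Union>i. A i) = A N" by auto
      moreover have "ip M (\<phi> (A N)) (\<psi> (\<Union>i. A i)) = ip M (\<phi> (A N \<inter> (\<Union>i. A i))) (\<psi> (A N \<inter> (\<Union>i. A i)))"
        by (rule \<phi>.ip_phi[OF Ai U \<psi> cross])
      ultimately have "ip M (\<phi> (A N)) (\<psi> (\<Union>i. A i)) = ip M (\<phi> (A N)) (\<psi> (A N))" by (simp only:)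
      moreover have "(\<lambda>x. \<Sum>i<N. \<phi> (A i) x) \<in> L2 M" using Ai by (intro \<phi>.phi_sum_L2) auto
      ultimately show ?case
        using ip_add_left[of "\<lambda>x. \<Sum>i<N. \<phi> (A i) x" M "\<phi> (A N)" "\<psi> (\<Union>i. A i)" 1] Ai U Suc
        by (simp add: \<phi>.phi_L2 \<psi>.phi_L2)
    qed
    ultimately show ?thesis by (simp add: sums_def)
  qed
  moreover have "(\<Sum>A\<in>\<A>. cmod (ip M (\<phi> A) (\<psi> A))) \<le>
      measure (control_measure M \<phi>) {0..<2 * pi} + measure (control_measure M \<psi>) {0..<2 * pi}"
    if \<A>: "finite \<A>" "\<A> \<subseteq> sets freq_space" "disjoint \<A>" for \<A>
  proof -
    have total: "(\<Sum>A\<in>\<A>. sq_norm M (\<xi> A)) \<le> measure (control_measure M \<xi>) {0..<2 * pi}"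
      if "orthogonal_random_measure M \<xi>" for \<xi>
    proof -
      interpret \<xi>: orthogonal_random_measure M \<xi> by fact
      interpret fin: finite_measure "control_measure M \<xi>" by (rule \<xi>.finite_control)
      have "(\<Sum>A\<in>\<A>. sq_norm M (\<xi> A)) = (\<Sum>A\<in>\<A>. measure (control_measure M \<xi>) A)"
        using \<A>(2) by (intro sum.cong) (auto simp: measure_def \<xi>.emeasure_control)
      also have "\<dots> = measure (control_measure M \<xi>) (\<Union>A\<in>\<A>. A)"
        using \<A> by (intro fin.finite_measure_finite_Union[symmetric]) (auto simp: disjoint_family_on_def disjoint_def)
      also have "\<dots> \<le> measure (control_measure M \<xi>) (space (control_measure M \<xi>))"
        by (rule fin.bounded_measure)
      finally show ?thesis by simp
    qed
    have "(\<Sum>A\<in>\<A>. cmod (ip M (\<phi> A) (\<psi> A))) \<le> (\<Sum>A\<in>\<A>. sq_norm M (\<phi> A) + sq_norm M (\<psi> A))"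
    proof (rule sum_mono)
      fix A assume "A \<in> \<A>"
      then have "A \<in> sets freq_space" using \<A>(2) by auto
      then have "cmod (ip M (\<phi> A) (\<psi> A)) \<le> sqrt (sq_norm M (\<phi> A)) * sqrt (sq_norm M (\<psi> A))"
        by (intro Cauchy_Schwarz_L2 \<phi>.phi_L2 \<psi>.phi_L2)
      also have "\<dots> \<le> sq_norm M (\<phi> A) + sq_norm M (\<psi> A)"
        using arith_geo_mean_sqrt[of "sq_norm M (\<phi> A)" "sq_norm M (\<psi> A)"]
        by (simp add: real_sqrt_mult) (smt (verit) sq_norm_nonneg field_sum_of_halves)
      finally show "cmod (ip M (\<phi> A) (\<psi> A)) \<le> sq_norm M (\<phi> A) + sq_norm M (\<psi> A)" .
    qed
    then show ?thesis using total[OF assms(1)] total[OF \<psi>] by (simp add: sum.distrib)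
  qed
  ultimately show ?thesis unfolding complex_measure_BV_def by blast
qed

section \<open>Densities and Fourier coefficients\<close>

text \<open>The functions \<open>f\<close> with \<open>E[(\<integral>f d\<phi>) cnj (\<psi>[0, 2\<pi>))] = \<integral>f g\<close> form a class that contains all bounded
  measurable functions as soon as it contains all indicators, and also as soon as it contains all
  exponentials.\<close>

lemma fourier_coeff_of_density:
  assumes \<phi>: "orthogonal_random_measure M \<phi>" and \<psi>: "orthogonal_random_measure M \<psi>"
    and cross: "\<And>A B. A \<in> sets freq_space \<Longrightarrow> B \<in> sets freq_space \<Longrightarrow> A \<inter> B = {} \<Longrightarrow> ip M (\<phi> A) (\<psi> B) = 0"
    and Y: "\<And>n. (fexp n, Y n) \<in> closed_span (control_measure M \<phi>) M (orthogonal_random_measure.indicator_pairs \<phi>)"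
    and Z: "(fexp 0, Z) \<in> closed_span (control_measure M \<psi>) M (orthogonal_random_measure.indicator_pairs \<psi>)"
    and g: "integrable freq_lebesgue g"
  shows "(\<forall>A\<in>sets freq_space. ip M (\<phi> A) (\<psi> A) = (\<integral>x. indicator A x * g x \<partial>freq_lebesgue)) \<longleftrightarrow>
    (\<forall>n. fourier_coeff g n = ip M (Y n) Z)"
proof -
  interpret \<phi>: orthogonal_random_measure M \<phi> by fact
  interpret \<psi>: orthogonal_random_measure M \<psi> by fact
  let ?\<Omega> = "{0..<2 * pi}"
  have \<Omega>: "?\<Omega> \<in> sets freq_space" by (simp add: sets_freq_space)
  have W: "\<psi> ?\<Omega> \<in> L2 M" by (rule \<psi>.phi_L2[OF \<Omega>])
  have ZL: "Z \<in> L2 M" by (rule \<psi>.C_L2(2)[OF Z])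
  \<comment> \<open>The indicator of the whole interval and \<open>fexp 0\<close> coincide on it, so
    \<open>\<psi> ?\<Omega>\<close> and \<open>Z\<close> are two versions of the integral of
    1.\<close>
  have "((\<lambda>x. indicator ?\<Omega> x), \<psi> ?\<Omega>) \<in> \<psi>.C"
    using \<Omega> by (intro closed_span.gen) (auto simp: \<psi>.indicator_pairs_def)
  then have "(fexp 0, \<psi> ?\<Omega>) \<in> \<psi>.C"
    by (rule \<psi>.C_cong[OF _ \<psi>.C_L2(1)[OF Z] W]) (auto intro!: AE_I2)
  then have ZW: "AE x in M. \<psi> ?\<Omega> x = Z x" using Z by (rule \<psi>.C_unique)
  have ip_Z: "ip M P Z = ip M P (\<psi> ?\<Omega>)" if "P \<in> L2 M" for P
    using ZW by (intro ip_cong_AE that ZL L2_measurable[OF that] L2_measurable[OF W]) auto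
  \<comment> \<open>The right-hand set no longer varies with \<open>A\<close>, so a single vector
    can be paired with the whole class.\<close>
  have diag: "ip M (\<phi> A) (\<psi> A) = ip M (\<phi> A) (\<psi> ?\<Omega>)" if A: "A \<in> sets freq_space" for A
  proof -
    have "A \<subseteq> ?\<Omega>" using sets.sets_into_space[OF A] by (simp only: space_freq_space)
    then have "A \<inter> ?\<Omega> = A" by (rule inf_absorb1)
    moreover have "ip M (\<phi> A) (\<psi> ?\<Omega>) = ip M (\<phi> (A \<inter> ?\<Omega>)) (\<psi> (A \<inter> ?\<Omega>))"
      by (rule \<phi>.ip_phi[OF A \<Omega> \<psi> cross])
    ultimately show ?thesis by (simp only:)
  qed
  have gen: "((\<lambda>x. indicator A x), \<phi> A) \<in> \<phi>.C" if "A \<in> sets freq_space" for A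
    using that by (intro closed_span.gen) (auto simp: \<phi>.indicator_pairs_def)
  let ?D = "{f. \<exists>P. (f, P) \<in> \<phi>.C \<and> integrable freq_lebesgue (\<lambda>x. f x * g x) \<and>
       ip M P (\<psi> ?\<Omega>) = (\<integral>x. f x * g x \<partial>freq_lebesgue)}"
  interpret D: bounded_limit_closed ?D by (rule \<phi>.pairing_closed[OF W g])
  \<comment> \<open>Partners are unique up to null sets, so the existential quantifier in
    \<open>?D\<close> may be evaluated at any known partner.\<close>
  have D_iff: "f \<in> ?D \<longleftrightarrow> ip M P (\<psi> ?\<Omega>) = (\<integral>x. f x * g x \<partial>freq_lebesgue)"
    if f: "(f, P) \<in> \<phi>.C" "integrable freq_lebesgue (\<lambda>x. f x * g x)" for f P
  proof -
    have "ip M Q (\<psi> ?\<Omega>) = ip M P (\<psi> ?\<Omega>)" if "(f, Q) \<in> \<phi>.C" for Q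
      by (rule ip_cong_AE[OF \<phi>.C_L2(2)[OF that] W L2_measurable[OF \<phi>.C_L2(2)[OF f(1)]] L2_measurable[OF W]
            \<phi>.C_unique[OF that f(1)]]) simp
    with f show ?thesis unfolding mem_Collect_eq by metis
  qed
  have ind: "(\<lambda>x. indicator A x) \<in> ?D \<longleftrightarrow> ip M (\<phi> A) (\<psi> A) = (\<integral>x. indicator A x * g x \<partial>freq_lebesgue)"
    if A: "A \<in> sets freq_space" for A
    unfolding diag[OF A]
    by (rule D_iff[OF gen[OF A] bounded_mult_integrable[OF g, where B = 1]]) (use A in \<open>auto simp: indicator_def intro!: borel_measurable_indicator\<close>)
  have exps: "fexp n \<in> ?D \<longleftrightarrow> fourier_coeff g n = ip M (Y n) Z" for n
    unfolding D_iff[OF Y fexp_mult_integrable[OF g]] ip_Z[OF \<phi>.C_L2(2)[OF Y]] fourier_coeff_def by auto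
  show ?thesis
  proof
    assume "\<forall>A\<in>sets freq_space. ip M (\<phi> A) (\<psi> A) = (\<integral>x. indicator A x * g x \<partial>freq_lebesgue)"
    then have "(\<lambda>x. indicator A x) \<in> ?D" if "A \<in> sets freq_space" for A
      using ind[OF that] that by blast
    then have "fexp n \<in> ?D" for n
      by (rule D.bounded_measurable_in_D[where B = 1]) auto
    then show "\<forall>n. fourier_coeff g n = ip M (Y n) Z" using exps by blast
  next
    assume "\<forall>n. fourier_coeff g n = ip M (Y n) Z"
    then have "fexp n \<in> ?D" for n using exps by blast
    then have "(\<lambda>x. indicator A x) \<in> ?D" if "A \<in> sets freq_space" for A
      using that by (rule D.indicator_in_D)
    then show "\<forall>A\<in>sets freq_space. ip M (\<phi> A) (\<psi> A) = (\<integral>x. indicator A x * g x \<partial>freq_lebesgue)"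
      using ind by blast
  qed
qed

lemma set_integrable_freq: "set_integrable lborel {0..<2 * pi} g \<longleftrightarrow> integrable freq_lebesgue (g :: real \<Rightarrow> complex)"
  unfolding set_integrable_def freq_lebesgue_def by (subst integrable_restrict_space) auto

lemma set_integral_freq:
  assumes "A \<in> sets freq_space"
  shows "(LINT x:A|lborel. g x) = (\<integral>x. indicator A x * (g x :: complex) \<partial>freq_lebesgue)"
proof -
  have "(\<integral>x. indicator A x * g x \<partial>freq_lebesgue) = (\<integral>x. indicator {0..<2 * pi} x *\<^sub>R (indicator A x * g x) \<partial>lborel)"
    unfolding freq_lebesgue_def by (subst integral_restrict_space) auto
  also have "\<dots> = (LINT x:A|lborel. g x)"
    unfolding set_lebesgue_integral_def
  proof (rule Bochner_Integration.integral_cong)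
    fix x
    have "A \<subseteq> {0..<2 * pi}" using sets.sets_into_space[OF assms] by (simp only: space_freq_space)
    then show "indicator {0..<2 * pi} x *\<^sub>R (indicator A x * g x) = indicator A x *\<^sub>R g x"
      by (auto simp: indicator_def)
  qed simp
  finally show ?thesis ..
qed

lemma AE_freq_lebesgue: "(AE x in freq_lebesgue. P x) \<longleftrightarrow> (AE x in lborel. x \<in> {0..<2 * pi} \<longrightarrow> P x)"
  unfolding freq_lebesgue_def by (subst AE_restrict_space_iff) auto

lemma has_spectral_density_iff:
  "has_spectral_density (\<lambda>A. ip M (\<phi> A) (\<psi> A)) g \<longleftrightarrow> integrable freq_lebesgue g \<and>
    (\<forall>A\<in>sets freq_space. ip M (\<phi> A) (\<psi> A) = (\<integral>x. indicator A x * g x \<partial>freq_lebesgue))"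
  unfolding has_spectral_density_def set_integrable_freq using set_integral_freq by auto

text \<open>The partial sums are bounded by the sum of the norms, so integration passes to the
  limit, and the integral against \<open>fexp n\<close> no longer changes once \<open>N\<close>
  reaches \<open>\<bar>n\<bar>\<close>.\<close>

lemma fourier_coeff_absolutely_convergent:
  fixes a :: "int \<Rightarrow> complex"
  assumes a: "(\<lambda>\<tau>. norm (a \<tau>)) summable_on UNIV"
  defines "h \<equiv> \<lambda>x. lim (\<lambda>N. \<Sum>\<tau>\<in>{- int N..int N}. fexp (- \<tau>) x * a \<tau>) / (2 * of_real pi)"
  shows "integrable freq_lebesgue h" "fourier_coeff h n = a n"
proof -
  define S where "S N x = (\<Sum>\<tau>\<in>{- int N..int N}. fexp (- \<tau>) x * a \<tau>)" for N x
  have conv: "(\<lambda>N. S N x) \<longlonglongrightarrow> lim (\<lambda>N. S N x)" for x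
  proof -
    have "(\<lambda>\<tau>. norm (fexp (- \<tau>) x * a \<tau>)) summable_on UNIV" using a by (simp add: norm_mult)
    then have "(\<lambda>\<tau>. fexp (- \<tau>) x * a \<tau>) summable_on UNIV" by (rule abs_summable_summable)
    then have "(sum (\<lambda>\<tau>. fexp (- \<tau>) x * a \<tau>) \<longlongrightarrow> infsum (\<lambda>\<tau>. fexp (- \<tau>) x * a \<tau>) UNIV) (finite_subsets_at_top UNIV)"
      using has_sum_infsum has_sum_def by blast
    \<comment> \<open>Symmetric intervals eventually contain every finite set of integers, so the
      unordered sum is also the limit of the symmetric partial sums.\<close>
    moreover have "filterlim (\<lambda>N. {- int N..int N}) (finite_subsets_at_top UNIV) sequentially"
      unfolding filterlim_finite_subsets_at_top
    proof (intro allI impI)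
      fix X :: "int set" assume X: "finite X \<and> X \<subseteq> UNIV"
      define K where "K = Max (insert 0 ((\<lambda>x. nat \<bar>x\<bar>) ` X))"
      have "nat \<bar>x\<bar> \<le> K" if "x \<in> X" for x using X that by (auto simp: K_def intro!: Max_ge)
      then have "X \<subseteq> {- int N..int N}" if "N \<ge> K" for N using that by fastforce
      then show "\<forall>\<^sub>F N in sequentially. finite {- int N..int N} \<and> X \<subseteq> {- int N..int N} \<and> {- int N..int N} \<subseteq> UNIV"
        by (intro eventually_mono[OF eventually_ge_at_top[of K]]) simp
    qed
    ultimately have "(\<lambda>N. S N x) \<longlonglongrightarrow> infsum (\<lambda>\<tau>. fexp (- \<tau>) x * a \<tau>) UNIV"
      unfolding S_def by (rule filterlim_compose)
    then show ?thesis by (metis limI)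
  qed
  define K where "K = infsum (\<lambda>\<tau>. norm (a \<tau>)) UNIV"
  have bound: "cmod (S N x) \<le> K" for N x
  proof -
    have "cmod (S N x) \<le> (\<Sum>\<tau>\<in>{- int N..int N}. norm (a \<tau>))"
      unfolding S_def by (rule order_trans[OF norm_sum]) (simp add: norm_mult)
    also have "\<dots> \<le> K" unfolding K_def by (rule finite_sum_le_infsum[OF a]) auto
    finally show ?thesis .
  qed
  have Sm: "S N \<in> borel_measurable freq_space" for N unfolding S_def by measurable
  let ?L = "\<lambda>x. lim (\<lambda>N. S N x)"
  have h_eq: "h = (\<lambda>x. ?L x / (2 * of_real pi))" by (simp add: h_def S_def)
  have Lb: "cmod (?L x) \<le> K" for x
    by (rule LIMSEQ_le_const2[OF tendsto_norm[OF conv]]) (use bound in auto)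
  have Lm: "?L \<in> borel_measurable freq_space"
    by (rule bounded_limit_measurable[OF Sm conv])
  interpret finite_measure freq_lebesgue by (rule finite_measure_freq_lebesgue)
  have Li: "integrable freq_lebesgue ?L"
    by (rule integrable_const_bound[where B = K]) (use Lb Lm in auto)
  then show "integrable freq_lebesgue h" unfolding h_eq by simp
  have "(\<lambda>N. \<integral>x. S N x * fexp n x \<partial>freq_lebesgue) \<longlonglongrightarrow> (\<integral>x. ?L x * fexp n x \<partial>freq_lebesgue)"
    by (rule bounded_mult_limit[OF integrable_fexp Sm bound conv])
  moreover have "(\<integral>x. S N x * fexp n x \<partial>freq_lebesgue) = 2 * of_real pi * a n" if "N \<ge> nat \<bar>n\<bar>" for N
  proof -
    have eq: "S N x * fexp n x = (\<Sum>\<tau>\<in>{- int N..int N}. a \<tau> * fexp (- \<tau> + n) x)" for x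
      unfolding S_def fexp_mult[symmetric] by (simp add: sum_distrib_right sum_distrib_left mult_ac)
    have "(\<integral>x. S N x * fexp n x \<partial>freq_lebesgue) =
        (\<Sum>\<tau>\<in>{- int N..int N}. a \<tau> * (if - \<tau> + n = 0 then 2 * of_real pi else 0))"
      unfolding eq by (simp add: integral_fexp)
    also have "\<dots> = (\<Sum>\<tau>\<in>{- int N..int N}. if \<tau> = n then a n * (2 * of_real pi) else 0)"
      by (intro sum.cong) auto
    also have "\<dots> = 2 * of_real pi * a n" using that by auto
    finally show ?thesis .
  qed
  then have "(\<lambda>N. \<integral>x. S N x * fexp n x \<partial>freq_lebesgue) \<longlonglongrightarrow> 2 * of_real pi * a n"
    by (intro tendsto_eventually eventually_mono[OF eventually_ge_at_top[of "nat \<bar>n\<bar>"]]) simp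
  ultimately have "(\<integral>x. ?L x * fexp n x \<partial>freq_lebesgue) = 2 * of_real pi * a n" by (rule LIMSEQ_unique)
  then have "(\<integral>x. fexp n x * ?L x / (2 * of_real pi) \<partial>freq_lebesgue) = a n"
    by (simp add: mult.commute)
  then show "fourier_coeff h n = a n" by (simp add: fourier_coeff_def h_eq)
qed

section \<open>Discrete scale invariant processes\<close>

locale DSI_process = prob_space M for M :: "'a measure" +
  fixes H l :: real and X :: "real \<Rightarrow> 'a \<Rightarrow> real"
  assumes l_gt_1: "l > 1" and DSI: "wide_sense_DSI M H l X"
begin

lemma l_pow_pos [simp]: "l powi n > 0"
  using l_gt_1 by (intro zero_less_power_int) auto

lemma l_powi_powr: "(l powi n) powr a = l powr (of_int n * a)"
  using l_gt_1 by (simp add: powr_powr flip: powr_real_of_int')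

lemma X_measurable: "t > 0 \<Longrightarrow> X t \<in> borel_measurable M"
  and X_sq_integrable: "t > 0 \<Longrightarrow> integrable M (\<lambda>x. (X t x)\<^sup>2)"
  and X_mean: "t > 0 \<Longrightarrow> (\<integral>x. X (l * t) x \<partial>M) = l powr H * (\<integral>x. X t x \<partial>M)"
  and X_product: "t > 0 \<Longrightarrow> s > 0 \<Longrightarrow>
    (\<integral>x. X (l * t) x * X (l * s) x \<partial>M) = l powr (2 * H) * (\<integral>x. X t x * X s x \<partial>M)"
  using DSI by (auto simp: wide_sense_DSI_def)

lemma X_L2: "t > 0 \<Longrightarrow> (\<lambda>x. complex_of_real (X t x)) \<in> L2 M"
  using X_measurable X_sq_integrable by (simp add: L2_def)

lemma X_integrable: "t > 0 \<Longrightarrow> integrable M (X t)"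
  by (rule square_integrable_imp_integrable[OF X_measurable X_sq_integrable])

lemma X_mult_integrable:
  assumes "t > 0" "s > 0"
  shows "integrable M (\<lambda>x. X t x * X s x)"
proof -
  have "integrable M (\<lambda>x. complex_of_real (X t x * X s x))"
    using L2_mult_integrable[OF X_L2[OF assms(1)] X_L2[OF assms(2)]] by simp
  then show ?thesis by (simp only: complex_of_real_integrable_eq)
qed

text \<open>Scale invariance concerns a single factor \<open>l\<close>. With a general
  \<open>f\<close> the iteration serves the mean, as a function of time, and the product moment, as
  a function of a common factor of both times.\<close>

lemma scaling_iterate:
  fixes f :: "real \<Rightarrow> real"
  assumes step: "\<And>c. c > 0 \<Longrightarrow> f (l * c) = l powr a * f c" and c: "c > 0"
  shows "f (l powi n * c) = (l powi n) powr a * f c"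
proof -
  have nat: "f (l ^ k * c) = (l powr a) ^ k * f c" if "c > 0" for k c
  proof (induction k)
    case (Suc k)
    have "l ^ k * c > 0" using l_gt_1 that by simp
    from step[OF this] Suc show ?case by (simp add: mult.assoc)
  qed simp
  have lk: "(l ^ k) powr a = (l powr a) ^ k" for k
    using l_gt_1 by (simp add: powr_realpow[symmetric] powr_powr powr_power mult.commute)
  show ?thesis
  proof (cases "n \<ge> 0")
    case True
    then obtain k where n: "n = int k" using nonneg_int_cases by blast
    then show ?thesis using nat[OF c, of k] by (simp add: lk)
  next
    case False
    then obtain k where n: "n = - int k" by (metis int_cases2 of_nat_0_le_iff)
    have pos: "l powi n * c > 0" using c by simp
    \<comment> \<open>For negative exponents one scales forward from the smaller time back to
      \<open>c\<close> and solves for its value.\<close>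
    have "l ^ k * (l powi n * c) = c" using l_gt_1 by (simp add: n power_int_minus)
    with nat[OF pos, of k] have "f c = (l powr a) ^ k * f (l powi n * c)" by simp
    moreover have "(l powi n) powr a * (l powr a) ^ k = 1"
      using l_gt_1 by (simp add: n power_int_minus lk[symmetric] inverse_powr powr_minus)
    ultimately show ?thesis by (metis mult.assoc mult_1)
  qed
qed

lemma X_mean_scale:
  assumes "t > 0"
  shows "(\<integral>x. X (l powi n * t) x \<partial>M) = (l powi n) powr H * (\<integral>x. X t x \<partial>M)"
  by (rule scaling_iterate[where f = "\<lambda>c. \<integral>x. X c x \<partial>M", OF X_mean assms])

lemma X_product_scale:
  assumes "t > 0" "s > 0"
  shows "(\<integral>x. X (l powi n * t) x * X (l powi n * s) x \<partial>M) = (l powi n) powr (2 * H) * (\<integral>x. X t x * X s x \<partial>M)"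
proof -
  have "(\<integral>x. X (l * c * t) x * X (l * c * s) x \<partial>M) = l powr (2 * H) * (\<integral>x. X (c * t) x * X (c * s) x \<partial>M)"
    if "c > 0" for c
    using X_product[of "c * t" "c * s"] that assms by (simp add: mult.assoc)
  from scaling_iterate[where f = "\<lambda>c. \<integral>x. X (c * t) x * X (c * s) x \<partial>M", OF this, of 1 n]
  show ?thesis by simp
qed

lemma covariance_eq:
  assumes "t > 0" "s > 0"
  shows "covariance M (X t) (X s) = (\<integral>x. X t x * X s x \<partial>M) - (\<integral>x. X t x \<partial>M) * (\<integral>x. X s x \<partial>M)"
proof -
  define a b where "a = (\<integral>x. X t x \<partial>M)" and "b = (\<integral>x. X s x \<partial>M)"
  have eq: "(X t x - a) * (X s x - b) = X t x * X s x - b * X t x - a * X s x + a * b" for x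
    by (simp add: algebra_simps)
  have "covariance M (X t) (X s) = (\<integral>x. X t x * X s x - b * X t x - a * X s x + a * b \<partial>M)"
    unfolding covariance_def a_def[symmetric] b_def[symmetric] eq ..
  also have "\<dots> = (\<integral>x. X t x * X s x \<partial>M) - b * a - a * b + a * b"
    using X_mult_integrable[OF assms] X_integrable[OF assms(1)] X_integrable[OF assms(2)]
    by (simp add: a_def b_def prob_space)
  finally show ?thesis by (simp add: a_def b_def)
qed

lemma sampled_multi_dim_self_similar:
  assumes s: "\<And>j. j < q \<Longrightarrow> s j > 0"
  shows "multi_dim_self_similar M H l q (\<lambda>j t. X (t * s j))"
  unfolding multi_dim_self_similar_def
proof (intro conjI allI impI)
  fix j assume "j < q"
  then have sj: "s j > 0" by (rule s)
  \<comment> \<open>Self-similarity quantifies over all real factors that stay in the grid; these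
    are powers of \<open>l\<close>.\<close>
  have quot: "\<exists>m. c = l powi m" if c: "c * l powi n \<in> range (\<lambda>n. l powi n)" for c n
  proof -
    obtain k where "c * l powi n = l powi k" using c by auto
    moreover have "l powi n \<noteq> 0" using l_pow_pos[of n] by linarith
    ultimately have "c = l powi k / l powi n" by (metis nonzero_mult_div_cancel_right)
    also have "\<dots> = l powi (k - n)" using l_gt_1 by (simp add: power_int_diff)
    finally show ?thesis by blast
  qed
  show "wide_sense_self_similar M H (range (\<lambda>n. l powi n)) (\<lambda>t. X (t * s j))"
    unfolding wide_sense_self_similar_def
  proof (intro conjI ballI allI impI)
    fix k assume "k \<in> range (\<lambda>n. l powi n)"
    then obtain n where k: "k = l powi n" by auto
    have ks: "k * s j > 0" using sj by (simp add: k)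
    show "X (k * s j) \<in> borel_measurable M" "integrable M (\<lambda>x. (X (k * s j) x)\<^sup>2)"
      using X_measurable[OF ks] X_sq_integrable[OF ks] by auto
    fix c :: real assume "c > 0" "c * k \<in> range (\<lambda>n. l powi n)"
    then obtain m where c: "c = l powi m" using quot k by blast
    show "(\<integral>x. X (c * k * s j) x \<partial>M) = c powr H * (\<integral>x. X (k * s j) x \<partial>M)"
      unfolding c mult.assoc by (rule X_mean_scale[OF ks])
    fix k' assume "k' \<in> range (\<lambda>n. l powi n)"
    then obtain n' where k': "k' = l powi n'" by auto
    have ks': "k' * s j > 0" using sj by (simp add: k')
    show "(\<integral>x. X (c * k * s j) x * X (c * k' * s j) x \<partial>M) = c powr (2 * H) * (\<integral>x. X (k * s j) x * X (k' * s j) x \<partial>M)"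
      unfolding c mult.assoc by (rule X_product_scale[OF ks ks'])
  qed auto
next
  fix n \<tau> :: int and j k assume "j < q" "k < q"
  then have pos: "l powi \<tau> * s j > 0" "1 * s k > 0" "l powi n * (l powi \<tau> * s j) > 0" "l powi n * (1 * s k) > 0"
    using s by auto
  have eq: "l powi (n + \<tau>) * s j = l powi n * (l powi \<tau> * s j)" "l powi n * s k = l powi n * (1 * s k)"
    using l_gt_1 by (simp_all add: power_int_add mult.assoc)
  \<comment> \<open>The subtracted product of means scales by the power \<open>H\<close> twice,
    matching the exponent \<open>2 * H\<close> of the second moment.\<close>
  have sq: "(l powi n) powr (2 * H) = (l powi n) powr H * (l powi n) powr H"
    by (simp flip: powr_add)
  show "covariance M (X (l powi (n + \<tau>) * s j)) (X (l powi n * s k)) =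
      l powr (2 * of_int n * H) * covariance M (X (l powi \<tau> * s j)) (X (1 * s k))"
    unfolding eq covariance_eq[OF pos(3,4)] covariance_eq[OF pos(1,2)]
      X_product_scale[OF pos(1,2)] X_mean_scale[OF pos(1)] X_mean_scale[OF pos(2)]
    using l_powi_powr[of n "2 * H"] sq by (simp add: algebra_simps)
qed

text \<open>A discrete form of the Lamperti transform, complex-valued so that it fits into
  \<open>L2\<close>.\<close>

definition normalized :: "real \<Rightarrow> int \<Rightarrow> 'a \<Rightarrow> complex" where
  "normalized s n x = of_real ((l powi n * s) powr (- H) * X (l powi n * s) x)"

lemma normalized_L2:
  assumes "s > 0"
  shows "normalized s n \<in> L2 M"
proof -
  have "l powi n * s > 0" using assms by simp
  from L2_scale[OF X_L2[OF this], of "of_real ((l powi n * s) powr (- H))"] show ?thesis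
    by (simp add: normalized_def[abs_def])
qed

lemma normalized_ip:
  "ip M (normalized s n) (normalized r m) =
    of_real ((l powi n * s) powr (- H) * (l powi m * r) powr (- H) * (\<integral>x. X (l powi n * s) x * X (l powi m * r) x \<partial>M))"
proof -
  have eq: "normalized s n x * cnj (normalized r m x) =
    complex_of_real (((l powi n * s) powr (- H) * (l powi m * r) powr (- H)) * (X (l powi n * s) x * X (l powi m * r) x))" for x
    by (simp add: normalized_def mult_ac)
  show ?thesis unfolding ip_def eq integral_complex_of_real by simp
qed

text \<open>The common factor \<open>l powi m\<close> of both times contributes the power
  \<open>- H\<close> twice through the normalisation and \<open>2 * H\<close> through the second
  moment, and these cancel.\<close>

lemma normalized_stationary:
  assumes s: "s > 0" and r: "r > 0"
  shows "ip M (normalized s n) (normalized r m) = ip M (normalized s (n - m)) (normalized r 0)"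
proof -
  define p where "p = l powi m"
  have p: "p > 0" by (simp add: p_def)
  have n: "l powi n * s = p * (l powi (n - m) * s)"
    unfolding p_def using l_gt_1 by (simp add: power_int_diff)
  have pos: "l powi (n - m) * s > 0" using s by simp
  have cancel: "(p * (l powi (n - m) * s)) powr (- H) * (p * r) powr (- H) * (p powr (2 * H) * E) =
      (l powi (n - m) * s) powr (- H) * r powr (- H) * E" for E
  proof -
    have "p powr (- H) * p powr (- H) * p powr (2 * H) = 1"
      using p by (simp flip: powr_add)
    moreover have "(p * (l powi (n - m) * s)) powr (- H) = p powr (- H) * (l powi (n - m) * s) powr (- H)"
      "(p * r) powr (- H) = p powr (- H) * r powr (- H)"
      using p pos r by (auto intro!: powr_mult)
    moreover have "(p powr (- H) * (l powi (n - m) * s) powr (- H)) * (p powr (- H) * r powr (- H)) * (p powr (2 * H) * E) =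
        (p powr (- H) * p powr (- H) * p powr (2 * H)) * ((l powi (n - m) * s) powr (- H) * r powr (- H) * E)"
      by (simp only: mult_ac)
    ultimately show ?thesis by (simp only: mult_1)
  qed
  have "(l powi n * s) powr (- H) * (l powi m * r) powr (- H) * (\<integral>x. X (l powi n * s) x * X (l powi m * r) x \<partial>M) =
      (l powi (n - m) * s) powr (- H) * r powr (- H) * (\<integral>x. X (l powi (n - m) * s) x * X r x \<partial>M)"
    unfolding n p_def[symmetric] X_product_scale[OF pos r, of m, folded p_def] by (rule cancel)
  then show ?thesis unfolding normalized_ip by simp
qed

end

text \<open>The spectral distribution may have no density, and the Fourier series of an integrable
  density may diverge. The formula is therefore asserted for every density at almost every point
  where the symmetric sums converge, and it is shown to define a density when the series is
  absolutely summable. Both hold for every representing \<phi>, not only for the constructed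
  one.\<close>

theorem theorem3p1:
  fixes M :: "'a measure" and H l :: real and q :: nat and s :: "nat \<Rightarrow> real"
    and X :: "real \<Rightarrow> 'a \<Rightarrow> real" and V :: "nat \<Rightarrow> int \<Rightarrow> 'a \<Rightarrow> real"
  assumes "prob_space M"
    and "H > 0" and "l > 1"
    and "wide_sense_DSI M H l X"
    and "q \<ge> 1" and "1 \<le> s 0" and "strict_mono_on {..<q} s" and "s (q - 1) < l"
    and V: "\<And>u n. u < q \<Longrightarrow> V u n = X (l powi n * s u)"
  shows "multi_dim_embedded_self_similar M H l q V \<and>
    (\<exists>\<phi>. orthogonal_spectral_measures M q \<phi> \<and>
       (\<forall>u<q. \<forall>\<nu><q. complex_measure_BV (spectral_distribution M \<phi> u \<nu>)) \<and>
       harmonic_like_representation M H l q s V \<phi>) \<and>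
    (\<forall>\<phi>. orthogonal_spectral_measures M q \<phi> \<longrightarrow>
       harmonic_like_representation M H l q s V \<phi> \<longrightarrow>
       (\<forall>u<q. \<forall>\<nu><q.
          (\<forall>g. has_spectral_density (spectral_distribution M \<phi> u \<nu>) g \<longrightarrow>
             (AE \<omega> in lborel. \<omega> \<in> {0..<2 * pi} \<longrightarrow>
                convergent (density_partial_sum M H l V u \<nu> \<omega>) \<longrightarrow>
                g \<omega> = density_series M H l s V u \<nu> \<omega>)) \<and>
          ((\<lambda>\<tau>::int. norm (l powr (- H * of_int \<tau>) * cov_Q M V u \<nu> \<tau>)) summable_on UNIV \<longrightarrow>
             has_spectral_density (spectral_distribution M \<phi> u \<nu>)
               (density_series M H l s V u \<nu>))))"
proof -
  interpret DSI_process M H l X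
    using assms by (intro DSI_process.intro DSI_process_axioms.intro)
  have s_pos: "s u > 0" if "u < q" for u
  proof -
    have "s 0 \<le> s u"
      using \<open>strict_mono_on {..<q} s\<close> that by (cases "u = 0") (auto dest!: strict_mono_onD[of _ s 0 u])
    then show ?thesis using \<open>1 \<le> s 0\<close> by linarith
  qed
  define Y where "Y u = normalized (s u)" for u
  have Y_L2: "Y u n \<in> L2 M" if "u < q" for u n
    unfolding Y_def by (rule normalized_L2[OF s_pos[OF that]])
  have Y_stat: "ip M (Y u n) (Y v m) = ip M (Y u (n - m)) (Y v 0)" if "u < q" "v < q" for u v n m
    unfolding Y_def by (rule normalized_stationary[OF s_pos[OF that(1)] s_pos[OF that(2)]])
  have pos: "l powi n * s u > 0" if "u < q" for u n using s_pos[OF that] by simp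
  have VY: "complex_of_real (V u n x) = of_real ((l powi n * s u) powr H) * Y u n x" if "u < q" for u n x
  proof -
    have "(l powi n * s u) powr H * (l powi n * s u) powr (- H) = 1"
      using l_gt_1 s_pos[OF that] by (simp flip: powr_add)
    then have "(l powi n * s u) powr H * ((l powi n * s u) powr (- H) * X (l powi n * s u) x) = V u n x"
      by (simp only: V[OF that] mult.assoc[symmetric] mult_1)
    then show ?thesis unfolding Y_def normalized_def of_real_mult[symmetric] by (simp only:)
  qed
  have fexp_eq: "(\<lambda>\<omega>. exp (\<i> * of_real (\<omega> * of_int n))) = fexp n" for n
    by (simp add: fexp_def fun_eq_iff)
  have sd: "spectral_distribution M \<phi> u v = (\<lambda>A. ip M (\<phi> u A) (\<phi> v A))" for \<phi> u v
    by (simp add: spectral_distribution_def ip_def fun_eq_iff)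
  have orth: "orthogonal_random_measure M (\<phi> u)"
    "A \<in> sets freq_space \<Longrightarrow> B \<in> sets freq_space \<Longrightarrow> A \<inter> B = {} \<Longrightarrow> ip M (\<phi> u A) (\<phi> v B) = 0"
    if "orthogonal_spectral_measures M q \<phi>" "u < q" "v < q" for \<phi> u v A B
    using that \<open>prob_space M\<close>
    by (auto simp: orthogonal_spectral_measures_def ip_def
        intro!: orthogonal_random_measure.intro orthogonal_random_measure_axioms.intro)
  have "multi_dim_embedded_self_similar M H l q V"
    unfolding multi_dim_embedded_self_similar_def
    using sampled_multi_dim_self_similar[of q s, OF s_pos] V
    by (intro exI[of _ "\<lambda>j t. X (t * s j)"]) blast
  moreover have "\<exists>\<phi>. orthogonal_spectral_measures M q \<phi> \<and>
       (\<forall>u<q. \<forall>\<nu><q. complex_measure_BV (spectral_distribution M \<phi> u \<nu>)) \<and>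
       harmonic_like_representation M H l q s V \<phi>"
  proof -
    \<comment> \<open>The bound on \<open>u\<close> stands inside the existential quantifier so that
      choice yields a total function.\<close>
    have "\<forall>u. \<exists>\<mu>. u < q \<longrightarrow> spectral_isometry \<mu> M (Y u)"
    proof
      fix u
      show "\<exists>\<mu>. u < q \<longrightarrow> spectral_isometry \<mu> M (Y u)"
      proof (cases "u < q")
        case True
        obtain \<mu> where "frequency_isometry \<mu> M (exponential_pairs (Y u))"
          using stationary_frequency_isometry[OF \<open>prob_space M\<close> Y_L2[OF True] Y_stat[OF True True]] by blast
        then show ?thesis by (auto intro: spectral_isometry.intro)
      qed simp
    qed
    from choice[OF this] obtain \<mu> where \<mu>: "\<And>u. u < q \<Longrightarrow> spectral_isometry (\<mu> u) M (Y u)"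
      by blast
    define \<phi> where "\<phi> u = spectral_isometry.spectral_measure (\<mu> u) M (Y u)" for u
    have osm: "orthogonal_spectral_measures M q \<phi>"
      unfolding orthogonal_spectral_measures_def
    proof (intro conjI allI impI ballI)
      show "random_measure M (\<phi> u)" if "u < q" for u
        unfolding \<phi>_def by (rule spectral_isometry.random_spectral_measure[OF \<mu>[OF that]])
      show "(\<integral>x. \<phi> u A x * cnj (\<phi> v B x) \<partial>M) = 0"
        if "u < q" "v < q" "A \<in> sets freq_space" "B \<in> sets freq_space" "A \<inter> B = {}" for u v A B
        using cross_orthogonal_spectral_measures[OF \<mu>[OF that(1)] \<mu>[OF that(2)] Y_stat[OF that(1,2)] that(3-5)]
        by (simp add: ip_def \<phi>_def)
    qed
    moreover have "complex_measure_BV (spectral_distribution M \<phi> u v)" if "u < q" "v < q" for u v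
      unfolding sd
      by (rule complex_measure_BV_ip[OF orth(1)[OF osm that(1,1)] orth(1)[OF osm that(2,2)] orth(2)[OF osm that]])
    moreover have "harmonic_like_representation M H l q s V \<phi>"
      unfolding harmonic_like_representation_def fexp_eq
    proof (intro allI impI exI conjI)
      show "has_stochastic_integral M (\<phi> u) (fexp n) (Y u n)" if "u < q" for u n
        unfolding \<phi>_def by (rule spectral_isometry.has_stochastic_integral_fexp[OF \<mu>[OF that]])
      show "AE x in M. complex_of_real (V u n x) = of_real ((l powi n * s u) powr H) * Y u n x" if "u < q" for u n
        by (rule AE_I2) (rule VY[OF that])
    qed
    ultimately show ?thesis by blast
  qed
  moreover have "(\<forall>g. has_spectral_density (spectral_distribution M \<phi> u v) g \<longrightarrow>
             (AE \<omega> in lborel. \<omega> \<in> {0..<2 * pi} \<longrightarrow>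
                convergent (density_partial_sum M H l V u v \<omega>) \<longrightarrow>
                g \<omega> = density_series M H l s V u v \<omega>)) \<and>
          ((\<lambda>\<tau>::int. norm (l powr (- H * of_int \<tau>) * cov_Q M V u v \<tau>)) summable_on UNIV \<longrightarrow>
             has_spectral_density (spectral_distribution M \<phi> u v) (density_series M H l s V u v))"
    if \<phi>: "orthogonal_spectral_measures M q \<phi>" and rep: "harmonic_like_representation M H l q s V \<phi>"
      and u: "u < q" and v: "v < q" for \<phi> u v
  proof -
    \<comment> \<open>For an arbitrary \<phi> the integral is known only through \<open>V\<close>;
      dividing by the non-zero power identifies it almost everywhere with \<open>Y\<close>.\<close>
    have YC: "(fexp n, Y w n) \<in> closed_span (control_measure M (\<phi> w)) M (orthogonal_random_measure.indicator_pairs (\<phi> w))"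
      if w: "w < q" for w n
    proof -
      interpret orthogonal_random_measure M "\<phi> w" by (rule orth(1)[OF \<phi> w w])
      obtain I where I: "has_stochastic_integral M (\<phi> w) (fexp n) I"
        "AE x in M. complex_of_real (V w n x) = of_real ((l powi n * s w) powr H) * I x"
        using rep w unfolding harmonic_like_representation_def fexp_eq by blast
      have IC: "(fexp n, I) \<in> C"
        by (rule stochastic_integral_in_C[OF I(1) fexp_measurable_freq, where B = 1]) simp
      have "AE x in M. I x = Y w n x"
        using I(2)
      proof eventually_elim
        case (elim x)
        have "(l powi n * s w) powr H \<noteq> 0" using l_gt_1 s_pos[OF w] by simp
        then show ?case using elim unfolding VY[OF w] by (metis mult_cancel_left of_real_eq_0_iff)
      qed
      then show ?thesis
        by (intro C_cong[OF IC C_L2(1)[OF IC] Y_L2[OF w]]) simp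
    qed
    \<comment> \<open>The normalised covariance splits into \<open>K\<close>, which does not depend
      on the lag, and the coefficient \<open>a\<close> of the series.\<close>
    define K where "K = (s u * s v) powr (- H)"
    define a where "a \<tau> = complex_of_real (l powr (- H * of_int \<tau>) * cov_Q M V u v \<tau>)" for \<tau>
    have ip_Y: "ip M (Y u n) (Y v 0) = of_real K * a n" for n
    proof -
      have "(l powi n * s u) powr (- H) = l powr (- H * of_int n) * s u powr (- H)"
        using s_pos[OF u] l_powi_powr[of n "- H"] by (simp add: powr_mult mult.commute less_imp_le)
      then have "(l powi n * s u) powr (- H) * (l powi 0 * s v) powr (- H) = K * l powr (- H * of_int n)"
        using s_pos[OF u] s_pos[OF v] by (simp add: K_def powr_mult mult_ac)
      then show ?thesis
        unfolding Y_def normalized_ip a_def cov_Q_def V[OF u] V[OF v] by simp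
    qed
    \<comment> \<open>Both claims rest on this: read forwards, every density has the asserted
      Fourier series; read backwards, a function with these coefficients is a density.\<close>
    have density_iff: "has_spectral_density (spectral_distribution M \<phi> u v) g \<longleftrightarrow>
        integrable freq_lebesgue g \<and> (\<forall>n. fourier_coeff g n = of_real K * a n)" for g
    proof (cases "integrable freq_lebesgue g")
      case True
      have eq: "(\<forall>A\<in>sets freq_space. ip M (\<phi> u A) (\<phi> v A) = (\<integral>x. indicator A x * g x \<partial>freq_lebesgue)) \<longleftrightarrow>
          (\<forall>n. fourier_coeff g n = ip M (Y u n) (Y v 0))"
        by (rule fourier_coeff_of_density[OF orth(1)[OF \<phi> u u] orth(1)[OF \<phi> v v] orth(2)[OF \<phi> u v]
              YC[OF u] YC[OF v] True])
      show ?thesis unfolding sd has_spectral_density_iff eq ip_Y ..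
    next
      case False
      then show ?thesis unfolding sd has_spectral_density_iff by simp
    qed
    have partial: "density_partial_sum M H l V u v x N = (\<Sum>\<tau>\<in>{- int N..int N}. fexp (- \<tau>) x * a \<tau>)" for x N
      unfolding density_partial_sum_def a_def by (intro sum.cong) (simp_all add: fexp_def mult_ac)
    have series: "density_series M H l s V u v x =
        of_real K * (lim (\<lambda>N. \<Sum>\<tau>\<in>{- int N..int N}. fexp (- \<tau>) x * a \<tau>) / (2 * of_real pi))" for x
      unfolding density_series_def K_def partial[abs_def] by simp
    show ?thesis
    proof (intro conjI allI impI)
      fix g assume "has_spectral_density (spectral_distribution M \<phi> u v) g"
      then have g: "integrable freq_lebesgue g" "\<And>n. fourier_coeff g n = of_real K * a n"
        unfolding density_iff by auto
      have sum_eq: "fourier_sum g N x = of_real K * (\<Sum>\<tau>\<in>{- int N..int N}. fexp (- \<tau>) x * a \<tau>) / (2 * of_real pi)" for N x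
        unfolding fourier_sum_def g(2) by (simp add: sum_distrib_left mult_ac)
      have "AE x in freq_lebesgue. convergent (density_partial_sum M H l V u v x) \<longrightarrow> g x = density_series M H l s V u v x"
        using fourier_series_AE_limit[OF g(1)]
      proof eventually_elim
        case (elim x)
        show ?case
        proof
          assume "convergent (density_partial_sum M H l V u v x)"
          then have "(\<lambda>N. \<Sum>\<tau>\<in>{- int N..int N}. fexp (- \<tau>) x * a \<tau>) \<longlonglongrightarrow>
              lim (\<lambda>N. \<Sum>\<tau>\<in>{- int N..int N}. fexp (- \<tau>) x * a \<tau>)"
            unfolding partial[abs_def] convergent_LIMSEQ_iff .
          then have "(\<lambda>N. fourier_sum g N x) \<longlonglongrightarrow> of_real K *
              lim (\<lambda>N. \<Sum>\<tau>\<in>{- int N..int N}. fexp (- \<tau>) x * a \<tau>) / (2 * of_real pi)"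
            unfolding sum_eq by (intro tendsto_intros) auto
          then have "g x = of_real K * lim (\<lambda>N. \<Sum>\<tau>\<in>{- int N..int N}. fexp (- \<tau>) x * a \<tau>) / (2 * of_real pi)"
            using elim by blast
          then show "g x = density_series M H l s V u v x" by (simp add: series)
        qed
      qed
      then show "AE \<omega> in lborel. \<omega> \<in> {0..<2 * pi} \<longrightarrow> convergent (density_partial_sum M H l V u v \<omega>) \<longrightarrow>
          g \<omega> = density_series M H l s V u v \<omega>"
        unfolding AE_freq_lebesgue .
    next
      assume "(\<lambda>\<tau>::int. norm (l powr (- H * of_int \<tau>) * cov_Q M V u v \<tau>)) summable_on UNIV"
      then have a: "(\<lambda>\<tau>. norm (a \<tau>)) summable_on UNIV" unfolding a_def norm_of_real real_norm_def .
      define h where "h x = lim (\<lambda>N. \<Sum>\<tau>\<in>{- int N..int N}. fexp (- \<tau>) x * a \<tau>) / (2 * of_real pi)" for x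
      have h: "integrable freq_lebesgue h" "fourier_coeff h n = a n" for n
        using fourier_coeff_absolutely_convergent[OF a] by (auto simp: h_def[abs_def])
      have eq: "density_series M H l s V u v = (\<lambda>x. of_real K * h x)"
        by (rule ext) (simp only: series h_def)
      have "fourier_coeff (\<lambda>x. of_real K * h x) n = of_real K * a n" for n
        using h(2)[of n] by (simp add: fourier_coeff_def mult.left_commute)
      then show "has_spectral_density (spectral_distribution M \<phi> u v) (density_series M H l s V u v)"
        unfolding density_iff eq using h(1) by simp
    qed
  qed
  ultimately show ?thesis by blast
qed

end
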